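(* Let $\mathfrak{g}=\mathfrak{sl}_2(\mathbb{C})$. The following four conditions on $(\mu',\mu'')\in\mathbb{C}^2$ are equivalent: (i) $\dim\mathrm{Hom}_{\mathfrak{g}}(N,M(\mu')\otimes M(\mu''))\leq 1$ for every simple $\mathfrak{g}$-module $N\in\mathcal{O}$; (ii) $\dim\mathrm{Hom}_{\mathfrak{g}}(M(\nu),M(\mu')\otimes M(\mu''))\leq 1$ for all $\nu\in\mathbb{C}$; (iii) the tensor product $M(\mu')\otimes M(\mu'')$ is self-dual, i.e. $(M(\mu')\otimes M(\mu''))^\vee\cong M(\mu')\otimes M(\mu'')$ as $\mathfrak{g}$-modules; (iv) the tensor product $M(\mu')\otimes M(\mu'')$ does not contain any reducible Verma module as a direct summand.
   Context: For $\mathfrak{g}=\mathfrak{sl}_2(\mathbb{C})$ fix a Cartan subalgebra $\mathfrak{h}$ and a Borel subalgebra $\mathfrak{b}=\mathfrak{h}+\mathfrak{n}$, and identify $\mathfrak{h}^*$ with $\mathbb{C}$ so that the unique positive root is $2$. For $\mu\in\mathbb{C}$, $M(\mu)=U(\mathfrak{g})\otimes_{U(\mathfrak{b})}\mathbb{C}_\mu$ is the Verma module of highest weight $\mu$. Tensor products are over $\mathbb{C}$ with the diagonal $\mathfrak{g}$-action. Category $\mathcal{O}$ consists of the $\mathfrak{g}$-modules that are finitely generated, $\mathfrak{h}$-semisimple and locally $\mathfrak{n}$-finite. Duality: fix an anti-involution $\tau$ of $\mathfrak{g}$ that is the identity on $\mathfrak{h}$ and interchanges the root spaces $\mathfrak{g}_\alpha$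 and $\mathfrak{g}_{-\alpha}$. For an $\mathfrak{h}$-semisimple module $M$ with weight spaces $M_\lambda$, the dual is $M^\vee:=\bigoplus_{\lambda\in\mathfrak{h}^*}\mathrm{Hom}_{\mathbb{C}}(M_\lambda,\mathbb{C})$ with $\mathfrak{g}$-action $(X\cdot f)(v):=f(\tau(X)v)$ for $X\in\mathfrak{g}$, $f\in M^\vee$, $v\in M$. *)

theory Defs
  imports
    "HOL-Analysis.Analysis"
    "HOL-Library.Poly_Mapping"
    "HOL-Algebra.QuotRing"
    "Jordan_Normal_Form.Missing_VectorSpace"
begin

abbreviation complex_ring :: "complex ring" where
  "complex_ring \<equiv> \<lparr>carrier = UNIV, mult = (*), one = 1, zero = 0, add = (+)\<rparr>"

definition complex_space :: "(complex, complex) module" where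
  "complex_space = ring.extend complex_ring (module.fields (*))"

section \<open>The Lie algebra $sl_2$\<close>

text \<open>
  All Lie algebras below are complex subspaces of the 2x2 matrices that are closed under the
  commutator. The Cartan subalgebra is the diagonal one, and a linear form on it is identified with
  its value at diag(1,-1); as the first diagonal entry is a coordinate on the Cartan subalgebra, the
  form belonging to \<open>\<nu>\<close> is \<open>H \<mapsto> \<nu> * H$1$1\<close>, and the positive root is 2.
\<close>

definition mscale :: "complex \<Rightarrow> complex^2^2 \<Rightarrow> complex^2^2" where
  "mscale c X = (\<chi> i j. c * X$i$j)"

definition commutator :: "complex^2^2 \<Rightarrow> complex^2^2 \<Rightarrow> complex^2^2" where
  "commutator X Y = X ** Y - Y ** X"

definition sl2 :: "(complex^2^2) set" where
  "sl2 = {X. trace X = 0}"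

definition cartan :: "(complex^2^2) set" where
  "cartan = {X \<in> sl2. X$1$2 = 0 \<and> X$2$1 = 0}"

definition nilradical :: "(complex^2^2) set" where
  "nilradical = {X \<in> sl2. X$1$1 = 0 \<and> X$2$2 = 0 \<and> X$2$1 = 0}"

definition borel_subalgebra :: "(complex^2^2) set" where
  "borel_subalgebra = {H + X | H X. H \<in> cartan \<and> X \<in> nilradical}"

definition root_space :: "complex \<Rightarrow> (complex^2^2) set" where
  "root_space \<alpha> = {X \<in> sl2. \<forall>H\<in>cartan. commutator H X = mscale (\<alpha> * H$1$1) X}"

definition duality_anti_involution :: "(complex^2^2 \<Rightarrow> complex^2^2) \<Rightarrow> bool" where
  "duality_anti_involution \<tau> \<longleftrightarrow>
     (\<forall>X\<in>sl2. \<tau> X \<in> sl2 \<and> \<tau> (\<tau> X) = X) \<and>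
     (\<forall>X\<in>sl2. \<forall>Y\<in>sl2. \<tau> (X + Y) = \<tau> X + \<tau> Y \<and> \<tau> (commutator X Y) = commutator (\<tau> Y) (\<tau> X)) \<and>
     (\<forall>c. \<forall>X\<in>sl2. \<tau> (mscale c X) = mscale c (\<tau> X)) \<and>
     (\<forall>H\<in>cartan. \<tau> H = H) \<and>
     \<tau> ` root_space 2 = root_space (-2) \<and> \<tau> ` root_space (-2) = root_space 2"

section \<open>Modules over a Lie algebra\<close>

text \<open>
  A module is a complex vector space together with the action of the matrices. As usual for
  HOL-Algebra modules, the ring fields \<open>mult\<close> and \<open>one\<close> carry no meaning.
\<close>

record 'v lmodule = "(complex, 'v) module" +
  act :: "complex^2^2 \<Rightarrow> 'v \<Rightarrow> 'v"

definition lie_module :: "(complex^2^2) set \<Rightarrow> 'v lmodule \<Rightarrow> bool" where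
  "lie_module L V \<longleftrightarrow>
     vectorspace complex_ring V \<and>
     (\<forall>X\<in>L. act V X \<in> module_hom complex_ring V V) \<and>
     (\<forall>X\<in>L. \<forall>Y\<in>L. \<forall>v\<in>carrier V. act V (X + Y) v = act V X v \<oplus>\<^bsub>V\<^esub> act V Y v) \<and>
     (\<forall>c. \<forall>X\<in>L. \<forall>v\<in>carrier V. act V (mscale c X) v = c \<odot>\<^bsub>V\<^esub> act V X v) \<and>
     (\<forall>X\<in>L. \<forall>Y\<in>L. \<forall>v\<in>carrier V.
        act V (commutator X Y) v = act V X (act V Y v) \<ominus>\<^bsub>V\<^esub> act V Y (act V X v))"

definition lie_submodule :: "(complex^2^2) set \<Rightarrow> 'v set \<Rightarrow> 'v lmodule \<Rightarrow> bool" where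
  "lie_submodule L W V \<longleftrightarrow>
     LinearCombinations.submodule complex_ring W V \<and> (\<forall>X\<in>L. \<forall>w\<in>W. act V X w \<in> W)"

definition generated_submodule :: "(complex^2^2) set \<Rightarrow> 'v lmodule \<Rightarrow> 'v set \<Rightarrow> 'v set" where
  "generated_submodule L V S = \<Inter>{W. lie_submodule L W V \<and> S \<subseteq> W}"

definition simple_module :: "(complex^2^2) set \<Rightarrow> 'v lmodule \<Rightarrow> bool" where
  "simple_module L V \<longleftrightarrow>
     lie_module L V \<and> carrier V \<noteq> {\<zero>\<^bsub>V\<^esub>} \<and>
     (\<forall>W. lie_submodule L W V \<longrightarrow> W = {\<zero>\<^bsub>V\<^esub>} \<or> W = carrier V)"

definition reducible_module :: "(complex^2^2) set \<Rightarrow> 'v lmodule \<Rightarrow> bool" where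
  "reducible_module L V \<longleftrightarrow>
     lie_module L V \<and> (\<exists>W. lie_submodule L W V \<and> W \<noteq> {\<zero>\<^bsub>V\<^esub>} \<and> W \<noteq> carrier V)"

text \<open>
  Homomorphisms are functions on the carrier, extended by \<open>undefined\<close>, so that they form a vector
  space.
\<close>

definition lie_hom :: "(complex^2^2) set \<Rightarrow> 'v lmodule \<Rightarrow> 'w lmodule \<Rightarrow> ('v \<Rightarrow> 'w) set" where
  "lie_hom L V W =
     {f \<in> module_hom complex_ring V W. f \<in> extensional (carrier V) \<and>
        (\<forall>X\<in>L. \<forall>v\<in>carrier V. f (act V X v) = act W X (f v))}"

definition hom_space ::
    "(complex^2^2) set \<Rightarrow> 'v lmodule \<Rightarrow> 'w lmodule \<Rightarrow> (complex, 'v \<Rightarrow> 'w) module" where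
  "hom_space L V W =
     \<lparr>carrier = lie_hom L V W,
      mult = (\<lambda>f g. \<lambda>v\<in>carrier V. \<zero>\<^bsub>W\<^esub>),
      one = (\<lambda>v\<in>carrier V. \<zero>\<^bsub>W\<^esub>),
      zero = (\<lambda>v\<in>carrier V. \<zero>\<^bsub>W\<^esub>),
      add = (\<lambda>f g. \<lambda>v\<in>carrier V. f v \<oplus>\<^bsub>W\<^esub> g v),
      smult = (\<lambda>c f. \<lambda>v\<in>carrier V. c \<odot>\<^bsub>W\<^esub> f v)\<rparr>"

text \<open>\<open>vectorspace.dim\<close> is only meaningful for finite-dimensional spaces.\<close>

definition dim_hom_le_1 :: "(complex^2^2) set \<Rightarrow> 'v lmodule \<Rightarrow> 'w lmodule \<Rightarrow> bool" where
  "dim_hom_le_1 L V W \<longleftrightarrow>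
     vectorspace.fin_dim complex_ring (hom_space L V W) \<and>
     vectorspace.dim complex_ring (hom_space L V W) \<le> 1"

definition lie_isomorphic :: "(complex^2^2) set \<Rightarrow> 'v lmodule \<Rightarrow> 'w lmodule \<Rightarrow> bool" where
  "lie_isomorphic L V W \<longleftrightarrow> (\<exists>f\<in>lie_hom L V W. bij_betw f (carrier V) (carrier W))"

definition has_direct_summand :: "(complex^2^2) set \<Rightarrow> 'v lmodule \<Rightarrow> 'w lmodule \<Rightarrow> bool" where
  "has_direct_summand L V D \<longleftrightarrow>
     (\<exists>A B. lie_submodule L A V \<and> lie_submodule L B V \<and>
        A \<inter> B = {\<zero>\<^bsub>V\<^esub>} \<and> A <+>\<^bsub>V\<^esub> B = carrier V \<and>
        lie_isomorphic L (V\<lparr>carrier := A\<rparr>) D)"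

section \<open>Quotients and free vector spaces\<close>

definition quotient_space ::
    "(complex, 'v, 'e) module_scheme \<Rightarrow> 'v set \<Rightarrow> (complex, 'v set) module" where
  "quotient_space M N =
     \<lparr>carrier = a_rcosets\<^bsub>M\<^esub> N,
      mult = rcoset_mult M N,
      one = N +>\<^bsub>M\<^esub> \<one>\<^bsub>M\<^esub>,
      zero = N,
      add = set_add M,
      smult = (\<lambda>c S. \<Union>x\<in>S. N +>\<^bsub>M\<^esub> (c \<odot>\<^bsub>M\<^esub> x))\<rparr>"

abbreviation gen :: "'x \<Rightarrow> 'x \<Rightarrow>\<^sub>0 complex" where
  "gen x \<equiv> Poly_Mapping.single x 1"

definition fscale :: "complex \<Rightarrow> ('x \<Rightarrow>\<^sub>0 complex) \<Rightarrow> ('x \<Rightarrow>\<^sub>0 complex)" where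
  "fscale c p = Poly_Mapping.map ((*) c) p"

definition linear_extension ::
    "('x \<Rightarrow> ('y \<Rightarrow>\<^sub>0 complex)) \<Rightarrow> ('x \<Rightarrow>\<^sub>0 complex) \<Rightarrow> ('y \<Rightarrow>\<^sub>0 complex)" where
  "linear_extension \<phi> p = (\<Sum>x\<in>Poly_Mapping.keys p. fscale (Poly_Mapping.lookup p x) (\<phi> x))"

definition free_space :: "'x set \<Rightarrow> (complex, 'x \<Rightarrow>\<^sub>0 complex) module" where
  "free_space A =
     \<lparr>carrier = {p. Poly_Mapping.keys p \<subseteq> A}, mult = (\<lambda>p q. 0), one = 0, zero = 0, add = (+), smult = fscale\<rparr>"

section \<open>The universal enveloping algebra\<close>

text \<open>
  The enveloping algebra is presented as the free unital associative algebra on the elements of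
  the Lie algebra, with words as its basis, modulo the two-sided ideal that makes the generators
  linear and turns commutators into brackets.
\<close>

definition free_algebra :: "'x set \<Rightarrow> (complex, 'x list \<Rightarrow>\<^sub>0 complex) module" where
  "free_algebra A = (free_space (lists A))
     \<lparr>mult := (\<lambda>p q. \<Sum>u\<in>Poly_Mapping.keys p. \<Sum>v\<in>Poly_Mapping.keys q.
                 Poly_Mapping.single (u @ v) (Poly_Mapping.lookup p u * Poly_Mapping.lookup q v)),
      one := gen []\<rparr>"

definition enveloping_ideal :: "(complex^2^2) set \<Rightarrow> ((complex^2^2) list \<Rightarrow>\<^sub>0 complex) set" where
  "enveloping_ideal L = genideal (free_algebra L)
     ({gen [X + Y] - gen [X] - gen [Y] | X Y. X \<in> L \<and> Y \<in> L} \<union>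
      {gen [mscale c X] - fscale c (gen [X]) | c X. X \<in> L} \<union>
      {gen [X, Y] - gen [Y, X] - gen [commutator X Y] | X Y. X \<in> L \<and> Y \<in> L})"

definition enveloping_algebra ::
    "(complex^2^2) set \<Rightarrow> (complex, ((complex^2^2) list \<Rightarrow>\<^sub>0 complex) set) module" where
  "enveloping_algebra L = quotient_space (free_algebra L) (enveloping_ideal L)"

definition enveloping_gen ::
    "(complex^2^2) set \<Rightarrow> complex^2^2 \<Rightarrow> ((complex^2^2) list \<Rightarrow>\<^sub>0 complex) set" where
  "enveloping_gen L X = enveloping_ideal L +>\<^bsub>free_algebra L\<^esub> gen [X]"

text \<open>The homomorphism of enveloping algebras induced by the inclusion of a subalgebra into \<open>L\<close>.\<close>

definition enveloping_incl ::
    "(complex^2^2) set \<Rightarrow> ((complex^2^2) list \<Rightarrow>\<^sub>0 complex) set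
      \<Rightarrow> ((complex^2^2) list \<Rightarrow>\<^sub>0 complex) set" where
  "enveloping_incl L S = (\<Union>p\<in>S. enveloping_ideal L +>\<^bsub>free_algebra L\<^esub> p)"

text \<open>
  The action on a Lie algebra module of a class \<open>S\<close> in the enveloping algebra; all representatives
  of \<open>S\<close> act in the same way.
\<close>

definition enveloping_act ::
    "'v lmodule \<Rightarrow> ((complex^2^2) list \<Rightarrow>\<^sub>0 complex) set \<Rightarrow> 'v \<Rightarrow> 'v" where
  "enveloping_act V S v =
     the_elem ((\<lambda>p. \<Oplus>\<^bsub>V\<^esub>w\<in>Poly_Mapping.keys p. Poly_Mapping.lookup p w \<odot>\<^bsub>V\<^esub> foldr (act V) w v) ` S)"

section \<open>Tensor products and Verma modules\<close>

definition bilinear_relations ::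
    "(complex, 'v, 'e) module_scheme \<Rightarrow> (complex, 'w, 'f) module_scheme
      \<Rightarrow> ('v \<times> 'w \<Rightarrow>\<^sub>0 complex) set" where
  "bilinear_relations V W =
     {gen (v \<oplus>\<^bsub>V\<^esub> v', w) - gen (v, w) - gen (v', w) | v v' w.
        v \<in> carrier V \<and> v' \<in> carrier V \<and> w \<in> carrier W} \<union>
     {gen (v, w \<oplus>\<^bsub>W\<^esub> w') - gen (v, w) - gen (v, w') | v w w'.
        v \<in> carrier V \<and> w \<in> carrier W \<and> w' \<in> carrier W} \<union>
     {gen (c \<odot>\<^bsub>V\<^esub> v, w) - fscale c (gen (v, w)) | c v w. v \<in> carrier V \<and> w \<in> carrier W} \<union>
     {gen (v, c \<odot>\<^bsub>W\<^esub> w) - fscale c (gen (v, w)) | c v w. v \<in> carrier V \<and> w \<in> carrier W}"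

text \<open>
  The tensor product over the complex numbers modulo the additional relations \<open>R\<close>, as a module on
  which \<open>X\<close> acts by sending the class of a pure tensor \<open>z\<close> to the class of \<open>\<phi> X z\<close>.
\<close>

definition tensor_quotient ::
    "(complex, 'v, 'e) module_scheme \<Rightarrow> (complex, 'w, 'f) module_scheme
      \<Rightarrow> ('v \<times> 'w \<Rightarrow>\<^sub>0 complex) set \<Rightarrow> (complex^2^2 \<Rightarrow> 'v \<times> 'w \<Rightarrow> ('v \<times> 'w \<Rightarrow>\<^sub>0 complex))
      \<Rightarrow> ('v \<times> 'w \<Rightarrow>\<^sub>0 complex) set lmodule" where
  "tensor_quotient V W R \<phi> =
     (let F = free_space (carrier V \<times> carrier W);
          K = LinearCombinations.module.span complex_ring F (bilinear_relations V W \<union> R)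
      in module.extend (quotient_space F K)
           (lmodule.fields (\<lambda>X S. \<Union>p\<in>S. K +>\<^bsub>F\<^esub> linear_extension (\<phi> X) p)))"

definition tensor_product ::
    "'v lmodule \<Rightarrow> 'w lmodule \<Rightarrow> ('v \<times> 'w \<Rightarrow>\<^sub>0 complex) set lmodule" where
  "tensor_product V W =
     tensor_quotient V W {} (\<lambda>X (v, w). gen (act V X v, w) + gen (v, act W X w))"

text \<open>The one-dimensional module of the Borel subalgebra of weight \<open>\<mu>\<close>.\<close>

definition weight_module :: "complex \<Rightarrow> complex lmodule" where
  "weight_module \<mu> = module.extend complex_space (lmodule.fields (\<lambda>X z. \<mu> * X$1$1 * z))"

type_synonym verma_carrier =
  "(((complex^2^2) list \<Rightarrow>\<^sub>0 complex) set \<times> complex \<Rightarrow>\<^sub>0 complex) set"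

definition verma :: "complex \<Rightarrow> verma_carrier lmodule" where
  "verma \<mu> =
     (let U = enveloping_algebra sl2; U\<^sub>b = enveloping_algebra borel_subalgebra
      in tensor_quotient U (weight_module \<mu>)
           {gen (u \<otimes>\<^bsub>U\<^esub> enveloping_incl sl2 b, z) - gen (u, enveloping_act (weight_module \<mu>) b z)
              | u b z. u \<in> carrier U \<and> b \<in> carrier U\<^sub>b}
           (\<lambda>X (u, z). gen (enveloping_gen sl2 X \<otimes>\<^bsub>U\<^esub> u, z)))"

section \<open>Weights, category O and duality\<close>

definition weight_space :: "'v lmodule \<Rightarrow> complex \<Rightarrow> 'v set" where
  "weight_space V \<nu> =
     {v \<in> carrier V. \<forall>H\<in>cartan. act V H v = (\<nu> * H$1$1) \<odot>\<^bsub>V\<^esub> v}"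

definition cartan_semisimple :: "'v lmodule \<Rightarrow> bool" where
  "cartan_semisimple V \<longleftrightarrow>
     LinearCombinations.module.span complex_ring V (\<Union>\<nu>. weight_space V \<nu>) = carrier V"

definition category_O :: "'v lmodule \<Rightarrow> bool" where
  "category_O V \<longleftrightarrow>
     lie_module sl2 V \<and>
     (\<exists>S. finite S \<and> S \<subseteq> carrier V \<and> generated_submodule sl2 V S = carrier V) \<and>
     cartan_semisimple V \<and>
     (\<forall>v\<in>carrier V.
        vectorspace.fin_dim complex_ring (V\<lparr>carrier := generated_submodule nilradical V {v}\<rparr>))"

text \<open>
  An element of the direct sum of the spaces Hom(\<open>V\<^sub>\<nu>\<close>, C) is represented by the linear form on
  \<open>V\<close> whose restrictions to the weight spaces are its components, all but finitely many of which
  vanish.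
\<close>

definition dual_module ::
    "(complex^2^2 \<Rightarrow> complex^2^2) \<Rightarrow> 'v lmodule \<Rightarrow> ('v \<Rightarrow> complex) lmodule" where
  "dual_module \<tau> V =
     \<lparr>carrier = {f \<in> module_hom complex_ring V complex_space.
                   f \<in> extensional (carrier V) \<and> finite {\<nu>. \<exists>v\<in>weight_space V \<nu>. f v \<noteq> 0}},
      mult = (\<lambda>f g. \<lambda>v\<in>carrier V. 0),
      one = (\<lambda>v\<in>carrier V. 0),
      zero = (\<lambda>v\<in>carrier V. 0),
      add = (\<lambda>f g. \<lambda>v\<in>carrier V. f v + g v),
      smult = (\<lambda>c f. \<lambda>v\<in>carrier V. c * f v),
      act = (\<lambda>X f. \<lambda>v\<in>carrier V. f (act V (\<tau> X) v))\<rparr>"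

end

theory Submission
  imports Defs
begin

text \<open>
  Let \<open>T = M(\<mu>') \<otimes> M(\<mu>'')\<close>. Each of the four conditions holds if and only if \<open>\<mu>'\<close> and \<open>\<mu>''\<close> are not
  both natural numbers.

  For highest weight vectors \<open>v\<close> and \<open>w\<close> the tensors \<open>f\<^sup>i v \<otimes> f\<^sup>j w\<close> form a basis of \<open>T\<close>. The basis
  vectors with \<open>i + j = k\<close> span a weight space, of weight \<open>\<mu>' + \<mu>'' - 2 k\<close>. The operator \<open>f\<close> is
  always injective on \<open>T\<close>, and everything depends on \<open>e\<close>, which maps \<open>(i, j)\<close> to a combination of
  \<open>(i - 1, j)\<close> and \<open>(i, j - 1)\<close> with coefficients \<open>i (\<mu>' - i + 1)\<close> and \<open>j (\<mu>'' - j + 1)\<close>.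

  Suppose that \<open>\<mu>''\<close>, say, is not a natural number. Then the second coefficient is nonzero for all
  \<open>j > 0\<close>, and by triangularity \<open>e\<close> is surjective (\<open>tensor_e_surjective\<close>), its kernel in each degree is
  at most one-dimensional (\<open>tensor_singular_unique\<close>), and its transpose is injective. Homomorphisms
  from a Verma module correspond to singular vectors of its weight, so (ii) holds; (i) follows, as a
  simple module in category O is generated by a singular vector (\<open>dim_hom_simple\<close>). A reducible Verma
  module is not a summand of \<open>T\<close>, because \<open>e\<close> is not surjective on it (\<open>no_reducible_summand\<close>). On the
  dual of \<open>T\<close> the operators \<open>e\<close> and \<open>f\<close> are, up to scalars, the transposes of \<open>f\<close> and \<open>e\<close>, so there too
  \<open>f\<close> is injective and \<open>e\<close> is surjective. This and the bound on the kernel of \<open>e\<close> suffice to build an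
  isomorphism between \<open>T\<close> and its dual degree by degree (\<open>graded_iso_step\<close>,
  \<open>tensor_model_self_dual\<close>).

  Suppose now that both are natural numbers, \<open>m\<close> and \<open>n\<close>. The transpose of \<open>e\<close> kills the basis vector
  dual to \<open>(m, n)\<close>, so \<open>f\<close> is not injective on the dual and \<open>T\<close> is not self-dual. The singular vector
  \<open>f\<^bsup>m + n + 1\<^esup> (v \<otimes> w)\<close> decomposes into two independent singular vectors
  (\<open>tensor_two_singular_vectors\<close>), whose weight \<open>- m - n - 2\<close> is not a natural number and belongs to a
  simple Verma module; so (i) and (ii) fail. Finally, an explicit projection shows that the reducible
  Verma module generated by \<open>v \<otimes> w\<close> is a direct summand (\<open>verma_summand\<close>).

  The computations take place in models on finitely supported functions. The Verma modules, their tensor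
  product and its dual are isomorphic to these models by \<open>verma_isomorphic_model\<close>,
  \<open>tensor_product_isomorphic_model\<close> and \<open>dual_isomorphic_cotensor_model\<close>, and the four conditions are
  invariant under isomorphism.
\<close>

section \<open>Linear algebra over the complex numbers\<close>

lemma complex_ring_field: "field complex_ring"
proof -
  have "abelian_group complex_ring"
  proof (rule abelian_groupI)
    fix x :: complex
    show "\<exists>y\<in>carrier complex_ring. y \<oplus>\<^bsub>complex_ring\<^esub> x = \<zero>\<^bsub>complex_ring\<^esub>"
      by (rule bexI[of _ "- x"]) simp_all
  qed (simp_all add: algebra_simps)
  then have "cring complex_ring"
    by (rule cringI) (auto intro!: comm_monoidI simp: algebra_simps)
  then show ?thesis
    by (rule cring.cring_fieldI2) (simp_all, metis right_inverse)
qed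

lemma complex_vectorspaceI:
  assumes "\<zero>\<^bsub>V\<^esub> \<in> carrier V"
    and "\<And>v w. \<lbrakk>v \<in> carrier V; w \<in> carrier V\<rbrakk> \<Longrightarrow> v \<oplus>\<^bsub>V\<^esub> w \<in> carrier V"
    and "\<And>v. v \<in> carrier V \<Longrightarrow> \<exists>w\<in>carrier V. v \<oplus>\<^bsub>V\<^esub> w = \<zero>\<^bsub>V\<^esub>"
    and "\<And>c v. v \<in> carrier V \<Longrightarrow> c \<odot>\<^bsub>V\<^esub> v \<in> carrier V"
    and "\<And>v w. \<lbrakk>v \<in> carrier V; w \<in> carrier V\<rbrakk> \<Longrightarrow> v \<oplus>\<^bsub>V\<^esub> w = w \<oplus>\<^bsub>V\<^esub> v"
    and "\<And>v w x. \<lbrakk>v \<in> carrier V; w \<in> carrier V; x \<in> carrier V\<rbrakk>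
      \<Longrightarrow> (v \<oplus>\<^bsub>V\<^esub> w) \<oplus>\<^bsub>V\<^esub> x = v \<oplus>\<^bsub>V\<^esub> (w \<oplus>\<^bsub>V\<^esub> x)"
    and "\<And>v. v \<in> carrier V \<Longrightarrow> v \<oplus>\<^bsub>V\<^esub> \<zero>\<^bsub>V\<^esub> = v"
    and "\<And>a b v. v \<in> carrier V \<Longrightarrow> (a * b) \<odot>\<^bsub>V\<^esub> v = a \<odot>\<^bsub>V\<^esub> (b \<odot>\<^bsub>V\<^esub> v)"
    and "\<And>v. v \<in> carrier V \<Longrightarrow> 1 \<odot>\<^bsub>V\<^esub> v = v"
    and "\<And>a b v. v \<in> carrier V \<Longrightarrow> (a + b) \<odot>\<^bsub>V\<^esub> v = (a \<odot>\<^bsub>V\<^esub> v) \<oplus>\<^bsub>V\<^esub> (b \<odot>\<^bsub>V\<^esub> v)"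
    and "\<And>a v w. \<lbrakk>v \<in> carrier V; w \<in> carrier V\<rbrakk>
      \<Longrightarrow> a \<odot>\<^bsub>V\<^esub> (v \<oplus>\<^bsub>V\<^esub> w) = (a \<odot>\<^bsub>V\<^esub> v) \<oplus>\<^bsub>V\<^esub> (a \<odot>\<^bsub>V\<^esub> w)"
  shows "vectorspace complex_ring V"
  by (rule vs_criteria[OF complex_ring_field]) (use assms in auto)

lemma vectorspace_image:
  assumes V: "vectorspace complex_ring V"
    and im: "q ` carrier V = carrier Q"
    and add: "\<And>x y. \<lbrakk>x \<in> carrier V; y \<in> carrier V\<rbrakk> \<Longrightarrow> q x \<oplus>\<^bsub>Q\<^esub> q y = q (x \<oplus>\<^bsub>V\<^esub> y)"
    and smult: "\<And>c x. x \<in> carrier V \<Longrightarrow> c \<odot>\<^bsub>Q\<^esub> q x = q (c \<odot>\<^bsub>V\<^esub> x)"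
    and zero: "\<zero>\<^bsub>Q\<^esub> = q \<zero>\<^bsub>V\<^esub>"
  shows "vectorspace complex_ring Q"
proof -
  interpret V: vectorspace complex_ring V by (fact V)
  have sc: "c \<odot>\<^bsub>V\<^esub> x \<in> carrier V" if "x \<in> carrier V" for c x
    using V.smult_closed[of c x] that by simp
  have repr: "\<exists>x\<in>carrier V. w = q x" if "w \<in> carrier Q" for w
    using that im by auto
  have mem: "q x \<in> carrier Q" if "x \<in> carrier V" for x
    using that im by auto
  show ?thesis
  proof (rule complex_vectorspaceI, goal_cases)
    case 1 show ?case by (simp add: zero mem)
  next
    case (2 v w) then show ?case using repr[of v] repr[of w] by (auto simp: add intro!: mem)
  next
    case (3 v)
    then obtain x where x: "x \<in> carrier V" "v = q x" using repr by blast
    have "v \<oplus>\<^bsub>Q\<^esub> q (\<ominus>\<^bsub>V\<^esub> x) = \<zero>\<^bsub>Q\<^esub>"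
      using x add[of x "\<ominus>\<^bsub>V\<^esub> x"] zero by (simp add: V.M.r_neg)
    then show ?case using x mem by (metis V.M.a_inv_closed)
  next
    case (4 c v) then show ?case using repr[of v] by (auto simp: smult intro!: mem sc)
  next
    case (5 v w) then show ?case using repr[of v] repr[of w] by (auto simp: add V.M.a_comm)
  next
    case (6 v w x) then show ?case
      using repr[of v] repr[of w] repr[of x] by (auto simp: add V.M.a_assoc)
  next
    case (7 v) then show ?case using repr[of v] by (auto simp: add zero)
  next
    case (8 a b v) then show ?case using repr[of v] V.smult_assoc1[of a b] by (auto simp: smult sc)
  next
    case (9 v) then show ?case using repr[of v] V.smult_one by (auto simp: smult)
  next
    case (10 a b v) then show ?case using repr[of v] V.smult_l_distr[of a b] by (auto simp: smult add sc)
  next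
    case (11 a v w) then show ?case
      using repr[of v] repr[of w] V.smult_r_distr[of a] by (auto simp: smult add sc)
  qed
qed

subsection \<open>Finitely supported functions\<close>

text \<open>
  The basis vector at index 0 is the unit of the convolution product. It should not be simplified to
  this unit, as only the linear structure is of interest.
\<close>

declare single_one [simp del]

lemma lookup_fscale [simp]: "Poly_Mapping.lookup (fscale c p) x = c * Poly_Mapping.lookup p x"
  unfolding fscale_def by (simp add: Poly_Mapping.map.rep_eq when_def)

lemma fscale_simps [simp]:
  "fscale 1 p = p" "fscale 0 p = 0" "fscale c 0 = 0" "fscale a (fscale b p) = fscale (a * b) p"
  by (auto intro!: poly_mapping_eqI)

lemma fscale_distribs:
  "fscale c (p + q) = fscale c p + fscale c q" "fscale c (p - q) = fscale c p - fscale c q"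
  "fscale (a + b) p = fscale a p + fscale b p" "fscale (a - b) p = fscale a p - fscale b p"
  "fscale (- a) p = - fscale a p" "fscale a (- p) = - fscale a p"
  by (auto intro!: poly_mapping_eqI simp: lookup_add lookup_minus algebra_simps)

lemma fscale_minus_one: "fscale (- 1) p = - p"
  by (simp add: fscale_distribs)

lemma fscale_sum: "fscale c (sum g S) = (\<Sum>x\<in>S. fscale c (g x))"
  by (auto intro!: poly_mapping_eqI simp: lookup_sum sum_distrib_left)

lemma fscale_eq_0_iff [simp]: "fscale c p = 0 \<longleftrightarrow> c = 0 \<or> p = 0"
  by (auto simp: poly_mapping_eq_iff fun_eq_iff)

lemma lookup_gen: "Poly_Mapping.lookup (gen x) y = (if x = y then 1 else 0)"
  by (simp add: lookup_single when_def)

lemma keys_fscale_subset: "Poly_Mapping.keys (fscale c p) \<subseteq> Poly_Mapping.keys p"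
  by (auto simp: in_keys_iff)

lemma poly_mapping_expand: "p = (\<Sum>x\<in>Poly_Mapping.keys p. fscale (Poly_Mapping.lookup p x) (gen x))"
proof (rule poly_mapping_eqI)
  fix y
  show "Poly_Mapping.lookup p y =
    Poly_Mapping.lookup (\<Sum>x\<in>Poly_Mapping.keys p. fscale (Poly_Mapping.lookup p x) (gen x)) y"
    by (simp add: lookup_sum lookup_single when_def if_distrib sum.delta' in_keys_iff cong: if_cong)
qed

lemma free_induct [consumes 1, case_names zero add scale gen]:
  assumes "Poly_Mapping.keys p \<subseteq> A"
    and zero: "P 0"
    and add: "\<And>p q. \<lbrakk>Poly_Mapping.keys p \<subseteq> A; Poly_Mapping.keys q \<subseteq> A; P p; P q\<rbrakk> \<Longrightarrow> P (p + q)"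
    and scale: "\<And>c p. \<lbrakk>Poly_Mapping.keys p \<subseteq> A; P p\<rbrakk> \<Longrightarrow> P (fscale c p)"
    and gen: "\<And>x. x \<in> A \<Longrightarrow> P (gen x)"
  shows "P p"
proof -
  have "P (\<Sum>x\<in>S. fscale (Poly_Mapping.lookup p x) (gen x)) \<and>
      Poly_Mapping.keys (\<Sum>x\<in>S. fscale (Poly_Mapping.lookup p x) (gen x)) \<subseteq> A"
    if "finite S" "S \<subseteq> A" for S
    using that
  proof (induction S rule: finite_induct)
    case empty then show ?case using zero by simp
  next
    case (insert x S)
    have k: "Poly_Mapping.keys (fscale (Poly_Mapping.lookup p x) (gen x)) \<subseteq> A"
      using keys_fscale_subset[of _ "gen x"] insert.prems by auto
    have "P (fscale (Poly_Mapping.lookup p x) (gen x))"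
      using insert.prems gen by (intro scale) auto
    moreover have "Poly_Mapping.keys (\<Sum>x\<in>S. fscale (Poly_Mapping.lookup p x) (gen x)) \<subseteq> A"
      "P (\<Sum>x\<in>S. fscale (Poly_Mapping.lookup p x) (gen x))"
      using insert by auto
    ultimately have "P (fscale (Poly_Mapping.lookup p x) (gen x)
        + (\<Sum>x\<in>S. fscale (Poly_Mapping.lookup p x) (gen x)))"
      "Poly_Mapping.keys (fscale (Poly_Mapping.lookup p x) (gen x)
        + (\<Sum>x\<in>S. fscale (Poly_Mapping.lookup p x) (gen x))) \<subseteq> A"
      using k order_trans[OF keys_add Un_least] by (blast intro!: add)+
    then show ?case
      using insert.hyps by simp
  qed
  from this[OF finite_keys assms(1)] show ?thesis
    using poly_mapping_expand[of p] by simp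
qed

definition flinear :: "(('x \<Rightarrow>\<^sub>0 complex) \<Rightarrow> ('y \<Rightarrow>\<^sub>0 complex)) \<Rightarrow> bool" where
  "flinear g \<longleftrightarrow> (\<forall>p q. g (p + q) = g p + g q) \<and> (\<forall>c p. g (fscale c p) = fscale c (g p))"

lemma flinearD:
  assumes "flinear g"
  shows "g (p + q) = g p + g q" "g (fscale c p) = fscale c (g p)" "g 0 = 0"
    "g (- p) = - g p" "g (p - q) = g p - g q"
proof -
  show a: "g (p + q) = g p + g q" and s: "g (fscale c p) = fscale c (g p)" for p q c
    using assms by (auto simp: flinear_def)
  show z: "g 0 = 0" using s[of 0 0] by simp
  show m: "g (- p) = - g p" for p using s[of "-1" p] by (simp add: fscale_distribs)
  show "g (p - q) = g p - g q" using a[of p "- q"] m by simp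
qed

lemma flinear_ops:
  "flinear (\<lambda>p. p)"
  "flinear g \<Longrightarrow> flinear h \<Longrightarrow> flinear (\<lambda>p. g p + h p)"
  "flinear g \<Longrightarrow> flinear h \<Longrightarrow> flinear (\<lambda>p. g p - h p)"
  "flinear g \<Longrightarrow> flinear (\<lambda>p. fscale c (g p))"
  by (simp_all add: flinear_def fscale_distribs algebra_simps)

lemma flinear_comp: "flinear g \<Longrightarrow> flinear h \<Longrightarrow> flinear (\<lambda>p. g (h p))"
  by (simp add: flinear_def)

lemma flinear_eqI:
  assumes "flinear g" "flinear h" "\<And>x. g (gen x) = h (gen x)"
  shows "g p = h p"
proof -
  have "Poly_Mapping.keys p \<subseteq> UNIV" by simp
  then show ?thesis
    by (induction p rule: free_induct) (simp_all add: flinearD[OF assms(1)] flinearD[OF assms(2)] assms(3))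
qed

lemma linear_extension_superset:
  assumes "finite S" "Poly_Mapping.keys p \<subseteq> S"
  shows "linear_extension \<phi> p = (\<Sum>x\<in>S. fscale (Poly_Mapping.lookup p x) (\<phi> x))"
  unfolding linear_extension_def
  by (rule sum.mono_neutral_left) (use assms in \<open>auto simp: in_keys_iff\<close>)

lemma flinear_linear_extension: "flinear (linear_extension \<phi>)"
  unfolding flinear_def
proof (intro conjI allI)
  fix p q :: "'a \<Rightarrow>\<^sub>0 complex" and c
  let ?S = "Poly_Mapping.keys p \<union> Poly_Mapping.keys q"
  have "linear_extension \<phi> (p + q) = (\<Sum>x\<in>?S. fscale (Poly_Mapping.lookup (p + q) x) (\<phi> x))"
    by (intro linear_extension_superset keys_add) auto
  also have "\<dots> = linear_extension \<phi> p + linear_extension \<phi> q"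
    by (simp add: lookup_add fscale_distribs sum.distrib linear_extension_superset[of ?S])
  finally show "linear_extension \<phi> (p + q) = linear_extension \<phi> p + linear_extension \<phi> q" .
  have "linear_extension \<phi> (fscale c p)
    = (\<Sum>x\<in>Poly_Mapping.keys p. fscale (Poly_Mapping.lookup (fscale c p) x) (\<phi> x))"
    by (intro linear_extension_superset keys_fscale_subset) auto
  then show "linear_extension \<phi> (fscale c p) = fscale c (linear_extension \<phi> p)"
    by (simp add: linear_extension_def fscale_sum)
qed

lemmas linear_extension_simps = flinearD[OF flinear_linear_extension]

lemma linear_extension_gen [simp]: "linear_extension \<phi> (gen x) = \<phi> x"
  by (simp add: linear_extension_def)

lemma keys_linear_extension:
  assumes "\<And>x. x \<in> Poly_Mapping.keys p \<Longrightarrow> Poly_Mapping.keys (\<phi> x) \<subseteq> B"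
  shows "Poly_Mapping.keys (linear_extension \<phi> p) \<subseteq> B"
  unfolding linear_extension_def
  using keys_sum[of "\<lambda>x. fscale (Poly_Mapping.lookup p x) (\<phi> x)" "Poly_Mapping.keys p"]
    keys_fscale_subset assms by fastforce

definition bilinear_extension ::
    "('x \<Rightarrow> 'y \<Rightarrow> ('z \<Rightarrow>\<^sub>0 complex)) \<Rightarrow> ('x \<Rightarrow>\<^sub>0 complex) \<Rightarrow> ('y \<Rightarrow>\<^sub>0 complex) \<Rightarrow> ('z \<Rightarrow>\<^sub>0 complex)" where
  "bilinear_extension b p q = linear_extension (\<lambda>x. linear_extension (b x) q) p"

lemma flinear_bilinear_extension:
  "flinear (\<lambda>p. bilinear_extension b p q)" "flinear (bilinear_extension b p)"
proof -
  show "flinear (\<lambda>p. bilinear_extension b p q)"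
    unfolding bilinear_extension_def by (rule flinear_linear_extension)
  have "Poly_Mapping.keys p \<subseteq> UNIV" by simp
  then show "flinear (bilinear_extension b p)"
    by (induction p rule: free_induct)
      (simp_all add: flinear_def bilinear_extension_def linear_extension_simps fscale_distribs ac_simps)
qed

lemma vectorspace_fscale:
  assumes "carrier M = {p. Poly_Mapping.keys p \<subseteq> A}" "add M = (+)" "zero M = 0" "smult M = fscale"
  shows "vectorspace complex_ring M"
proof (rule complex_vectorspaceI, goal_cases)
  case (2 v w) then show ?case using keys_add[of v w] by (auto simp: assms)
next
  case (3 v) then show ?case by (intro bexI[of _ "- v"]) (simp_all add: assms)
next
  case (4 c v) then show ?case using keys_fscale_subset[of c v] by (auto simp: assms)
qed (simp_all add: assms fscale_distribs ac_simps)

lemma vectorspace_free_space: "vectorspace complex_ring (free_space A)"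
  by (rule vectorspace_fscale[of _ A]) (simp_all add: free_space_def)

lemma free_space_simps [simp]:
  "carrier (free_space A) = {p. Poly_Mapping.keys p \<subseteq> A}"
  "add (free_space A) = (+)" "zero (free_space A) = 0" "smult (free_space A) = fscale"
  by (simp_all add: free_space_def)

definition fsubspace :: "('x \<Rightarrow>\<^sub>0 complex) set \<Rightarrow> bool" where
  "fsubspace K \<longleftrightarrow> 0 \<in> K \<and> (\<forall>p\<in>K. \<forall>q\<in>K. p + q \<in> K) \<and> (\<forall>c. \<forall>p\<in>K. fscale c p \<in> K)"

lemma fsubspaceD:
  assumes "fsubspace K"
  shows "0 \<in> K" "p \<in> K \<Longrightarrow> q \<in> K \<Longrightarrow> p + q \<in> K" "p \<in> K \<Longrightarrow> fscale c p \<in> K"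
    "p \<in> K \<Longrightarrow> - p \<in> K" "p \<in> K \<Longrightarrow> q \<in> K \<Longrightarrow> p - q \<in> K"
proof -
  show a: "p \<in> K \<Longrightarrow> q \<in> K \<Longrightarrow> p + q \<in> K" and s: "p \<in> K \<Longrightarrow> fscale c p \<in> K" and "0 \<in> K" for p q c
    using assms by (auto simp: fsubspace_def)
  show m: "p \<in> K \<Longrightarrow> - p \<in> K" for p using s[of p "-1"] by (simp add: fscale_distribs)
  show "p \<in> K \<Longrightarrow> q \<in> K \<Longrightarrow> p - q \<in> K" using a[of p "- q"] m[of q] by simp
qed

lemma fsubspace_keys: "fsubspace {p. Poly_Mapping.keys p \<subseteq> A}"
  unfolding fsubspace_def
  by (auto dest!: subsetD[OF keys_add] subsetD[OF keys_fscale_subset])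

lemma fsubspace_vimage: "flinear g \<Longrightarrow> fsubspace K \<Longrightarrow> fsubspace {p. g p \<in> K}"
  by (auto simp: fsubspace_def flinearD)

lemma fsubspace_image:
  assumes g: "flinear g" and K: "fsubspace K"
  shows "fsubspace (g ` K)"
  unfolding fsubspace_def
proof (intro conjI ballI allI)
  show "0 \<in> g ` K" using fsubspaceD(1)[OF K] flinearD(3)[OF g] by (intro image_eqI[of _ _ 0]) simp_all
next
  fix p q assume "p \<in> g ` K" "q \<in> g ` K"
  then obtain x y where "x \<in> K" "p = g x" "y \<in> K" "q = g y" by blast
  then show "p + q \<in> g ` K"
    using fsubspaceD(2)[OF K] by (intro image_eqI[of _ _ "x + y"]) (simp_all add: flinearD[OF g])
next
  fix c p assume "p \<in> g ` K"
  then obtain x where "x \<in> K" "p = g x" by blast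
  then show "fscale c p \<in> g ` K"
    using fsubspaceD(3)[OF K] by (intro image_eqI[of _ _ "fscale c x"]) (simp_all add: flinearD[OF g])
qed

lemma fsubspace_contains:
  assumes "fsubspace M" "\<And>x. x \<in> A \<Longrightarrow> gen x \<in> M" "Poly_Mapping.keys p \<subseteq> A"
  shows "p \<in> M"
  using assms(3) by (induction p rule: free_induct) (use fsubspaceD[OF assms(1)] assms(2) in auto)

text \<open>
  Subtracting \<open>d x\<close> from the diagonal operator removes \<open>x\<close> from the support and keeps the rest,
  because the eigenvalues are distinct. So the support can be cut down to a single point.
\<close>

lemma fsubspace_diagonal:
  fixes d :: "'x \<Rightarrow> complex"
  assumes K: "fsubspace K" and D: "\<And>p. p \<in> K \<Longrightarrow> linear_extension (\<lambda>x. fscale (d x) (gen x)) p \<in> K"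
    and inj: "inj d" and p: "p \<in> K" "p \<noteq> 0"
  shows "\<exists>x. gen x \<in> K"
  using p
proof (induction "card (Poly_Mapping.keys p)" arbitrary: p rule: less_induct)
  case less
  let ?D = "linear_extension (\<lambda>x. fscale (d x) (gen x))"
  have look: "Poly_Mapping.lookup (?D p) x = d x * Poly_Mapping.lookup p x" for p x
  proof -
    have "Poly_Mapping.keys p \<subseteq> UNIV" by simp
    then show ?thesis
      by (induction p rule: free_induct)
        (auto simp: linear_extension_simps lookup_add lookup_gen distrib_left mult.left_commute split: if_splits)
  qed
  obtain x where x: "x \<in> Poly_Mapping.keys p" using less.prems(2) by (metis all_not_in_conv keys_eq_empty)
  show ?case
  proof (cases "Poly_Mapping.keys p = {x}")
    case True
    have eq: "p = fscale (Poly_Mapping.lookup p x) (gen x)"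
      using poly_mapping_expand[of p] True by simp
    have "Poly_Mapping.lookup p x \<noteq> 0" using x by (simp add: in_keys_iff)
    then have "gen x = fscale (1 / Poly_Mapping.lookup p x) p" by (subst (2) eq) simp
    then show ?thesis using fsubspaceD(3)[OF K less.prems(1)] by metis
  next
    case False
    then obtain y where y: "y \<in> Poly_Mapping.keys p" "y \<noteq> x" using x by blast
    define q where "q = ?D p - fscale (d x) p"
    have lq: "Poly_Mapping.lookup q z = (d z - d x) * Poly_Mapping.lookup p z" for z
      by (simp add: q_def lookup_minus look algebra_simps)
    have "q \<in> K" unfolding q_def by (rule fsubspaceD(5)[OF K D[OF less.prems(1)] fsubspaceD(3)[OF K less.prems(1)]])
    moreover have "Poly_Mapping.keys q \<subset> Poly_Mapping.keys p"
      using x by (auto simp: in_keys_iff lq)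
    then have "card (Poly_Mapping.keys q) < card (Poly_Mapping.keys p)" by (rule psubset_card_mono[OF finite_keys])
    moreover have "Poly_Mapping.lookup q y \<noteq> 0"
      using y inj_eq[OF inj, of y x] by (simp add: lq in_keys_iff)
    then have "q \<noteq> 0" by auto
    ultimately show ?thesis using less.hyps by blast
  qed
qed

lemma submodule_free_space_iff:
  "LinearCombinations.submodule complex_ring K (free_space A)
    \<longleftrightarrow> fsubspace K \<and> K \<subseteq> {p. Poly_Mapping.keys p \<subseteq> A}"
proof -
  interpret vectorspace complex_ring "free_space A" by (rule vectorspace_free_space)
  show ?thesis
    using module_axioms by (auto simp: LinearCombinations.submodule_def fsubspace_def)
qed

text \<open>
  The spans in the definitions of quotients are used only through their universal property.
\<close>

lemma fspan_facts:
  assumes "R \<subseteq> {p. Poly_Mapping.keys p \<subseteq> A}"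
  defines "K \<equiv> LinearCombinations.module.span complex_ring (free_space A) R"
  shows "fsubspace K" "K \<subseteq> {p. Poly_Mapping.keys p \<subseteq> A}" "R \<subseteq> K"
    "\<And>L. fsubspace L \<Longrightarrow> R \<subseteq> L \<Longrightarrow> K \<subseteq> L"
proof -
  interpret vectorspace complex_ring "free_space A" by (rule vectorspace_free_space)
  have R: "R \<subseteq> carrier (free_space A)" using assms by simp
  have "LinearCombinations.submodule complex_ring K (free_space A)"
    unfolding K_def by (rule span_is_submodule[OF R])
  then show "fsubspace K" "K \<subseteq> {p. Poly_Mapping.keys p \<subseteq> A}"
    by (simp_all add: submodule_free_space_iff)
  show "R \<subseteq> K" unfolding K_def by (rule in_own_span[OF R])
  fix L :: "('a \<Rightarrow>\<^sub>0 complex) set" assume L: "fsubspace L" "R \<subseteq> L"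
  have "K \<subseteq> L \<inter> {p. Poly_Mapping.keys p \<subseteq> A}"
    unfolding K_def
  proof (rule span_is_subset)
    show "R \<subseteq> L \<inter> {p. Poly_Mapping.keys p \<subseteq> A}" using L assms by auto
    have "fsubspace {p :: 'a \<Rightarrow>\<^sub>0 complex. Poly_Mapping.keys p \<subseteq> A}"
      by (rule fsubspace_keys)
    then show "LinearCombinations.submodule complex_ring (L \<inter> {p. Poly_Mapping.keys p \<subseteq> A}) (free_space A)"
      using L by (auto simp: submodule_free_space_iff fsubspace_def)
  qed
  then show "K \<subseteq> L" by auto
qed

subsection \<open>Quotients\<close>

definition fcoset :: "('x \<Rightarrow>\<^sub>0 complex) set \<Rightarrow> ('x \<Rightarrow>\<^sub>0 complex) \<Rightarrow> ('x \<Rightarrow>\<^sub>0 complex) set" where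
  "fcoset K p = (\<lambda>k. k + p) ` K"

lemma a_r_coset_fcoset: "add M = (+) \<Longrightarrow> a_r_coset M K p = fcoset K p"
  by (auto simp: a_r_coset_def r_coset_def fcoset_def)

lemma fcoset_eq_iff:
  assumes "fsubspace K"
  shows "fcoset K p = fcoset K q \<longleftrightarrow> p - q \<in> K"
proof
  assume "fcoset K p = fcoset K q"
  then have "p \<in> fcoset K q" using fsubspaceD(1)[OF assms] by (force simp: fcoset_def)
  then show "p - q \<in> K" by (auto simp: fcoset_def)
next
  assume d: "p - q \<in> K"
  have "k + p \<in> fcoset K q" if "k \<in> K" for k
    using fsubspaceD(2)[OF assms that d] by (force simp: fcoset_def)
  moreover have "k + q \<in> fcoset K p" if "k \<in> K" for k
  proof -
    have "k + q = (k - (p - q)) + p" by simp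
    then show ?thesis using fsubspaceD(5)[OF assms that d] unfolding fcoset_def by blast
  qed
  ultimately show "fcoset K p = fcoset K q" by (auto simp: fcoset_def)
qed

lemma fcoset_zero: "fcoset K 0 = K"
  by (simp add: fcoset_def)

lemma fcoset_add:
  assumes "fsubspace K" "add M = (+)"
  shows "set_add M (fcoset K p) (fcoset K q) = fcoset K (p + q)"
proof -
  have "(\<exists>k1\<in>K. \<exists>k2\<in>K. x = (k1 + p) + (k2 + q)) \<longleftrightarrow> (\<exists>k\<in>K. x = k + (p + q))" for x
  proof
    assume "\<exists>k\<in>K. x = k + (p + q)"
    then obtain k where "k \<in> K" "x = (k + p) + (0 + q)" by (auto simp: algebra_simps)
    then show "\<exists>k1\<in>K. \<exists>k2\<in>K. x = (k1 + p) + (k2 + q)" using fsubspaceD(1)[OF assms(1)] by blast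
  next
    assume "\<exists>k1\<in>K. \<exists>k2\<in>K. x = (k1 + p) + (k2 + q)"
    then obtain k1 k2 where "k1 \<in> K" "k2 \<in> K" "x = (k1 + k2) + (p + q)" by (auto simp: algebra_simps)
    then show "\<exists>k\<in>K. x = k + (p + q)" using fsubspaceD(2)[OF assms(1)] by blast
  qed
  moreover have "x \<in> set_add M (fcoset K p) (fcoset K q) \<longleftrightarrow>
      (\<exists>k1\<in>K. \<exists>k2\<in>K. x = (k1 + p) + (k2 + q))" for x
    unfolding set_add_def' fcoset_def assms(2) by blast
  ultimately show ?thesis
    unfolding set_eq_iff fcoset_def image_iff by simp
qed

text \<open>
  The unions in the definitions of quotients all have this form: an additive map is applied to
  every representative, and the classes that arise coincide.
\<close>

lemma fcoset_map:
  assumes K: "fsubspace K" and L: "fsubspace L" and g: "\<And>p q. g (p + q) = g p + g q" "\<And>k. k \<in> K \<Longrightarrow> g k \<in> L"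
  shows "(\<Union>x\<in>fcoset K p. fcoset L (g x)) = fcoset L (g p)"
proof -
  have "fcoset L (g x) = fcoset L (g p)" if x: "x \<in> fcoset K p" for x
  proof -
    obtain k where "k \<in> K" "x = k + p" using x by (auto simp: fcoset_def)
    then show ?thesis using g by (simp add: fcoset_eq_iff[OF L])
  qed
  moreover have "p \<in> fcoset K p" using fsubspaceD(1)[OF K] by (force simp: fcoset_def)
  ultimately show ?thesis by (intro SUP_eq_const) blast+
qed

lemma quotient_space_facts:
  assumes K: "fsubspace K" and M: "add M = (+)" "smult M = fscale"
  shows "carrier (quotient_space M K) = fcoset K ` carrier M"
    "zero (quotient_space M K) = fcoset K 0"
    "add (quotient_space M K) (fcoset K p) (fcoset K q) = fcoset K (p + q)"
    "smult (quotient_space M K) c (fcoset K p) = fcoset K (fscale c p)"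
proof -
  show "carrier (quotient_space M K) = fcoset K ` carrier M"
    by (auto simp: quotient_space_def A_RCOSETS_def' a_r_coset_fcoset[OF M(1)])
  show "zero (quotient_space M K) = fcoset K 0"
    by (simp add: quotient_space_def fcoset_zero)
  show "add (quotient_space M K) (fcoset K p) (fcoset K q) = fcoset K (p + q)"
    by (simp add: quotient_space_def fcoset_add K M)
  show "smult (quotient_space M K) c (fcoset K p) = fcoset K (fscale c p)"
    using fcoset_map[OF K K, of "fscale c" p] fsubspaceD(3)[OF K]
    by (simp add: quotient_space_def M a_r_coset_fcoset fscale_distribs)
qed

section \<open>The matrices of $sl_2$\<close>

definition mat_h :: "complex^2^2" where
  "mat_h = (\<chi> i j. if i = j then (if i = 1 then 1 else - 1) else 0)"

definition mat_e :: "complex^2^2" where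
  "mat_e = (\<chi> i j. if i = 1 \<and> j = 2 then 1 else 0)"

definition mat_f :: "complex^2^2" where
  "mat_f = (\<chi> i j. if i = 2 \<and> j = 1 then 1 else 0)"

lemma mat_entries [simp]:
  "mat_h $ 1 $ 1 = 1" "mat_h $ 1 $ 2 = 0" "mat_h $ 2 $ 1 = 0" "mat_h $ 2 $ 2 = - 1"
  "mat_e $ 1 $ 1 = 0" "mat_e $ 1 $ 2 = 1" "mat_e $ 2 $ 1 = 0" "mat_e $ 2 $ 2 = 0"
  "mat_f $ 1 $ 1 = 0" "mat_f $ 1 $ 2 = 0" "mat_f $ 2 $ 1 = 1" "mat_f $ 2 $ 2 = 0"
  by (simp_all add: mat_h_def mat_e_def mat_f_def)

lemma matrix_eq2_iff: "X = Y \<longleftrightarrow> X$1$1 = Y$1$1 \<and> X$1$2 = Y$1$2 \<and> X$2$1 = Y$2$1 \<and> X$2$2 = Y$2$2"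
  for X Y :: "complex^2^2"
  by (auto simp: vec_eq_iff forall_2)

lemma mscale_entry [simp]: "mscale c X $ i $ j = c * X $ i $ j"
  by (simp add: mscale_def)

lemma commutator_entries [simp]:
  "commutator X Y $ i $ j = X$i$1 * Y$1$j + X$i$2 * Y$2$j - (Y$i$1 * X$1$j + Y$i$2 * X$2$j)"
  by (simp add: commutator_def matrix_matrix_mult_def sum_2)

lemma sl2_iff: "X \<in> sl2 \<longleftrightarrow> X$2$2 = - X$1$1"
  by (auto simp: sl2_def trace_def sum_2 add_eq_0_iff)

lemma sl2_closed:
  "X \<in> sl2 \<Longrightarrow> Y \<in> sl2 \<Longrightarrow> X + Y \<in> sl2"
  "X \<in> sl2 \<Longrightarrow> mscale c X \<in> sl2"
  "X \<in> sl2 \<Longrightarrow> Y \<in> sl2 \<Longrightarrow> commutator X Y \<in> sl2"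
  by (simp_all add: sl2_iff)

lemma mat_in_sl2 [simp]: "mat_h \<in> sl2" "mat_e \<in> sl2" "mat_f \<in> sl2"
  by (simp_all add: sl2_iff)

lemma sl2_decomp: "X \<in> sl2 \<Longrightarrow> X = mscale (X$1$1) mat_h + mscale (X$1$2) mat_e + mscale (X$2$1) mat_f"
  by (simp add: matrix_eq2_iff sl2_iff)

lemma mat_commutators:
  "commutator mat_h mat_e = mscale 2 mat_e" "commutator mat_h mat_f = mscale (- 2) mat_f"
  "commutator mat_e mat_f = mat_h"
  by (simp_all add: matrix_eq2_iff)

lemma cartan_iff: "X \<in> cartan \<longleftrightarrow> X = mscale (X$1$1) mat_h"
  by (auto simp: cartan_def sl2_iff matrix_eq2_iff)

lemma nilradical_iff: "X \<in> nilradical \<longleftrightarrow> X = mscale (X$1$2) mat_e"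
  by (auto simp: nilradical_def sl2_iff matrix_eq2_iff)

lemma borel_iff: "X \<in> borel_subalgebra \<longleftrightarrow> X$2$2 = - X$1$1 \<and> X$2$1 = 0"
proof
  assume "X \<in> borel_subalgebra"
  then show "X$2$2 = - X$1$1 \<and> X$2$1 = 0"
    by (auto simp: borel_subalgebra_def cartan_def nilradical_def sl2_iff)
next
  assume X: "X$2$2 = - X$1$1 \<and> X$2$1 = 0"
  then have "X = mscale (X$1$1) mat_h + mscale (X$1$2) mat_e"
    by (simp add: matrix_eq2_iff)
  moreover have "mscale (X$1$1) mat_h \<in> cartan" "mscale (X$1$2) mat_e \<in> nilradical"
    by (simp_all add: cartan_iff nilradical_iff matrix_eq2_iff)
  ultimately show "X \<in> borel_subalgebra" unfolding borel_subalgebra_def by blast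
qed

lemma mat_in_subalgebras [simp]:
  "mat_h \<in> cartan" "mat_e \<in> nilradical" "mat_h \<in> borel_subalgebra" "mat_e \<in> borel_subalgebra"
  by (simp_all add: cartan_iff nilradical_iff borel_iff matrix_eq2_iff)

section \<open>Modules and homomorphisms\<close>

subsection \<open>Elementary rules\<close>

lemma lie_moduleD:
  assumes "lie_module L V"
  shows "vectorspace complex_ring V"
    and "X \<in> L \<Longrightarrow> v \<in> carrier V \<Longrightarrow> act V X v \<in> carrier V"
    and "X \<in> L \<Longrightarrow> v \<in> carrier V \<Longrightarrow> w \<in> carrier V \<Longrightarrow> act V X (v \<oplus>\<^bsub>V\<^esub> w) = act V X v \<oplus>\<^bsub>V\<^esub> act V X w"
    and "X \<in> L \<Longrightarrow> v \<in> carrier V \<Longrightarrow> act V X (c \<odot>\<^bsub>V\<^esub> v) = c \<odot>\<^bsub>V\<^esub> act V X v"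
    and "X \<in> L \<Longrightarrow> Y \<in> L \<Longrightarrow> v \<in> carrier V \<Longrightarrow> act V (X + Y) v = act V X v \<oplus>\<^bsub>V\<^esub> act V Y v"
    and "X \<in> L \<Longrightarrow> v \<in> carrier V \<Longrightarrow> act V (mscale c X) v = c \<odot>\<^bsub>V\<^esub> act V X v"
    and "X \<in> L \<Longrightarrow> Y \<in> L \<Longrightarrow> v \<in> carrier V \<Longrightarrow>
      act V (commutator X Y) v = act V X (act V Y v) \<ominus>\<^bsub>V\<^esub> act V Y (act V X v)"
  using assms by (auto simp: lie_module_def module_hom_def)

lemma vectorspace_minus:
  assumes "vectorspace complex_ring V" and vw: "v \<in> carrier V" "w \<in> carrier V"
  shows "v \<ominus>\<^bsub>V\<^esub> w = v \<oplus>\<^bsub>V\<^esub> (- 1) \<odot>\<^bsub>V\<^esub> w"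
proof -
  interpret V: vectorspace complex_ring V by fact
  have "(- 1) \<odot>\<^bsub>V\<^esub> w \<oplus>\<^bsub>V\<^esub> w = \<zero>\<^bsub>V\<^esub>"
    using V.smult_l_distr[of "-1" 1 w] V.smult_one[of w] V.smult_l_null[of w] vw by simp
  then have "\<ominus>\<^bsub>V\<^esub> w = (- 1) \<odot>\<^bsub>V\<^esub> w"
    by (rule V.minus_equality) (use vw V.smult_closed[of "-1" w] in auto)
  then show ?thesis by (simp add: a_minus_def)
qed

lemma lie_module_space:
  assumes "lie_module L V"
  shows "\<zero>\<^bsub>V\<^esub> \<in> carrier V"
    and "v \<in> carrier V \<Longrightarrow> w \<in> carrier V \<Longrightarrow> v \<oplus>\<^bsub>V\<^esub> w \<in> carrier V"
    and "v \<in> carrier V \<Longrightarrow> c \<odot>\<^bsub>V\<^esub> v \<in> carrier V"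
    and "v \<in> carrier V \<Longrightarrow> 0 \<odot>\<^bsub>V\<^esub> v = \<zero>\<^bsub>V\<^esub>"
    and "v \<in> carrier V \<Longrightarrow> 1 \<odot>\<^bsub>V\<^esub> v = v"
    and "c \<odot>\<^bsub>V\<^esub> \<zero>\<^bsub>V\<^esub> = \<zero>\<^bsub>V\<^esub>"
    and "v \<in> carrier V \<Longrightarrow> (a + b) \<odot>\<^bsub>V\<^esub> v = (a \<odot>\<^bsub>V\<^esub> v) \<oplus>\<^bsub>V\<^esub> (b \<odot>\<^bsub>V\<^esub> v)"
    and "v \<in> carrier V \<Longrightarrow> w \<in> carrier V \<Longrightarrow> c \<odot>\<^bsub>V\<^esub> (v \<oplus>\<^bsub>V\<^esub> w) = (c \<odot>\<^bsub>V\<^esub> v) \<oplus>\<^bsub>V\<^esub> (c \<odot>\<^bsub>V\<^esub> w)"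
    and "v \<in> carrier V \<Longrightarrow> a \<odot>\<^bsub>V\<^esub> (b \<odot>\<^bsub>V\<^esub> v) = (a * b) \<odot>\<^bsub>V\<^esub> v"
    and "v \<in> carrier V \<Longrightarrow> w \<in> carrier V \<Longrightarrow> v \<ominus>\<^bsub>V\<^esub> w = v \<oplus>\<^bsub>V\<^esub> (- 1) \<odot>\<^bsub>V\<^esub> w"
    and "v \<in> carrier V \<Longrightarrow> v \<oplus>\<^bsub>V\<^esub> \<zero>\<^bsub>V\<^esub> = v" "v \<in> carrier V \<Longrightarrow> \<zero>\<^bsub>V\<^esub> \<oplus>\<^bsub>V\<^esub> v = v"
proof -
  interpret V: vectorspace complex_ring V by (rule lie_moduleD(1)[OF assms])
  show "\<zero>\<^bsub>V\<^esub> \<in> carrier V" "v \<in> carrier V \<Longrightarrow> w \<in> carrier V \<Longrightarrow> v \<oplus>\<^bsub>V\<^esub> w \<in> carrier V"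
    "v \<in> carrier V \<Longrightarrow> v \<oplus>\<^bsub>V\<^esub> \<zero>\<^bsub>V\<^esub> = v" "v \<in> carrier V \<Longrightarrow> \<zero>\<^bsub>V\<^esub> \<oplus>\<^bsub>V\<^esub> v = v"
    by simp_all
  show cl: "v \<in> carrier V \<Longrightarrow> c \<odot>\<^bsub>V\<^esub> v \<in> carrier V" for c v using V.smult_closed[of c v] by simp
  show z: "v \<in> carrier V \<Longrightarrow> 0 \<odot>\<^bsub>V\<^esub> v = \<zero>\<^bsub>V\<^esub>" for v using V.smult_l_null[of v] by simp
  show one: "v \<in> carrier V \<Longrightarrow> 1 \<odot>\<^bsub>V\<^esub> v = v" for v using V.smult_one[of v] by simp
  show "c \<odot>\<^bsub>V\<^esub> \<zero>\<^bsub>V\<^esub> = \<zero>\<^bsub>V\<^esub>" using V.smult_r_null[of c] by simp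
  show ld: "v \<in> carrier V \<Longrightarrow> (a + b) \<odot>\<^bsub>V\<^esub> v = (a \<odot>\<^bsub>V\<^esub> v) \<oplus>\<^bsub>V\<^esub> (b \<odot>\<^bsub>V\<^esub> v)" for a b v
    using V.smult_l_distr[of a b v] by simp
  show "v \<in> carrier V \<Longrightarrow> w \<in> carrier V \<Longrightarrow> c \<odot>\<^bsub>V\<^esub> (v \<oplus>\<^bsub>V\<^esub> w) = (c \<odot>\<^bsub>V\<^esub> v) \<oplus>\<^bsub>V\<^esub> (c \<odot>\<^bsub>V\<^esub> w)"
    using V.smult_r_distr[of c v w] by simp
  show "v \<in> carrier V \<Longrightarrow> a \<odot>\<^bsub>V\<^esub> (b \<odot>\<^bsub>V\<^esub> v) = (a * b) \<odot>\<^bsub>V\<^esub> v"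
    using V.smult_assoc1[of a b v] by simp
  show "v \<in> carrier V \<Longrightarrow> w \<in> carrier V \<Longrightarrow> v \<ominus>\<^bsub>V\<^esub> w = v \<oplus>\<^bsub>V\<^esub> (- 1) \<odot>\<^bsub>V\<^esub> w"
    using vectorspace_minus[OF lie_moduleD(1)[OF assms]] .
qed

lemma lie_module_act_zero: "lie_module L V \<Longrightarrow> X \<in> L \<Longrightarrow> act V X \<zero>\<^bsub>V\<^esub> = \<zero>\<^bsub>V\<^esub>"
  using lie_moduleD(4)[of L V X "\<zero>\<^bsub>V\<^esub>" 0] lie_module_space(1,4,6)[of L V] lie_moduleD(2)[of L V X]
  by metis

lemma lie_module_solve:
  assumes V: "lie_module L V" and vw: "v \<in> carrier V" "w \<in> carrier V"
    and eq: "a \<odot>\<^bsub>V\<^esub> v \<oplus>\<^bsub>V\<^esub> b \<odot>\<^bsub>V\<^esub> w = \<zero>\<^bsub>V\<^esub>" and "b \<noteq> 0"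
  shows "w = (- a / b) \<odot>\<^bsub>V\<^esub> v"
proof -
  interpret V: vectorspace complex_ring V by (rule lie_moduleD(1)[OF V])
  note s = lie_module_space[OF V]
  have "w = (1 / b) \<odot>\<^bsub>V\<^esub> (b \<odot>\<^bsub>V\<^esub> w)" using s vw \<open>b \<noteq> 0\<close> by simp
  also have "b \<odot>\<^bsub>V\<^esub> w = (- a) \<odot>\<^bsub>V\<^esub> v"
  proof -
    have "(- a) \<odot>\<^bsub>V\<^esub> v = (- a) \<odot>\<^bsub>V\<^esub> v \<oplus>\<^bsub>V\<^esub> (a \<odot>\<^bsub>V\<^esub> v \<oplus>\<^bsub>V\<^esub> b \<odot>\<^bsub>V\<^esub> w)"
      using eq s vw by simp
    also have "\<dots> = ((- a) \<odot>\<^bsub>V\<^esub> v \<oplus>\<^bsub>V\<^esub> a \<odot>\<^bsub>V\<^esub> v) \<oplus>\<^bsub>V\<^esub> b \<odot>\<^bsub>V\<^esub> w"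
      using V.M.a_assoc s vw by simp
    also have "(- a) \<odot>\<^bsub>V\<^esub> v \<oplus>\<^bsub>V\<^esub> a \<odot>\<^bsub>V\<^esub> v = \<zero>\<^bsub>V\<^esub>"
      using s(7)[of v "- a" a] s(4) vw by simp
    finally show ?thesis using s vw by simp
  qed
  also have "(1 / b) \<odot>\<^bsub>V\<^esub> ((- a) \<odot>\<^bsub>V\<^esub> v) = (- a / b) \<odot>\<^bsub>V\<^esub> v" using s vw by simp
  finally show ?thesis .
qed

lemma lie_homD:
  assumes "f \<in> lie_hom L V W"
  shows "v \<in> carrier V \<Longrightarrow> f v \<in> carrier W"
    and "v \<in> carrier V \<Longrightarrow> w \<in> carrier V \<Longrightarrow> f (v \<oplus>\<^bsub>V\<^esub> w) = f v \<oplus>\<^bsub>W\<^esub> f w"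
    and "v \<in> carrier V \<Longrightarrow> f (c \<odot>\<^bsub>V\<^esub> v) = c \<odot>\<^bsub>W\<^esub> f v"
    and "X \<in> L \<Longrightarrow> v \<in> carrier V \<Longrightarrow> f (act V X v) = act W X (f v)"
    and "f \<in> extensional (carrier V)"
  using assms by (auto simp: lie_hom_def module_hom_def)

lemma lie_homI:
  assumes "\<And>v. v \<in> carrier V \<Longrightarrow> f v \<in> carrier W"
    and "\<And>v w. v \<in> carrier V \<Longrightarrow> w \<in> carrier V \<Longrightarrow> f (v \<oplus>\<^bsub>V\<^esub> w) = f v \<oplus>\<^bsub>W\<^esub> f w"
    and "\<And>c v. v \<in> carrier V \<Longrightarrow> f (c \<odot>\<^bsub>V\<^esub> v) = c \<odot>\<^bsub>W\<^esub> f v"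
    and "\<And>X v. X \<in> L \<Longrightarrow> v \<in> carrier V \<Longrightarrow> f (act V X v) = act W X (f v)"
    and "f \<in> extensional (carrier V)"
  shows "f \<in> lie_hom L V W"
  using assms by (auto simp: lie_hom_def module_hom_def)

lemma lie_hom_restrictI:
  assumes V: "lie_module L V"
    and "\<And>v. v \<in> carrier V \<Longrightarrow> f v \<in> carrier W"
    and "\<And>v w. v \<in> carrier V \<Longrightarrow> w \<in> carrier V \<Longrightarrow> f (v \<oplus>\<^bsub>V\<^esub> w) = f v \<oplus>\<^bsub>W\<^esub> f w"
    and "\<And>c v. v \<in> carrier V \<Longrightarrow> f (c \<odot>\<^bsub>V\<^esub> v) = c \<odot>\<^bsub>W\<^esub> f v"
    and "\<And>X v. X \<in> L \<Longrightarrow> v \<in> carrier V \<Longrightarrow> f (act V X v) = act W X (f v)"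
  shows "restrict f (carrier V) \<in> lie_hom L V W"
  by (rule lie_homI) (simp_all add: assms lie_module_space[OF V] lie_moduleD[OF V])

lemma lie_hom_zero:
  assumes "lie_module L V" "lie_module L W" "f \<in> lie_hom L V W"
  shows "f \<zero>\<^bsub>V\<^esub> = \<zero>\<^bsub>W\<^esub>"
  using lie_homD(1,3)[OF assms(3), of "\<zero>\<^bsub>V\<^esub>"] lie_module_space(1,4,6)[OF assms(1)]
    lie_module_space(4)[OF assms(2)] by metis

lemma lie_hom_compose:
  assumes "lie_module L U" "f \<in> lie_hom L U V" "g \<in> lie_hom L V W"
  shows "(\<lambda>u\<in>carrier U. g (f u)) \<in> lie_hom L U W"
  by (rule lie_hom_restrictI[OF assms(1)]) (simp_all add: lie_homD[OF assms(2)] lie_homD[OF assms(3)])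

lemma lie_hom_inverse:
  assumes U: "lie_module L U" and f: "f \<in> lie_hom L U V" and b: "bij_betw f (carrier U) (carrier V)"
  defines "g \<equiv> \<lambda>v\<in>carrier V. inv_into (carrier U) f v"
  shows "g \<in> lie_hom L V U" "bij_betw g (carrier V) (carrier U)"
    "\<And>u. u \<in> carrier U \<Longrightarrow> g (f u) = u" "\<And>v. v \<in> carrier V \<Longrightarrow> f (g v) = v"
proof -
  have inj: "inj_on f (carrier U)" and im: "f ` carrier U = carrier V"
    using b by (auto simp: bij_betw_def)
  show gf: "g (f u) = u" if "u \<in> carrier U" for u
    using that inj lie_homD(1)[OF f] by (simp add: g_def inv_into_f_f)
  show fg: "f (g v) = v" if "v \<in> carrier V" for v
    using that im by (simp add: g_def f_inv_into_f)
  have repr: "\<exists>u\<in>carrier U. v = f u" if "v \<in> carrier V" for v using that im by auto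
  note s = lie_module_space[OF U] lie_moduleD(2)[OF U]
  show gU: "g \<in> lie_hom L V U"
  proof (rule lie_homI, goal_cases)
    case (1 v) then show ?case using repr[of v] gf by auto
  next
    case (2 v w)
    then obtain x y where "x \<in> carrier U" "v = f x" "y \<in> carrier U" "w = f y" using repr by meson
    then show ?case using gf s(2) by (simp flip: lie_homD(2)[OF f])
  next
    case (3 c v)
    then obtain x where "x \<in> carrier U" "v = f x" using repr by meson
    then show ?case using gf s(3) by (simp flip: lie_homD(3)[OF f])
  next
    case (4 X v)
    then obtain x where "x \<in> carrier U" "v = f x" using repr by meson
    then show ?case using gf s(13) 4 by (simp flip: lie_homD(4)[OF f])
  qed (simp add: g_def)
  show "bij_betw g (carrier V) (carrier U)"
    by (rule bij_betw_byWitness[of _ f]) (use gf fg lie_homD(1)[OF f] lie_homD(1)[OF gU] in auto)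
qed

lemma lie_isomorphic_refl:
  assumes "lie_module L V"
  shows "lie_isomorphic L V V"
  unfolding lie_isomorphic_def
proof (rule bexI)
  show "(\<lambda>v\<in>carrier V. v) \<in> lie_hom L V V" by (rule lie_hom_restrictI[OF assms]) auto
  show "bij_betw (\<lambda>v\<in>carrier V. v) (carrier V) (carrier V)" by (auto simp: bij_betw_def inj_on_def)
qed

lemma lie_isomorphic_sym: "lie_module L U \<Longrightarrow> lie_isomorphic L U V \<Longrightarrow> lie_isomorphic L V U"
  unfolding lie_isomorphic_def using lie_hom_inverse(1,2) by metis

lemma lie_isomorphic_trans:
  assumes "lie_module L U" "lie_isomorphic L U V" "lie_isomorphic L V W"
  shows "lie_isomorphic L U W"
proof -
  obtain f g where f: "f \<in> lie_hom L U V" "bij_betw f (carrier U) (carrier V)"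
    and g: "g \<in> lie_hom L V W" "bij_betw g (carrier V) (carrier W)"
    using assms(2,3) by (auto simp: lie_isomorphic_def)
  have "bij_betw (\<lambda>u\<in>carrier U. g (f u)) (carrier U) (carrier W)"
    using bij_betw_trans[OF f(2) g(2)]
      bij_betw_cong[of "carrier U" "\<lambda>u\<in>carrier U. g (f u)" "g \<circ> f" "carrier W"] by simp
  then show ?thesis
    unfolding lie_isomorphic_def using lie_hom_compose[OF assms(1) f(1) g(1)] by (rule bexI)
qed

text \<open>
  Module structures pass to images under intertwining surjections. Tensor products, duals and
  copies on another type are recognised as modules in this way, each as an image of an explicit
  model.
\<close>

lemma lie_module_image:
  assumes V: "lie_module L V"
    and L: "\<And>X Y. X \<in> L \<Longrightarrow> Y \<in> L \<Longrightarrow> X + Y \<in> L \<and> commutator X Y \<in> L" "\<And>c X. X \<in> L \<Longrightarrow> mscale c X \<in> L"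
    and im: "q ` carrier V = carrier Q"
    and add: "\<And>x y. \<lbrakk>x \<in> carrier V; y \<in> carrier V\<rbrakk> \<Longrightarrow> q x \<oplus>\<^bsub>Q\<^esub> q y = q (x \<oplus>\<^bsub>V\<^esub> y)"
    and smult: "\<And>c x. x \<in> carrier V \<Longrightarrow> c \<odot>\<^bsub>Q\<^esub> q x = q (c \<odot>\<^bsub>V\<^esub> x)"
    and zero: "\<zero>\<^bsub>Q\<^esub> = q \<zero>\<^bsub>V\<^esub>"
    and act: "\<And>X x. \<lbrakk>X \<in> L; x \<in> carrier V\<rbrakk> \<Longrightarrow> act Q X (q x) = q (act V X x)"
  shows "lie_module L Q"
proof -
  have vs: "vectorspace complex_ring Q"
    by (rule vectorspace_image[OF lie_moduleD(1)[OF V] im add smult zero])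
  interpret Q: vectorspace complex_ring Q by (fact vs)
  interpret V: vectorspace complex_ring V by (rule lie_moduleD(1)[OF V])
  note s = lie_module_space[OF V] and d = lie_moduleD[OF V]
  have mem: "q x \<in> carrier Q" if "x \<in> carrier V" for x using that im by auto
  have repr: "\<exists>x\<in>carrier V. w = q x" if "w \<in> carrier Q" for w using that im by auto
  have minus: "q x \<ominus>\<^bsub>Q\<^esub> q y = q (x \<ominus>\<^bsub>V\<^esub> y)" if "x \<in> carrier V" "y \<in> carrier V" for x y
  proof -
    have "\<ominus>\<^bsub>Q\<^esub> q y = q (\<ominus>\<^bsub>V\<^esub> y)"
      by (rule Q.minus_equality) (use that mem in \<open>simp_all add: add zero V.M.l_neg\<close>)
    then show ?thesis using that by (simp add: a_minus_def add)
  qed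
  show ?thesis
    unfolding lie_module_def
  proof (intro conjI ballI allI vs, goal_cases)
    case (1 X)
    show ?case
      unfolding module_hom_def
    proof (intro CollectI conjI allI impI funcsetI, goal_cases)
      case (1 v) with \<open>X \<in> L\<close> repr[of v] show ?case by (auto simp: act mem d)
    next
      case (2 v w) with \<open>X \<in> L\<close> repr[of v] repr[of w] show ?case by (auto simp: act add d s)
    next
      case (3 c v) with \<open>X \<in> L\<close> repr[of v] show ?case by (auto simp: act smult d s)
    qed
  next
    case (2 X Y v) with repr[of v] L show ?case by (auto simp: act add d)
  next
    case (3 c X v) with repr[of v] L show ?case by (auto simp: act smult d)
  next
    case (4 X Y v) with repr[of v] L show ?case by (auto simp: act minus d)
  qed
qed

lemmas sl2_module_image =
  lie_module_image[where L = sl2, OF _ conjI[OF sl2_closed(1) sl2_closed(3)] sl2_closed(2)]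

lemma sl2_act_decomp:
  assumes V: "lie_module sl2 V" and "X \<in> sl2" "v \<in> carrier V"
  shows "act V X v = X$1$1 \<odot>\<^bsub>V\<^esub> act V mat_h v \<oplus>\<^bsub>V\<^esub> X$1$2 \<odot>\<^bsub>V\<^esub> act V mat_e v \<oplus>\<^bsub>V\<^esub> X$2$1 \<odot>\<^bsub>V\<^esub> act V mat_f v"
  by (subst sl2_decomp[OF assms(2)]) (simp add: lie_moduleD[OF V] sl2_closed assms(3))

lemma sl2_hom_restrictI:
  assumes V: "lie_module sl2 V" and W: "lie_module sl2 W"
    and f: "\<And>v. v \<in> carrier V \<Longrightarrow> f v \<in> carrier W"
      "\<And>v w. v \<in> carrier V \<Longrightarrow> w \<in> carrier V \<Longrightarrow> f (v \<oplus>\<^bsub>V\<^esub> w) = f v \<oplus>\<^bsub>W\<^esub> f w"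
      "\<And>c v. v \<in> carrier V \<Longrightarrow> f (c \<odot>\<^bsub>V\<^esub> v) = c \<odot>\<^bsub>W\<^esub> f v"
    and act: "\<And>v. v \<in> carrier V \<Longrightarrow> f (act V mat_h v) = act W mat_h (f v)"
      "\<And>v. v \<in> carrier V \<Longrightarrow> f (act V mat_e v) = act W mat_e (f v)"
      "\<And>v. v \<in> carrier V \<Longrightarrow> f (act V mat_f v) = act W mat_f (f v)"
  shows "restrict f (carrier V) \<in> lie_hom sl2 V W"
proof (rule lie_hom_restrictI[OF V f])
  fix X v assume X: "X \<in> sl2" and v: "v \<in> carrier V"
  show "f (act V X v) = act W X (f v)"
    unfolding sl2_act_decomp[OF V X v] sl2_act_decomp[OF W X f(1)[OF v]]
    by (simp add: f act v lie_module_space[OF V] lie_moduleD(2)[OF V])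
qed

subsection \<open>Dimension of a space of homomorphisms\<close>

lemma vectorspace_hom_space:
  assumes V: "lie_module L V" and W: "lie_module L W"
  shows "vectorspace complex_ring (hom_space L V W)"
proof -
  interpret W: vectorspace complex_ring W by (rule lie_moduleD(1)[OF W])
  note s = lie_module_space[OF W] and d = lie_moduleD[OF W]
  note V' = lie_module_space[OF V] lie_moduleD[OF V]
  have ext: "f = g" if "f \<in> lie_hom L V W" "g \<in> lie_hom L V W" "\<And>v. v \<in> carrier V \<Longrightarrow> f v = g v" for f g
    using that lie_homD(5) extensionalityI by metis
  have z: "(\<lambda>v\<in>carrier V. \<zero>\<^bsub>W\<^esub>) \<in> lie_hom L V W"
    by (rule lie_hom_restrictI[OF V]) (simp_all add: s lie_module_act_zero[OF W])
  have a: "(\<lambda>v\<in>carrier V. f v \<oplus>\<^bsub>W\<^esub> g v) \<in> lie_hom L V W" if "f \<in> lie_hom L V W" "g \<in> lie_hom L V W" for f g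
    by (rule lie_hom_restrictI[OF V])
      (simp_all add: lie_homD[OF that(1)] lie_homD[OF that(2)] s d W.M.a_ac)
  have c: "(\<lambda>v\<in>carrier V. c \<odot>\<^bsub>W\<^esub> f v) \<in> lie_hom L V W" if "f \<in> lie_hom L V W" for c f
    by (rule lie_hom_restrictI[OF V]) (simp_all add: lie_homD[OF that] s d mult.commute)
  show ?thesis
  proof (rule complex_vectorspaceI, unfold hom_space_def, simp_all only: partial_object.simps ring.simps monoid.simps module.simps, goal_cases)
    case (3 f)
    have "(\<lambda>v\<in>carrier V. f v \<oplus>\<^bsub>W\<^esub> (\<lambda>v\<in>carrier V. (- 1) \<odot>\<^bsub>W\<^esub> f v) v) = (\<lambda>v\<in>carrier V. \<zero>\<^bsub>W\<^esub>)"
    proof (rule restrict_ext)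
      fix v assume "v \<in> carrier V"
      then show "f v \<oplus>\<^bsub>W\<^esub> (\<lambda>v\<in>carrier V. (- 1) \<odot>\<^bsub>W\<^esub> f v) v = \<zero>\<^bsub>W\<^esub>"
        using s(7)[of "f v" 1 "-1"] s lie_homD(1)[OF 3] by simp
    qed
    then show ?case using c[OF 3] by blast
  next
    case (7 f)
    show ?case by (rule ext[OF a[OF 7 z] 7]) (simp add: lie_homD(1)[OF 7] s)
  next
    case (9 f)
    show ?case by (rule ext[OF c[OF 9] 9]) (simp add: lie_homD(1)[OF 9] s)
  qed (simp_all add: z a c lie_homD(1) s W.M.a_ac cong: restrict_cong)
qed

text \<open>
  A space has dimension at most one if and only if any two of its vectors are dependent. In this
  form the condition is about pairs of homomorphisms and can be composed with isomorphisms.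
\<close>

lemma dim_hom_le_1_iff:
  assumes V: "lie_module L V" and W: "lie_module L W"
  shows "dim_hom_le_1 L V W \<longleftrightarrow> (\<forall>f\<in>lie_hom L V W. \<forall>g\<in>lie_hom L V W. \<exists>a b. (a \<noteq> 0 \<or> b \<noteq> 0) \<and>
    (\<forall>v\<in>carrier V. a \<odot>\<^bsub>W\<^esub> f v \<oplus>\<^bsub>W\<^esub> b \<odot>\<^bsub>W\<^esub> g v = \<zero>\<^bsub>W\<^esub>))"
    (is "_ \<longleftrightarrow> ?dep")
proof -
  let ?H = "hom_space L V W"
  interpret H: vectorspace complex_ring ?H by (rule vectorspace_hom_space[OF V W])
  note s = lie_module_space[OF W]
  have car: "carrier ?H = lie_hom L V W" by (simp add: hom_space_def)
  have zero: "\<zero>\<^bsub>?H\<^esub> = (\<lambda>v\<in>carrier V. \<zero>\<^bsub>W\<^esub>)" by (simp add: hom_space_def)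
  have comb: "a \<odot>\<^bsub>?H\<^esub> f \<oplus>\<^bsub>?H\<^esub> b \<odot>\<^bsub>?H\<^esub> g = (\<lambda>v\<in>carrier V. a \<odot>\<^bsub>W\<^esub> f v \<oplus>\<^bsub>W\<^esub> b \<odot>\<^bsub>W\<^esub> g v)" for a b f g
    by (auto simp: hom_space_def intro!: restrict_ext)
  show ?thesis
  proof
    assume dim: "dim_hom_le_1 L V W"
    show ?dep
    proof (intro ballI)
      fix f g assume fg: "f \<in> lie_hom L V W" "g \<in> lie_hom L V W"
      show "\<exists>a b. (a \<noteq> 0 \<or> b \<noteq> 0) \<and> (\<forall>v\<in>carrier V. a \<odot>\<^bsub>W\<^esub> f v \<oplus>\<^bsub>W\<^esub> b \<odot>\<^bsub>W\<^esub> g v = \<zero>\<^bsub>W\<^esub>)"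
      proof (cases "f = g")
        case True
        have "1 \<odot>\<^bsub>W\<^esub> f v \<oplus>\<^bsub>W\<^esub> (- 1) \<odot>\<^bsub>W\<^esub> g v = \<zero>\<^bsub>W\<^esub>" if "v \<in> carrier V" for v
          using s(7)[of "f v" 1 "-1"] s(4) lie_homD(1)[OF fg(1) that] True by simp
        then show ?thesis by (intro exI[of _ 1] exI[of _ "-1"]) auto
      next
        case False
        have sub: "{f, g} \<subseteq> carrier ?H" using fg car by auto
        have "H.lin_dep {f, g}"
        proof (rule ccontr)
          assume "\<not> H.lin_dep {f, g}"
          then have "card {f, g} \<le> H.dim"
            using H.li_le_dim(2)[OF _ sub] dim by (auto simp: dim_hom_le_1_def)
          then show False using False dim by (simp add: dim_hom_le_1_def)
        qed
        then obtain a u where a: "a \<in> {f, g} \<rightarrow> carrier complex_ring" "H.lincomb a {f, g} = \<zero>\<^bsub>?H\<^esub>"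
          "u \<in> {f, g}" "a u \<noteq> \<zero>\<^bsub>complex_ring\<^esub>"
          using H.finite_lin_dep[of "{f, g}"] sub by auto
        have "H.lincomb a {f, g} = a f \<odot>\<^bsub>?H\<^esub> f \<oplus>\<^bsub>?H\<^esub> a g \<odot>\<^bsub>?H\<^esub> g"
          unfolding H.lincomb_def using False sub H.smult_closed[of "a f" f] H.smult_closed[of "a g" g]
          by (simp add: H.M.finsum_insert)
        then have eq: "(\<lambda>v\<in>carrier V. a f \<odot>\<^bsub>W\<^esub> f v \<oplus>\<^bsub>W\<^esub> a g \<odot>\<^bsub>W\<^esub> g v) = (\<lambda>v\<in>carrier V. \<zero>\<^bsub>W\<^esub>)"
          using a(2) comb zero by simp
        have "a f \<odot>\<^bsub>W\<^esub> f v \<oplus>\<^bsub>W\<^esub> a g \<odot>\<^bsub>W\<^esub> g v = \<zero>\<^bsub>W\<^esub>" if "v \<in> carrier V" for v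
          using fun_cong[OF eq, of v] that by simp
        then show ?thesis using a(3,4) by (intro exI[of _ "a f"] exI[of _ "a g"]) auto
      qed
    qed
  next
    assume dep: ?dep
    have "\<exists>A. finite A \<and> card A \<le> 1 \<and> A \<subseteq> carrier ?H \<and> H.span A = carrier ?H"
    proof (cases "\<exists>f\<in>lie_hom L V W. f \<noteq> \<zero>\<^bsub>?H\<^esub>")
      case True
      then obtain f where f: "f \<in> lie_hom L V W" "f \<noteq> \<zero>\<^bsub>?H\<^esub>" by blast
      have sub: "{f} \<subseteq> carrier ?H" using f car by auto
      have fs: "f \<in> H.span {f}" using H.in_own_span[OF sub] by auto
      have sm: "LinearCombinations.submodule complex_ring (H.span {f}) ?H" by (rule H.span_is_submodule[OF sub])
      have "g \<in> H.span {f}" if g: "g \<in> lie_hom L V W" for g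
      proof -
        obtain a b where ab: "a \<noteq> 0 \<or> b \<noteq> 0" "\<forall>v\<in>carrier V. a \<odot>\<^bsub>W\<^esub> f v \<oplus>\<^bsub>W\<^esub> b \<odot>\<^bsub>W\<^esub> g v = \<zero>\<^bsub>W\<^esub>"
          using dep f(1) g by meson
        have "b \<noteq> 0"
        proof
          assume "b = 0"
          have "f v = \<zero>\<^bsub>W\<^esub>" if "v \<in> carrier V" for v
          proof -
            have "a \<odot>\<^bsub>W\<^esub> f v = \<zero>\<^bsub>W\<^esub>" using ab(2) that \<open>b = 0\<close> s lie_homD(1)[OF f(1)] lie_homD(1)[OF g] by simp
            then have "(1 / a) \<odot>\<^bsub>W\<^esub> (a \<odot>\<^bsub>W\<^esub> f v) = \<zero>\<^bsub>W\<^esub>" using s(6) by simp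
            then show ?thesis using ab(1) \<open>b = 0\<close> s lie_homD(1)[OF f(1) that] by simp
          qed
          then have "f = \<zero>\<^bsub>?H\<^esub>" unfolding zero using lie_homD(5)[OF f(1)]
            by (intro extensionalityI[of _ "carrier V"]) auto
          then show False using f(2) by simp
        qed
        have "g = (- a / b) \<odot>\<^bsub>?H\<^esub> f"
        proof (rule extensionalityI[of _ "carrier V"])
          show "g \<in> extensional (carrier V)" by (rule lie_homD(5)[OF g])
          show "(- a / b) \<odot>\<^bsub>?H\<^esub> f \<in> extensional (carrier V)" by (simp add: hom_space_def)
          show "g v = ((- a / b) \<odot>\<^bsub>?H\<^esub> f) v" if "v \<in> carrier V" for v
            using lie_module_solve[OF W lie_homD(1)[OF f(1) that] lie_homD(1)[OF g that] _ \<open>b \<noteq> 0\<close>, of a] ab(2) that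
            by (simp add: hom_space_def)
        qed
        then show ?thesis using sm fs by (auto simp: LinearCombinations.submodule_def)
      qed
      then show ?thesis using H.span_is_subset2[OF sub] sub car by (intro exI[of _ "{f}"]) auto
    next
      case False
      have "\<zero>\<^bsub>?H\<^esub> \<in> H.span {}" using H.span_is_submodule[of "{}"] by (auto simp: LinearCombinations.submodule_def)
      then show ?thesis using False car H.span_is_subset2[of "{}"] by (intro exI[of _ "{}"]) auto
    qed
    then obtain A where A: "finite A" "card A \<le> 1" "A \<subseteq> carrier ?H" "H.span A = carrier ?H" by blast
    have "H.fin_dim" unfolding H.fin_dim_def using A by blast
    moreover have "H.dim \<le> 1" using H.gen_ge_dim[OF A(1,3,4)] A(2) by simp
    ultimately show "dim_hom_le_1 L V W" by (simp add: dim_hom_le_1_def)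
  qed
qed

lemma dim_hom_le_1_iso:
  assumes V: "lie_module L V" and W: "lie_module L W" and V': "lie_module L V'" and W': "lie_module L W'"
    and iso: "lie_isomorphic L V V'" "lie_isomorphic L W W'" and dim: "dim_hom_le_1 L V W"
  shows "dim_hom_le_1 L V' W'"
  unfolding dim_hom_le_1_iff[OF V' W']
proof (intro ballI)
  fix f g assume fg: "f \<in> lie_hom L V' W'" "g \<in> lie_hom L V' W'"
  obtain \<alpha> \<beta> where \<alpha>: "\<alpha> \<in> lie_hom L V V'" "bij_betw \<alpha> (carrier V) (carrier V')"
    and \<beta>: "\<beta> \<in> lie_hom L W W'" "bij_betw \<beta> (carrier W) (carrier W')"
    using iso by (auto simp: lie_isomorphic_def)
  obtain \<gamma> where \<gamma>: "\<gamma> \<in> lie_hom L W' W" "\<And>w. w \<in> carrier W' \<Longrightarrow> \<beta> (\<gamma> w) = w"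
    using lie_hom_inverse[OF W \<beta>] by blast
  have "(\<lambda>v\<in>carrier V. \<gamma> (h (\<alpha> v))) \<in> lie_hom L V W" if "h \<in> lie_hom L V' W'" for h
    using lie_hom_compose[OF V \<alpha>(1) lie_hom_compose[OF V' that \<gamma>(1)]] lie_homD(1)[OF \<alpha>(1)]
    by (simp cong: restrict_cong)
  from this[OF fg(1)] this[OF fg(2)] dim[unfolded dim_hom_le_1_iff[OF V W]]
  obtain a b where ab: "a \<noteq> 0 \<or> b \<noteq> 0"
    "\<forall>v\<in>carrier V. a \<odot>\<^bsub>W\<^esub> (\<lambda>v\<in>carrier V. \<gamma> (f (\<alpha> v))) v \<oplus>\<^bsub>W\<^esub> b \<odot>\<^bsub>W\<^esub> (\<lambda>v\<in>carrier V. \<gamma> (g (\<alpha> v))) v = \<zero>\<^bsub>W\<^esub>"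
    by meson
  have "a \<odot>\<^bsub>W'\<^esub> f u \<oplus>\<^bsub>W'\<^esub> b \<odot>\<^bsub>W'\<^esub> g u = \<zero>\<^bsub>W'\<^esub>" if u: "u \<in> carrier V'" for u
  proof -
    obtain v where v: "v \<in> carrier V" "u = \<alpha> v" using \<alpha>(2) u by (auto simp: bij_betw_def)
    have m: "f u \<in> carrier W'" "g u \<in> carrier W'" using fg lie_homD(1) u by metis+
    have "\<beta> (a \<odot>\<^bsub>W\<^esub> \<gamma> (f u) \<oplus>\<^bsub>W\<^esub> b \<odot>\<^bsub>W\<^esub> \<gamma> (g u)) = \<zero>\<^bsub>W'\<^esub>"
      using ab(2) v lie_hom_zero[OF W W' \<beta>(1)] by simp
    then show ?thesis
      using m lie_homD(1)[OF \<gamma>(1)] lie_module_space(3)[OF W] \<gamma>(2) by (simp add: lie_homD(2,3)[OF \<beta>(1)])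
  qed
  then show "\<exists>a b. (a \<noteq> 0 \<or> b \<noteq> 0) \<and> (\<forall>v\<in>carrier V'. a \<odot>\<^bsub>W'\<^esub> f v \<oplus>\<^bsub>W'\<^esub> b \<odot>\<^bsub>W'\<^esub> g v = \<zero>\<^bsub>W'\<^esub>)"
    using ab(1) by blast
qed

subsection \<open>Submodules and direct summands\<close>

lemma lie_submodule_iff:
  assumes "lie_module L V"
  shows "lie_submodule L W V \<longleftrightarrow> W \<subseteq> carrier V \<and> \<zero>\<^bsub>V\<^esub> \<in> W \<and> (\<forall>v\<in>W. \<forall>w\<in>W. v \<oplus>\<^bsub>V\<^esub> w \<in> W) \<and>
    (\<forall>c. \<forall>v\<in>W. c \<odot>\<^bsub>V\<^esub> v \<in> W) \<and> (\<forall>X\<in>L. \<forall>w\<in>W. act V X w \<in> W)"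
proof -
  interpret V: vectorspace complex_ring V by (rule lie_moduleD(1)[OF assms])
  show ?thesis
    using V.module_axioms by (auto simp: lie_submodule_def LinearCombinations.submodule_def)
qed

lemma lie_module_restrict:
  assumes V: "lie_module L V" and W: "lie_submodule L W V"
  shows "lie_module L (V\<lparr>carrier := W\<rparr>)"
proof -
  interpret V: vectorspace complex_ring V by (rule lie_moduleD(1)[OF V])
  note w = W[unfolded lie_submodule_iff[OF V]]
  have vs: "vectorspace complex_ring (V\<lparr>carrier := W\<rparr>)"
    by (rule V.subspace_is_vs)
      (use W V.vectorspace_axioms in \<open>simp add: subspace_def lie_submodule_def\<close>)
  have m: "v \<ominus>\<^bsub>V\<lparr>carrier := W\<rparr>\<^esub> u = v \<ominus>\<^bsub>V\<^esub> u" if "v \<in> W" "u \<in> W" for v u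
    using vectorspace_minus[OF vs, of v u] lie_module_space(10)[OF V, of v u] that w by (simp add: subset_iff)
  show ?thesis
    unfolding lie_module_def
  proof (intro conjI ballI allI vs, goal_cases)
    case (1 X) then show ?case using w by (auto simp: module_hom_def lie_moduleD[OF V] subset_iff)
  next
    case (4 X Y v)
    then have "act V X (act V Y v) \<in> W" "act V Y (act V X v) \<in> W" "v \<in> carrier V" using w by auto
    then show ?case using 4 by (simp add: m lie_moduleD(7)[OF V])
  qed (use w in \<open>auto simp: lie_moduleD[OF V] subset_iff\<close>)
qed

lemma lie_submodule_image:
  assumes V: "lie_module L V" and W: "lie_module L W" and f: "f \<in> lie_hom L V W" and A: "lie_submodule L A V"
  shows "lie_submodule L (f ` A) W"
proof -
  note a = A[unfolded lie_submodule_iff[OF V]]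
  show ?thesis
    unfolding lie_submodule_iff[OF W]
  proof (intro conjI ballI allI, goal_cases)
    case 1 then show ?case using a lie_homD(1)[OF f] by auto
  next
    case 2 show ?case using a lie_hom_zero[OF V W f] by (metis image_eqI)
  next
    case (3 v w)
    then obtain x y where "x \<in> A" "v = f x" "y \<in> A" "w = f y" by auto
    then have "v \<oplus>\<^bsub>W\<^esub> w = f (x \<oplus>\<^bsub>V\<^esub> y)" "x \<oplus>\<^bsub>V\<^esub> y \<in> A" using a by (auto simp: lie_homD[OF f] subset_iff)
    then show ?case by blast
  next
    case (4 c v)
    then obtain x where "x \<in> A" "v = f x" by auto
    then have "c \<odot>\<^bsub>W\<^esub> v = f (c \<odot>\<^bsub>V\<^esub> x)" "c \<odot>\<^bsub>V\<^esub> x \<in> A" using a by (auto simp: lie_homD[OF f] subset_iff)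
    then show ?case by blast
  next
    case (5 X v)
    then obtain x where "x \<in> A" "v = f x" by auto
    then have "act W X v = f (act V X x)" "act V X x \<in> A"
      using a 5 by (auto simp: lie_homD[OF f] subset_iff)
    then show ?case by blast
  qed
qed

lemma lie_submodule_kernel:
  assumes V: "lie_module L V" and W: "lie_module L W" and f: "f \<in> lie_hom L V W"
  shows "lie_submodule L {v \<in> carrier V. f v = \<zero>\<^bsub>W\<^esub>} V"
  unfolding lie_submodule_iff[OF V]
  using lie_module_space[OF V] lie_module_space(1,6,11)[OF W] lie_moduleD(2)[OF V] lie_homD[OF f]
    lie_hom_zero[OF V W f] lie_module_act_zero[OF W] by auto

lemma reducible_module_iso:
  assumes V: "lie_module L V" and W: "lie_module L W" and iso: "lie_isomorphic L V W"
    and red: "reducible_module L V"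
  shows "reducible_module L W"
proof -
  obtain f where f: "f \<in> lie_hom L V W" "bij_betw f (carrier V) (carrier W)"
    using iso by (auto simp: lie_isomorphic_def)
  obtain A where A: "lie_submodule L A V" "A \<noteq> {\<zero>\<^bsub>V\<^esub>}" "A \<noteq> carrier V"
    using red by (auto simp: reducible_module_def)
  have sub: "A \<subseteq> carrier V" and "\<zero>\<^bsub>V\<^esub> \<in> A" using A(1) by (auto simp: lie_submodule_iff[OF V])
  have inj: "inj_on f (carrier V)" and im: "f ` carrier V = carrier W" using f(2) by (auto simp: bij_betw_def)
  have "f ` A \<noteq> f ` carrier V" using inj sub A(3) by (simp add: inj_on_image_eq_iff)
  moreover have "f ` A \<noteq> f ` {\<zero>\<^bsub>V\<^esub>}"
    using inj sub A(2) lie_module_space(1)[OF V] by (subst inj_on_image_eq_iff) auto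
  ultimately show ?thesis
    using lie_submodule_image[OF V W f(1) A(1)] lie_hom_zero[OF V W f(1)] im W
    unfolding reducible_module_def by (intro conjI exI[of _ "f ` A"]) simp_all
qed

lemma simple_module_iff:
  "simple_module L V \<longleftrightarrow> lie_module L V \<and> carrier V \<noteq> {\<zero>\<^bsub>V\<^esub>} \<and> \<not> reducible_module L V"
  by (auto simp: simple_module_def reducible_module_def)

text \<open>
  A direct summand isomorphic to \<open>D\<close> amounts to an inclusion of \<open>D\<close> together with a retraction.
  This form can be transported along isomorphisms by composition.\<close>

lemma has_direct_summand_iff:
  assumes V: "lie_module L V" and D: "lie_module L D"
  shows "has_direct_summand L V D \<longleftrightarrow>
    (\<exists>q\<in>lie_hom L D V. \<exists>p\<in>lie_hom L V D. \<forall>d\<in>carrier D. p (q d) = d)"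
proof
  interpret V: vectorspace complex_ring V by (rule lie_moduleD(1)[OF V])
  assume "has_direct_summand L V D"
  then obtain A B where A: "lie_submodule L A V" and B: "lie_submodule L B V"
    and AB: "A \<inter> B = {\<zero>\<^bsub>V\<^esub>}" "A <+>\<^bsub>V\<^esub> B = carrier V"
    and "lie_isomorphic L (V\<lparr>carrier := A\<rparr>) D"
    by (auto simp: has_direct_summand_def)
  then obtain f where f: "f \<in> lie_hom L (V\<lparr>carrier := A\<rparr>) D" "bij_betw f A (carrier D)"
    by (auto simp: lie_isomorphic_def)
  note a = A[unfolded lie_submodule_iff[OF V]] and b = B[unfolded lie_submodule_iff[OF V]]
  note s = lie_module_space[OF V]
  have subA: "A \<subseteq> carrier V" and subB: "B \<subseteq> carrier V" using a b by auto
  have VA: "lie_module L (V\<lparr>carrier := A\<rparr>)" by (rule lie_module_restrict[OF V A])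
  obtain q where q: "q \<in> lie_hom L D (V\<lparr>carrier := A\<rparr>)" "\<And>d. d \<in> carrier D \<Longrightarrow> f (q d) = d"
    using lie_hom_inverse(1,4)[OF VA f(1)] f(2) by auto
  note fh = lie_homD[OF f(1), simplified]
  define \<pi> where "\<pi> v = (THE x. x \<in> A \<and> (\<exists>y\<in>B. v = x \<oplus>\<^bsub>V\<^esub> y))" for v
  have pi: "\<pi> (x \<oplus>\<^bsub>V\<^esub> y) = x" if xy: "x \<in> A" "y \<in> B" for x y
    unfolding \<pi>_def
  proof (rule the_equality)
    show "x \<in> A \<and> (\<exists>y'\<in>B. x \<oplus>\<^bsub>V\<^esub> y = x \<oplus>\<^bsub>V\<^esub> y')" using xy by blast
    fix x' assume "x' \<in> A \<and> (\<exists>y'\<in>B. x \<oplus>\<^bsub>V\<^esub> y = x' \<oplus>\<^bsub>V\<^esub> y')"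
    then obtain y' where y': "x' \<in> A" "y' \<in> B" "x \<oplus>\<^bsub>V\<^esub> y = x' \<oplus>\<^bsub>V\<^esub> y'" by blast
    have car: "x \<in> carrier V" "y \<in> carrier V" "x' \<in> carrier V" "y' \<in> carrier V"
      using xy y' subA subB by auto
    have "x' \<ominus>\<^bsub>V\<^esub> x = y \<ominus>\<^bsub>V\<^esub> y'"
    proof -
      have "x' = x \<oplus>\<^bsub>V\<^esub> (y \<ominus>\<^bsub>V\<^esub> y')" using y'(3) car
        by (metis V.M.a_assoc V.M.minus_closed V.M.minus_eq V.M.a_inv_closed V.M.r_neg V.M.r_zero)
      then show ?thesis using car
        by (simp add: a_minus_def V.M.a_comm[of x] V.M.a_assoc V.M.l_neg V.M.r_neg)
    qed
    moreover have "x' \<ominus>\<^bsub>V\<^esub> x \<in> A" "y \<ominus>\<^bsub>V\<^esub> y' \<in> B"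
      using a b xy y' car by (simp_all add: s(10))
    ultimately have "x' \<ominus>\<^bsub>V\<^esub> x = \<zero>\<^bsub>V\<^esub>" using AB(1) by (metis IntI singletonD)
    then show "x' = x"
      using car V.M.a_assoc[of x' "\<ominus>\<^bsub>V\<^esub> x" x] by (simp add: a_minus_def V.M.l_neg)
  qed
  have repr: "\<exists>x\<in>A. \<exists>y\<in>B. v = x \<oplus>\<^bsub>V\<^esub> y" if "v \<in> carrier V" for v
    using that AB(2) unfolding set_add_def' by blast
  have "(\<lambda>v\<in>carrier V. f (\<pi> v)) \<in> lie_hom L V D"
  proof (rule lie_hom_restrictI[OF V], goal_cases)
    case (1 v) then show ?case using repr[of v] pi fh(1) by fastforce
  next
    case (2 v w)
    then obtain x y x' y' where xy: "x \<in> A" "y \<in> B" "v = x \<oplus>\<^bsub>V\<^esub> y" "x' \<in> A" "y' \<in> B" "w = x' \<oplus>\<^bsub>V\<^esub> y'"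
      using repr by meson
    then have "v \<oplus>\<^bsub>V\<^esub> w = (x \<oplus>\<^bsub>V\<^esub> x') \<oplus>\<^bsub>V\<^esub> (y \<oplus>\<^bsub>V\<^esub> y')"
      using subA subB by (simp add: subset_iff V.M.a_ac)
    moreover have "x \<oplus>\<^bsub>V\<^esub> x' \<in> A" "y \<oplus>\<^bsub>V\<^esub> y' \<in> B" using xy a b by auto
    ultimately show ?case using xy by (simp add: pi fh)
  next
    case (3 c v)
    then obtain x y where xy: "x \<in> A" "y \<in> B" "v = x \<oplus>\<^bsub>V\<^esub> y" using repr by meson
    then have "c \<odot>\<^bsub>V\<^esub> v = c \<odot>\<^bsub>V\<^esub> x \<oplus>\<^bsub>V\<^esub> c \<odot>\<^bsub>V\<^esub> y" using subA subB s(8) by (simp add: subset_iff)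
    moreover have "c \<odot>\<^bsub>V\<^esub> x \<in> A" "c \<odot>\<^bsub>V\<^esub> y \<in> B" using xy a b by auto
    ultimately show ?case using xy by (simp add: pi fh)
  next
    case (4 X v)
    then obtain x y where xy: "x \<in> A" "y \<in> B" "v = x \<oplus>\<^bsub>V\<^esub> y" using repr by meson
    then have "act V X v = act V X x \<oplus>\<^bsub>V\<^esub> act V X y"
      using subA subB lie_moduleD(3)[OF V 4(1)] by (simp add: subset_iff)
    moreover have "act V X x \<in> A" "act V X y \<in> B" using xy a b 4(1) by auto
    ultimately show ?case using xy 4(1) by (simp add: pi fh)
  qed
  moreover have qV: "q \<in> lie_hom L D V"
    using lie_homD[OF q(1)] subA by (intro lie_homI) auto
  moreover have "f (\<pi> (q d)) = d" if "d \<in> carrier D" for d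
  proof -
    have "q d \<in> A" using lie_homD(1)[OF q(1) that] by simp
    moreover have "\<zero>\<^bsub>V\<^esub> \<in> B" using b by auto
    ultimately have "\<pi> (q d) = q d" using pi[of "q d" "\<zero>\<^bsub>V\<^esub>"] subA s(11) by auto
    then show ?thesis using q(2)[OF that] by simp
  qed
  ultimately show "\<exists>q\<in>lie_hom L D V. \<exists>p\<in>lie_hom L V D. \<forall>d\<in>carrier D. p (q d) = d"
    using lie_homD(1)[OF qV] by (intro bexI[of _ q] bexI[of _ "\<lambda>v\<in>carrier V. f (\<pi> v)"]) auto
next
  interpret V: vectorspace complex_ring V by (rule lie_moduleD(1)[OF V])
  interpret D: vectorspace complex_ring D by (rule lie_moduleD(1)[OF D])
  assume "\<exists>q\<in>lie_hom L D V. \<exists>p\<in>lie_hom L V D. \<forall>d\<in>carrier D. p (q d) = d"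
  then obtain q p where q: "q \<in> lie_hom L D V" and p: "p \<in> lie_hom L V D"
    and pq: "\<And>d. d \<in> carrier D \<Longrightarrow> p (q d) = d" by blast
  define A where "A = q ` carrier D"
  define B where "B = {v \<in> carrier V. p v = \<zero>\<^bsub>D\<^esub>}"
  note s = lie_module_space[OF V] and sD = lie_module_space[OF D]
  have cD: "lie_submodule L (carrier D) D" using sD lie_moduleD[OF D] by (simp add: lie_submodule_iff[OF D])
  have A: "lie_submodule L A V" unfolding A_def by (rule lie_submodule_image[OF D V q cD])
  have B: "lie_submodule L B V" unfolding B_def by (rule lie_submodule_kernel[OF V D p])
  have subA: "A \<subseteq> carrier V" using A by (simp add: lie_submodule_iff[OF V])
  have "A \<inter> B = {\<zero>\<^bsub>V\<^esub>}"
  proof -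
    have "v = \<zero>\<^bsub>V\<^esub>" if "v \<in> A" "v \<in> B" for v
      using that pq lie_hom_zero[OF D V q] by (auto simp: A_def B_def)
    then show ?thesis using A B by (auto simp: lie_submodule_iff[OF V])
  qed
  moreover have "A <+>\<^bsub>V\<^esub> B = carrier V"
  proof
    show "A <+>\<^bsub>V\<^esub> B \<subseteq> carrier V" using subA by (auto simp: set_add_def' B_def)
    show "carrier V \<subseteq> A <+>\<^bsub>V\<^esub> B"
    proof
      fix v assume v: "v \<in> carrier V"
      let ?a = "q (p v)" and ?b = "v \<oplus>\<^bsub>V\<^esub> (- 1) \<odot>\<^bsub>V\<^esub> q (p v)"
      have pv: "p v \<in> carrier D" "?a \<in> carrier V" using v lie_homD(1)[OF p] lie_homD(1)[OF q] by auto
      have "p ?b = p v \<oplus>\<^bsub>D\<^esub> (- 1) \<odot>\<^bsub>D\<^esub> p v" using pv v s pq by (simp add: lie_homD[OF p])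
      then have "?b \<in> B" using pv v s sD(7)[of "p v" 1 "-1"] sD(4,5) by (simp add: B_def)
      moreover have "?a \<in> A" using pv by (simp add: A_def)
      moreover have "v = ?a \<oplus>\<^bsub>V\<^esub> ?b"
      proof -
        have "?a \<oplus>\<^bsub>V\<^esub> (- 1) \<odot>\<^bsub>V\<^esub> ?a = \<zero>\<^bsub>V\<^esub>" using s(7)[of ?a 1 "-1"] s(4,5) pv by simp
        moreover have "?a \<oplus>\<^bsub>V\<^esub> ?b = v \<oplus>\<^bsub>V\<^esub> (?a \<oplus>\<^bsub>V\<^esub> (- 1) \<odot>\<^bsub>V\<^esub> ?a)"
          using pv v s by (simp add: V.M.a_lcomm)
        ultimately show ?thesis using s v by simp
      qed
      ultimately show "v \<in> A <+>\<^bsub>V\<^esub> B" by (auto simp: set_add_def')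
    qed
  qed
  moreover have "lie_isomorphic L (V\<lparr>carrier := A\<rparr>) D"
    unfolding lie_isomorphic_def
  proof (rule bexI)
    have "restrict p (carrier (V\<lparr>carrier := A\<rparr>)) \<in> lie_hom L (V\<lparr>carrier := A\<rparr>) D"
      by (rule lie_hom_restrictI[OF lie_module_restrict[OF V A]])
        (use subA in \<open>auto simp: lie_homD[OF p] subset_iff\<close>)
    then show "restrict p A \<in> lie_hom L (V\<lparr>carrier := A\<rparr>) D" by simp
    have "bij_betw p A (carrier D)"
      by (rule bij_betw_byWitness[of _ q]) (use pq lie_homD(1)[OF q] in \<open>auto simp: A_def\<close>)
    then show "bij_betw (restrict p A) (carrier (V\<lparr>carrier := A\<rparr>)) (carrier D)"
      using bij_betw_cong[of A "restrict p A" p "carrier D"] by simp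
  qed
  ultimately show "has_direct_summand L V D"
    unfolding has_direct_summand_def using A B by blast
qed

lemma has_direct_summand_iso:
  assumes V: "lie_module L V" and V': "lie_module L V'" and D: "lie_module L D" and D': "lie_module L D'"
    and iso: "lie_isomorphic L V V'" "lie_isomorphic L D D'" and sum: "has_direct_summand L V D"
  shows "has_direct_summand L V' D'"
proof -
  obtain q p where q: "q \<in> lie_hom L D V" and p: "p \<in> lie_hom L V D"
    and pq: "\<And>d. d \<in> carrier D \<Longrightarrow> p (q d) = d"
    using sum unfolding has_direct_summand_iff[OF V D] by blast
  obtain \<alpha> where \<alpha>: "\<alpha> \<in> lie_hom L V V'" "bij_betw \<alpha> (carrier V) (carrier V')"
    using iso by (auto simp: lie_isomorphic_def)
  obtain \<beta> where \<beta>: "\<beta> \<in> lie_hom L D D'" "bij_betw \<beta> (carrier D) (carrier D')"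
    using iso by (auto simp: lie_isomorphic_def)
  obtain \<alpha>' where \<alpha>': "\<alpha>' \<in> lie_hom L V' V" "\<And>v. v \<in> carrier V \<Longrightarrow> \<alpha>' (\<alpha> v) = v"
    using lie_hom_inverse[OF V \<alpha>] by blast
  obtain \<beta>' where \<beta>': "\<beta>' \<in> lie_hom L D' D" "\<And>v. v \<in> carrier D' \<Longrightarrow> \<beta> (\<beta>' v) = v"
    using lie_hom_inverse[OF D \<beta>] by blast
  note q' = lie_hom_compose[OF D' \<beta>'(1) lie_hom_compose[OF D q \<alpha>(1)]]
  note p' = lie_hom_compose[OF V' \<alpha>'(1) lie_hom_compose[OF V p \<beta>(1)]]
  show ?thesis
    unfolding has_direct_summand_iff[OF V' D']
    by (rule bexI[OF _ q'], rule bexI[OF _ p'])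
      (simp add: lie_homD(1)[OF \<alpha>(1)] lie_homD(1)[OF \<alpha>'(1)] lie_homD(1)[OF \<beta>'(1)] lie_homD(1)[OF q]
        \<alpha>'(2) \<beta>'(2) pq)
qed

subsection \<open>Linear extensions into a module\<close>

definition free_lift ::
    "(complex, 'v, 'e) module_scheme \<Rightarrow> ('x \<Rightarrow> 'v) \<Rightarrow> ('x \<Rightarrow>\<^sub>0 complex) \<Rightarrow> 'v" where
  "free_lift V g p = (\<Oplus>\<^bsub>V\<^esub>x\<in>Poly_Mapping.keys p. Poly_Mapping.lookup p x \<odot>\<^bsub>V\<^esub> g x)"

lemma free_lift_superset:
  assumes V: "vectorspace complex_ring V" and g: "\<And>x. x \<in> A \<Longrightarrow> g x \<in> carrier V"
    and S: "finite S" "S \<subseteq> A" "Poly_Mapping.keys p \<subseteq> S"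
  shows "free_lift V g p = (\<Oplus>\<^bsub>V\<^esub>x\<in>S. Poly_Mapping.lookup p x \<odot>\<^bsub>V\<^esub> g x)"
proof -
  interpret vectorspace complex_ring V by (rule V)
  show ?thesis
  unfolding free_lift_def
proof (rule M.add.finprod_mono_neutral_cong_left[OF S(1) S(3)])
  show "\<And>i. i \<in> S - Poly_Mapping.keys p \<Longrightarrow> Poly_Mapping.lookup p i \<odot>\<^bsub>V\<^esub> g i = \<zero>\<^bsub>V\<^esub>"
    using g S smult_l_null by (auto simp: in_keys_iff)
  show "(\<lambda>x. Poly_Mapping.lookup p x \<odot>\<^bsub>V\<^esub> g x) \<in> S \<rightarrow> carrier V"
    using g S smult_closed by auto
qed simp
qed

lemma free_lift_facts:
  assumes V: "vectorspace complex_ring V" and g: "\<And>x. x \<in> A \<Longrightarrow> g x \<in> carrier V"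
    and p: "Poly_Mapping.keys p \<subseteq> A"
  shows "free_lift V g p \<in> carrier V"
    and "Poly_Mapping.keys q \<subseteq> A \<Longrightarrow> free_lift V g (p + q) = free_lift V g p \<oplus>\<^bsub>V\<^esub> free_lift V g q"
    and "free_lift V g (fscale c p) = c \<odot>\<^bsub>V\<^esub> free_lift V g p"
    and "x \<in> A \<Longrightarrow> free_lift V g (gen x) = g x"
    and "free_lift V g 0 = \<zero>\<^bsub>V\<^esub>"
proof -
  interpret vectorspace complex_ring V by (rule V)
  have cl: "a \<odot>\<^bsub>V\<^esub> g x \<in> carrier V" if "x \<in> A" for a x using g[OF that] smult_closed by auto
  show "free_lift V g p \<in> carrier V"
    unfolding free_lift_def by (rule M.finsum_closed) (use p cl in auto)
  show "free_lift V g 0 = \<zero>\<^bsub>V\<^esub>" by (simp add: free_lift_def)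
  show "x \<in> A \<Longrightarrow> free_lift V g (gen x) = g x"
    using g[of x] smult_one[of "g x"] by (simp add: free_lift_def)
  show "free_lift V g (p + q) = free_lift V g p \<oplus>\<^bsub>V\<^esub> free_lift V g q" if q: "Poly_Mapping.keys q \<subseteq> A"
  proof -
    let ?S = "Poly_Mapping.keys p \<union> Poly_Mapping.keys q"
    note S = free_lift_superset[where S = ?S, OF V g]
    have "free_lift V g (p + q) = (\<Oplus>\<^bsub>V\<^esub>x\<in>?S. Poly_Mapping.lookup (p + q) x \<odot>\<^bsub>V\<^esub> g x)"
      by (rule S) (use p q in \<open>auto dest!: subsetD[OF keys_add]\<close>)
    also have "\<dots> = (\<Oplus>\<^bsub>V\<^esub>x\<in>?S. Poly_Mapping.lookup p x \<odot>\<^bsub>V\<^esub> g x \<oplus>\<^bsub>V\<^esub> Poly_Mapping.lookup q x \<odot>\<^bsub>V\<^esub> g x)"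
    proof (rule M.finsum_cong')
      fix x assume "x \<in> ?S"
      then have "x \<in> A" using p q by auto
      then show "Poly_Mapping.lookup (p + q) x \<odot>\<^bsub>V\<^esub> g x
        = Poly_Mapping.lookup p x \<odot>\<^bsub>V\<^esub> g x \<oplus>\<^bsub>V\<^esub> Poly_Mapping.lookup q x \<odot>\<^bsub>V\<^esub> g x"
        using smult_l_distr[of "Poly_Mapping.lookup p x" "Poly_Mapping.lookup q x" "g x"] g
        by (simp add: lookup_add)
    qed (use p q cl M.a_closed in \<open>auto simp: Pi_iff subset_iff\<close>)
    also have "\<dots> = (\<Oplus>\<^bsub>V\<^esub>x\<in>?S. Poly_Mapping.lookup p x \<odot>\<^bsub>V\<^esub> g x)
        \<oplus>\<^bsub>V\<^esub> (\<Oplus>\<^bsub>V\<^esub>x\<in>?S. Poly_Mapping.lookup q x \<odot>\<^bsub>V\<^esub> g x)"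
      by (rule M.finsum_addf) (use p q cl in \<open>auto simp: Pi_iff subset_iff\<close>)
    also have "\<dots> = free_lift V g p \<oplus>\<^bsub>V\<^esub> free_lift V g q"
      using S[where p = p] S[where p = q] p q by auto
    finally show ?thesis .
  qed
  show "free_lift V g (fscale c p) = c \<odot>\<^bsub>V\<^esub> free_lift V g p"
  proof -
    have "free_lift V g (fscale c p)
        = (\<Oplus>\<^bsub>V\<^esub>x\<in>Poly_Mapping.keys p. Poly_Mapping.lookup (fscale c p) x \<odot>\<^bsub>V\<^esub> g x)"
      by (rule free_lift_superset[OF V g]) (use p in \<open>auto dest!: subsetD[OF keys_fscale_subset]\<close>)
    also have "\<dots> = (\<Oplus>\<^bsub>V\<^esub>x\<in>Poly_Mapping.keys p. c \<odot>\<^bsub>V\<^esub> (Poly_Mapping.lookup p x \<odot>\<^bsub>V\<^esub> g x))"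
    proof (rule M.finsum_cong')
      fix x assume "x \<in> Poly_Mapping.keys p"
      then have "x \<in> A" using p by auto
      then show "Poly_Mapping.lookup (fscale c p) x \<odot>\<^bsub>V\<^esub> g x = c \<odot>\<^bsub>V\<^esub> (Poly_Mapping.lookup p x \<odot>\<^bsub>V\<^esub> g x)"
        using smult_assoc1[of c "Poly_Mapping.lookup p x" "g x"] g by simp
    qed (use p cl smult_closed in \<open>auto simp: Pi_iff subset_iff\<close>)
    also have "\<dots> = c \<odot>\<^bsub>V\<^esub> (\<Oplus>\<^bsub>V\<^esub>x\<in>Poly_Mapping.keys p. Poly_Mapping.lookup p x \<odot>\<^bsub>V\<^esub> g x)"
      by (rule finsum_smult_ldistr[symmetric]) (use p cl in \<open>auto simp: Pi_iff subset_iff\<close>)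
    finally show ?thesis by (simp add: free_lift_def)
  qed
qed

section \<open>Modules of $sl_2$ on finitely supported functions\<close>

text \<open>
  The trace-zero matrix with first row \<open>(a, b)\<close> and lower left entry \<open>c\<close> is \<open>a h + b e + c f\<close>, so
  three operators describe a module.
\<close>

definition sl2_model :: "(('x \<Rightarrow>\<^sub>0 complex) \<Rightarrow> ('x \<Rightarrow>\<^sub>0 complex)) \<Rightarrow> (('x \<Rightarrow>\<^sub>0 complex) \<Rightarrow> ('x \<Rightarrow>\<^sub>0 complex))
    \<Rightarrow> (('x \<Rightarrow>\<^sub>0 complex) \<Rightarrow> ('x \<Rightarrow>\<^sub>0 complex)) \<Rightarrow> ('x \<Rightarrow>\<^sub>0 complex) lmodule" where
  "sl2_model h e f = \<lparr>carrier = UNIV, mult = (\<lambda>p q. 0), one = 0, zero = 0, add = (+), smult = fscale,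
     act = (\<lambda>X p. fscale (X$1$1) (h p) + fscale (X$1$2) (e p) + fscale (X$2$1) (f p))\<rparr>"

lemma sl2_model_simps [simp]:
  "carrier (sl2_model h e f) = UNIV" "zero (sl2_model h e f) = 0" "add (sl2_model h e f) = (+)"
  "smult (sl2_model h e f) = fscale"
  "act (sl2_model h e f) X p = fscale (X$1$1) (h p) + fscale (X$1$2) (e p) + fscale (X$2$1) (f p)"
  by (simp_all add: sl2_model_def)

lemma vectorspace_sl2_model: "vectorspace complex_ring (sl2_model h e f)"
  by (rule vectorspace_fscale[of _ UNIV]) simp_all

lemma lie_module_sl2_model:
  assumes lin: "flinear h" "flinear e" "flinear f"
    and he: "\<And>p. h (e p) = e (h p) + fscale 2 (e p)"
    and hf: "\<And>p. h (f p) = f (h p) - fscale 2 (f p)"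
    and ef: "\<And>p. e (f p) = f (e p) + h p"
  shows "lie_module sl2 (sl2_model h e f)"
  unfolding lie_module_def
proof (intro conjI ballI allI vectorspace_sl2_model, goal_cases)
  case (1 X)
  show ?case
    by (auto simp: module_hom_def flinearD[OF lin(1)] flinearD[OF lin(2)] flinearD[OF lin(3)] fscale_distribs
        mult.commute)
next
  case (2 X Y v) then show ?case by (simp add: fscale_distribs)
next
  case (3 c X v) then show ?case by (simp add: fscale_distribs)
next
  case (4 X Y v)
  have m: "u \<ominus>\<^bsub>sl2_model h e f\<^esub> w = u - w" for u w
    using vectorspace_minus[OF vectorspace_sl2_model, of u h e f w] by (simp add: fscale_minus_one)
  have X: "X $ 2 $ 2 = - X $ 1 $ 1" "Y $ 2 $ 2 = - Y $ 1 $ 1" using 4 by (simp_all add: sl2_iff)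
  show ?case
    unfolding m sl2_model_simps commutator_entries X
      flinearD[OF lin(1)] flinearD[OF lin(2)] flinearD[OF lin(3)] he hf ef
    by (rule poly_mapping_eqI) (simp add: lookup_add lookup_minus algebra_simps)
qed

lemma sl2_model_homI:
  assumes "lie_module sl2 (sl2_model h e f)" "lie_module sl2 (sl2_model h' e' f')" "flinear g"
    and "\<And>p. g (h p) = h' (g p)" "\<And>p. g (e p) = e' (g p)" "\<And>p. g (f p) = f' (g p)"
  shows "g \<in> lie_hom sl2 (sl2_model h e f) (sl2_model h' e' f')"
  using sl2_hom_restrictI[OF assms(1,2), of g] assms(4-)
  by (simp add: flinearD[OF assms(3)] restrict_def)

definition vlinear :: "(complex, 'v, 'e) module_scheme \<Rightarrow> (('x \<Rightarrow>\<^sub>0 complex) \<Rightarrow> 'v) \<Rightarrow> bool" where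
  "vlinear V g \<longleftrightarrow> (\<forall>p. g p \<in> carrier V) \<and> (\<forall>p q. g (p + q) = g p \<oplus>\<^bsub>V\<^esub> g q) \<and>
    (\<forall>c p. g (fscale c p) = c \<odot>\<^bsub>V\<^esub> g p)"

lemma vlinear_eqI:
  assumes "vlinear V g" "vlinear V h" "\<And>x. g (gen x) = h (gen x)"
  shows "g p = h p"
proof -
  have "Poly_Mapping.keys p \<subseteq> UNIV" by simp
  then show ?thesis
  proof (induction p rule: free_induct)
    case zero
    have "g (fscale 0 (gen x)) = h (fscale 0 (gen x))" for x
      using assms unfolding vlinear_def by metis
    then show ?case by simp
  qed (use assms in \<open>simp_all add: vlinear_def\<close>)
qed

lemma vlinear_free_lift:
  assumes "vectorspace complex_ring V" "\<And>x. g x \<in> carrier V"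
  shows "vlinear V (free_lift V g)"
  using free_lift_facts[where A = UNIV and g = g, OF assms] by (simp add: vlinear_def)

lemma free_lift_gen:
  assumes "vectorspace complex_ring V" "\<And>x. g x \<in> carrier V"
  shows "free_lift V g (gen x) = g x"
  using free_lift_facts(4)[where A = UNIV and g = g, OF assms, of 0 x] by simp

lemma vlinear_flinear: "vlinear V g \<Longrightarrow> flinear k \<Longrightarrow> vlinear V (\<lambda>p. g (k p))"
  by (simp add: vlinear_def flinear_def)

lemma vlinear_act: "lie_module L V \<Longrightarrow> X \<in> L \<Longrightarrow> vlinear V g \<Longrightarrow> vlinear V (\<lambda>p. act V X (g p))"
  by (simp add: vlinear_def lie_moduleD)

lemma vlinear_hom:
  "f \<in> lie_hom L (sl2_model h e k) V \<Longrightarrow> vlinear V f"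
  using lie_homD(1-3)[of f L "sl2_model h e k" V] by (simp add: vlinear_def)

lemma vlinear_hom_comp:
  "f \<in> lie_hom L V W \<Longrightarrow> vlinear V g \<Longrightarrow> vlinear W (\<lambda>p. f (g p))"
  by (simp add: vlinear_def lie_homD)

section \<open>Highest weight modules\<close>

lemma funpow_act_closed:
  "lie_module L V \<Longrightarrow> X \<in> L \<Longrightarrow> v \<in> carrier V \<Longrightarrow> (act V X ^^ i) v \<in> carrier V"
  by (induction i) (simp_all add: lie_moduleD(2))

lemma act_commute:
  assumes V: "lie_module L V" and XY: "X \<in> L" "Y \<in> L" "v \<in> carrier V"
  shows "act V X (act V Y v) = act V (commutator X Y) v \<oplus>\<^bsub>V\<^esub> act V Y (act V X v)"
proof -
  interpret V: vectorspace complex_ring V by (rule lie_moduleD(1)[OF V])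
  have "act V X (act V Y v) \<in> carrier V" "act V Y (act V X v) \<in> carrier V"
    using XY lie_moduleD(2)[OF V] by auto
  then show ?thesis
    unfolding lie_moduleD(7)[OF V XY] by (simp add: a_minus_def V.M.a_assoc V.M.l_neg)
qed

lemma sl2_commute:
  assumes V: "lie_module sl2 V" and v: "v \<in> carrier V"
  shows "act V mat_h (act V mat_e v) = 2 \<odot>\<^bsub>V\<^esub> act V mat_e v \<oplus>\<^bsub>V\<^esub> act V mat_e (act V mat_h v)"
    and "act V mat_h (act V mat_f v) = (- 2) \<odot>\<^bsub>V\<^esub> act V mat_f v \<oplus>\<^bsub>V\<^esub> act V mat_f (act V mat_h v)"
    and "act V mat_e (act V mat_f v) = act V mat_h v \<oplus>\<^bsub>V\<^esub> act V mat_f (act V mat_e v)"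
  using v by (simp_all add: act_commute[OF V, of mat_h mat_e] act_commute[OF V, of mat_h mat_f]
      act_commute[OF V, of mat_e mat_f] mat_commutators lie_moduleD(6)[OF V])

definition singular_vector :: "'v lmodule \<Rightarrow> complex \<Rightarrow> 'v \<Rightarrow> bool" where
  "singular_vector V \<nu> v \<longleftrightarrow> v \<in> carrier V \<and> act V mat_e v = \<zero>\<^bsub>V\<^esub> \<and> act V mat_h v = \<nu> \<odot>\<^bsub>V\<^esub> v"

text \<open>
  Induction on \<open>i\<close>, moving \<open>h\<close> and \<open>e\<close> past one more factor \<open>f\<close>. At \<open>i = 0\<close> the truncated exponent
  \<open>i - 1\<close> does not matter, since the coefficient vanishes.
\<close>

lemma act_f_pow:
  assumes V: "lie_module sl2 V" and v: "singular_vector V \<nu> v"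
  shows "act V mat_h ((act V mat_f ^^ i) v) = (\<nu> - 2 * of_nat i) \<odot>\<^bsub>V\<^esub> (act V mat_f ^^ i) v"
    and "act V mat_e ((act V mat_f ^^ i) v) = (of_nat i * (\<nu> - of_nat i + 1)) \<odot>\<^bsub>V\<^esub> (act V mat_f ^^ (i - 1)) v"
proof -
  have vc: "v \<in> carrier V" using v by (simp add: singular_vector_def)
  note cl = funpow_act_closed[OF V mat_in_sl2(3) vc] and s = lie_module_space[OF V] and d = lie_moduleD[OF V]
  show h: "act V mat_h ((act V mat_f ^^ i) v) = (\<nu> - 2 * of_nat i) \<odot>\<^bsub>V\<^esub> (act V mat_f ^^ i) v" for i
  proof (induction i)
    case 0 then show ?case using v by (simp add: singular_vector_def)
  next
    case (Suc i)
    let ?w = "(act V mat_f ^^ i) v"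
    have "act V mat_h (act V mat_f ?w)
      = (- 2) \<odot>\<^bsub>V\<^esub> act V mat_f ?w \<oplus>\<^bsub>V\<^esub> (\<nu> - 2 * of_nat i) \<odot>\<^bsub>V\<^esub> act V mat_f ?w"
      using sl2_commute(2)[OF V cl] Suc cl d by simp
    also have "\<dots> = (\<nu> - 2 * of_nat (Suc i)) \<odot>\<^bsub>V\<^esub> act V mat_f ?w"
      using d(2) cl by (simp flip: s(7) add: algebra_simps)
    finally show ?case by simp
  qed
  show "act V mat_e ((act V mat_f ^^ i) v)
      = (of_nat i * (\<nu> - of_nat i + 1)) \<odot>\<^bsub>V\<^esub> (act V mat_f ^^ (i - 1)) v"
  proof (induction i)
    case 0 then show ?case using v vc s(4) by (simp add: singular_vector_def)
  next
    case (Suc i)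
    let ?w = "(act V mat_f ^^ i) v"
    have fe: "act V mat_f (act V mat_e ?w) = (of_nat i * (\<nu> - of_nat i + 1)) \<odot>\<^bsub>V\<^esub> ?w"
    proof (cases i)
      case 0 then show ?thesis using v vc s(4) lie_module_act_zero[OF V] by (simp add: singular_vector_def)
    next
      case (Suc j)
      then show ?thesis using Suc.IH cl d by simp
    qed
    have "act V mat_e (act V mat_f ?w)
      = (\<nu> - 2 * of_nat i) \<odot>\<^bsub>V\<^esub> ?w \<oplus>\<^bsub>V\<^esub> (of_nat i * (\<nu> - of_nat i + 1)) \<odot>\<^bsub>V\<^esub> ?w"
      using sl2_commute(3)[OF V cl] h fe by simp
    also have "\<dots> = (of_nat (Suc i) * (\<nu> - of_nat (Suc i) + 1)) \<odot>\<^bsub>V\<^esub> ?w"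
      using cl by (simp flip: s(7) add: algebra_simps)
    finally show ?case by simp
  qed
qed

subsection \<open>The Verma module on finitely supported sequences\<close>

text \<open>
  The basis element \<open>i\<close> plays the part of \<open>f\<^sup>i v\<close> for a highest weight vector \<open>v\<close>; the coefficients
  are those of \<open>act_f_pow\<close>.
\<close>

definition verma_h :: "complex \<Rightarrow> (nat \<Rightarrow>\<^sub>0 complex) \<Rightarrow> (nat \<Rightarrow>\<^sub>0 complex)" where
  "verma_h \<nu> = linear_extension (\<lambda>i. fscale (\<nu> - 2 * of_nat i) (gen i))"

definition verma_e :: "complex \<Rightarrow> (nat \<Rightarrow>\<^sub>0 complex) \<Rightarrow> (nat \<Rightarrow>\<^sub>0 complex)" where
  "verma_e \<nu> = linear_extension (\<lambda>i. fscale (of_nat i * (\<nu> - of_nat i + 1)) (gen (i - 1)))"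

definition verma_f :: "(nat \<Rightarrow>\<^sub>0 complex) \<Rightarrow> (nat \<Rightarrow>\<^sub>0 complex)" where
  "verma_f = linear_extension (\<lambda>i. gen (Suc i))"

definition verma_model :: "complex \<Rightarrow> (nat \<Rightarrow>\<^sub>0 complex) lmodule" where
  "verma_model \<nu> = sl2_model (verma_h \<nu>) (verma_e \<nu>) verma_f"

lemma flinear_verma [simp]: "flinear (verma_h \<nu>)" "flinear (verma_e \<nu>)" "flinear verma_f"
  by (simp_all add: verma_h_def verma_e_def verma_f_def flinear_linear_extension)

lemma verma_gen [simp]:
  "verma_h \<nu> (gen i) = fscale (\<nu> - 2 * of_nat i) (gen i)"
  "verma_e \<nu> (gen i) = fscale (of_nat i * (\<nu> - of_nat i + 1)) (gen (i - 1))"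
  "verma_f (gen i) = gen (Suc i)"
  by (simp_all add: verma_h_def verma_e_def verma_f_def)

lemmas verma_linear [simp] = flinearD[OF flinear_verma(1)] flinearD[OF flinear_verma(2)] flinearD[OF flinear_verma(3)]

lemma lie_module_verma_model: "lie_module sl2 (verma_model \<nu>)"
  unfolding verma_model_def
proof (rule lie_module_sl2_model)
  show "verma_h \<nu> (verma_e \<nu> p) = verma_e \<nu> (verma_h \<nu> p) + fscale 2 (verma_e \<nu> p)" for p
  proof (rule flinear_eqI[of "\<lambda>p. verma_h \<nu> (verma_e \<nu> p)" "\<lambda>p. verma_e \<nu> (verma_h \<nu> p) + fscale 2 (verma_e \<nu> p)"])
    fix i show "verma_h \<nu> (verma_e \<nu> (gen i)) = verma_e \<nu> (verma_h \<nu> (gen i)) + fscale 2 (verma_e \<nu> (gen i))"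
      by (cases i) (simp_all flip: fscale_distribs(3,4) add: algebra_simps)
  qed (simp_all add: flinear_def fscale_distribs ac_simps)
  show "verma_h \<nu> (verma_f p) = verma_f (verma_h \<nu> p) - fscale 2 (verma_f p)" for p
    by (rule flinear_eqI[of "\<lambda>p. verma_h \<nu> (verma_f p)" "\<lambda>p. verma_f (verma_h \<nu> p) - fscale 2 (verma_f p)"])
      (simp_all flip: fscale_distribs(3,4) add: flinear_def fscale_distribs(1,2) algebra_simps)
  show "verma_e \<nu> (verma_f p) = verma_f (verma_e \<nu> p) + verma_h \<nu> p" for p
  proof (rule flinear_eqI[of "\<lambda>p. verma_e \<nu> (verma_f p)" "\<lambda>p. verma_f (verma_e \<nu> p) + verma_h \<nu> p"])
    fix i show "verma_e \<nu> (verma_f (gen i)) = verma_f (verma_e \<nu> (gen i)) + verma_h \<nu> (gen i)"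
      by (cases i) (simp_all flip: fscale_distribs(3,4) add: algebra_simps)
  qed (simp_all add: flinear_def fscale_distribs ac_simps)
qed simp_all

lemma verma_model_simps [simp]:
  "carrier (verma_model \<nu>) = UNIV" "zero (verma_model \<nu>) = 0" "add (verma_model \<nu>) = (+)"
  "smult (verma_model \<nu>) = fscale"
  "act (verma_model \<nu>) mat_h = verma_h \<nu>" "act (verma_model \<nu>) mat_e = verma_e \<nu>"
  "act (verma_model \<nu>) mat_f = verma_f"
  by (auto simp: verma_model_def)

lemma verma_f_pow: "(verma_f ^^ i) (gen 0) = gen i"
  by (induction i) simp_all

lemma lookup_verma_e:
  "Poly_Mapping.lookup (verma_e \<nu> p) i = of_nat (Suc i) * (\<nu> - of_nat i) * Poly_Mapping.lookup p (Suc i)"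
proof -
  have "Poly_Mapping.keys p \<subseteq> UNIV" by simp
  then show ?thesis
  proof (induction p rule: free_induct)
    case (gen j) then show ?case by (cases j) (auto simp: lookup_single when_def)
  qed (simp_all add: lookup_add distrib_left mult.left_commute)
qed

lemma lookup_verma_f:
  "Poly_Mapping.lookup (verma_f p) i = (case i of 0 \<Rightarrow> 0 | Suc j \<Rightarrow> Poly_Mapping.lookup p j)"
proof -
  have "Poly_Mapping.keys p \<subseteq> UNIV" by simp
  then show ?thesis
    by (induction p rule: free_induct) (auto simp: lookup_add lookup_single when_def split: nat.split)
qed

lemma lookup_verma_h:
  "Poly_Mapping.lookup (verma_h \<nu> p) i = (\<nu> - 2 * of_nat i) * Poly_Mapping.lookup p i"
proof -
  have "Poly_Mapping.keys p \<subseteq> UNIV" by simp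
  then show ?thesis
    by (induction p rule: free_induct)
      (auto simp: lookup_add lookup_single when_def distrib_left mult.left_commute)
qed

definition highest_weight_hom :: "'v lmodule \<Rightarrow> 'v \<Rightarrow> (nat \<Rightarrow>\<^sub>0 complex) \<Rightarrow> 'v" where
  "highest_weight_hom V v = free_lift V (\<lambda>i. (act V mat_f ^^ i) v)"

lemma highest_weight_hom:
  assumes V: "lie_module sl2 V" and v: "singular_vector V \<nu> v"
  shows "highest_weight_hom V v \<in> lie_hom sl2 (verma_model \<nu>) V"
    and "highest_weight_hom V v (gen i) = (act V mat_f ^^ i) v"
    and "vlinear V (highest_weight_hom V v)"
proof -
  have vc: "v \<in> carrier V" using v by (simp add: singular_vector_def)
  note vs = lie_moduleD(1)[OF V]
  note cl = funpow_act_closed[OF V mat_in_sl2(3) vc]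
  let ?\<theta> = "highest_weight_hom V v"
  show gen: "?\<theta> (gen i) = (act V mat_f ^^ i) v" for i
    unfolding highest_weight_hom_def by (rule free_lift_gen[OF vs cl])
  show lin: "vlinear V ?\<theta>"
    unfolding highest_weight_hom_def by (rule vlinear_free_lift[OF vs cl])
  note lins = vlinear_flinear[OF lin] vlinear_act[OF V _ lin] flinear_verma
  note sc = lin[unfolded vlinear_def]
  have "restrict ?\<theta> (carrier (verma_model \<nu>)) \<in> lie_hom sl2 (verma_model \<nu>) V"
  proof (rule sl2_hom_restrictI[OF lie_module_verma_model V])
    show "?\<theta> (act (verma_model \<nu>) mat_h p) = act V mat_h (?\<theta> p)" for p
      unfolding verma_model_simps
      by (rule vlinear_eqI[of V "\<lambda>p. ?\<theta> (verma_h \<nu> p)" "\<lambda>p. act V mat_h (?\<theta> p)"])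
        (simp_all add: lins gen act_f_pow[OF V v] sc)
    show "?\<theta> (act (verma_model \<nu>) mat_e p) = act V mat_e (?\<theta> p)" for p
      unfolding verma_model_simps
      by (rule vlinear_eqI[of V "\<lambda>p. ?\<theta> (verma_e \<nu> p)" "\<lambda>p. act V mat_e (?\<theta> p)"])
        (simp_all add: lins gen act_f_pow[OF V v] sc)
    show "?\<theta> (act (verma_model \<nu>) mat_f p) = act V mat_f (?\<theta> p)" for p
      unfolding verma_model_simps
      by (rule vlinear_eqI[of V "\<lambda>p. ?\<theta> (verma_f p)" "\<lambda>p. act V mat_f (?\<theta> p)"])
        (simp_all add: lins gen sc)
  qed (simp_all add: sc)
  then show "?\<theta> \<in> lie_hom sl2 (verma_model \<nu>) V" by (simp add: restrict_def)
qed

lemma verma_model_hom_f_pow: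
  assumes "f \<in> lie_hom sl2 (verma_model \<nu>) V"
  shows "f (gen i) = (act V mat_f ^^ i) (f (gen 0))"
  using lie_homD(4)[OF assms, of mat_f] by (induction i) (simp_all flip: verma_gen(3))

lemma verma_model_hom_singular:
  assumes V: "lie_module sl2 V" and f: "f \<in> lie_hom sl2 (verma_model \<nu>) V"
  shows "singular_vector V \<nu> (f (gen 0))"
proof -
  have "f 0 = \<zero>\<^bsub>V\<^esub>" using lie_hom_zero[OF lie_module_verma_model V f] by simp
  then show ?thesis
    using lie_homD(1)[OF f] lie_homD(3)[OF f] lie_homD(4)[OF f, of mat_e "gen 0"] lie_homD(4)[OF f, of mat_h "gen 0"]
    by (simp add: singular_vector_def)
qed

text \<open>Homomorphisms out of a Verma module are determined by the image of the highest weight vector,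
  which can be any singular vector of the right weight.\<close>

lemma dim_hom_verma_model:
  assumes V: "lie_module sl2 V"
  shows "dim_hom_le_1 sl2 (verma_model \<nu>) V \<longleftrightarrow>
    (\<forall>u v. singular_vector V \<nu> u \<longrightarrow> singular_vector V \<nu> v \<longrightarrow>
      (\<exists>a b. (a \<noteq> 0 \<or> b \<noteq> 0) \<and> a \<odot>\<^bsub>V\<^esub> u \<oplus>\<^bsub>V\<^esub> b \<odot>\<^bsub>V\<^esub> v = \<zero>\<^bsub>V\<^esub>))"
  unfolding dim_hom_le_1_iff[OF lie_module_verma_model V]
proof (intro iffI allI impI ballI, goal_cases)
  case (1 u v)
  note hu = highest_weight_hom[OF V 1(2)] and hv = highest_weight_hom[OF V 1(3)]
  obtain a b where "a \<noteq> 0 \<or> b \<noteq> 0" "\<forall>p\<in>carrier (verma_model \<nu>).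
      a \<odot>\<^bsub>V\<^esub> highest_weight_hom V u p \<oplus>\<^bsub>V\<^esub> b \<odot>\<^bsub>V\<^esub> highest_weight_hom V v p = \<zero>\<^bsub>V\<^esub>"
    using 1(1) hu(1) hv(1) by meson
  moreover from this(2)[rule_format, of "gen 0"]
  have "a \<odot>\<^bsub>V\<^esub> u \<oplus>\<^bsub>V\<^esub> b \<odot>\<^bsub>V\<^esub> v = \<zero>\<^bsub>V\<^esub>" by (simp add: hu hv)
  ultimately show ?case by blast
next
  case (2 f g)
  let ?u = "f (gen 0)" and ?v = "g (gen 0)"
  obtain a b where ab: "a \<noteq> 0 \<or> b \<noteq> 0" "a \<odot>\<^bsub>V\<^esub> ?u \<oplus>\<^bsub>V\<^esub> b \<odot>\<^bsub>V\<^esub> ?v = \<zero>\<^bsub>V\<^esub>"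
    using 2(1) verma_model_hom_singular[OF V 2(2)] verma_model_hom_singular[OF V 2(3)] by meson
  interpret V: vectorspace complex_ring V by (rule lie_moduleD(1)[OF V])
  note s = lie_module_space[OF V]
  have lin: "vlinear V f" "vlinear V g"
    using 2(2,3) vlinear_hom unfolding verma_model_def by blast+
  have "a \<odot>\<^bsub>V\<^esub> f p \<oplus>\<^bsub>V\<^esub> b \<odot>\<^bsub>V\<^esub> g p = 0 \<odot>\<^bsub>V\<^esub> f p" for p
  proof (rule vlinear_eqI[of V "\<lambda>p. a \<odot>\<^bsub>V\<^esub> f p \<oplus>\<^bsub>V\<^esub> b \<odot>\<^bsub>V\<^esub> g p" "\<lambda>p. 0 \<odot>\<^bsub>V\<^esub> f p"])
    show "vlinear V (\<lambda>p. a \<odot>\<^bsub>V\<^esub> f p \<oplus>\<^bsub>V\<^esub> b \<odot>\<^bsub>V\<^esub> g p)"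
      using lin by (auto simp: vlinear_def s V.M.a_ac mult.commute)
    show "vlinear V (\<lambda>p. 0 \<odot>\<^bsub>V\<^esub> f p)" using lin(1) by (auto simp: vlinear_def s)
    fix i
    have car: "f (gen j) \<in> carrier V" "g (gen j) \<in> carrier V" for j using lin by (simp_all add: vlinear_def)
    have "a \<odot>\<^bsub>V\<^esub> f (gen i) \<oplus>\<^bsub>V\<^esub> b \<odot>\<^bsub>V\<^esub> g (gen i) = \<zero>\<^bsub>V\<^esub>"
    proof (induction i)
      case (Suc i)
      have "a \<odot>\<^bsub>V\<^esub> f (gen (Suc i)) \<oplus>\<^bsub>V\<^esub> b \<odot>\<^bsub>V\<^esub> g (gen (Suc i))
          = act V mat_f (a \<odot>\<^bsub>V\<^esub> f (gen i) \<oplus>\<^bsub>V\<^esub> b \<odot>\<^bsub>V\<^esub> g (gen i))"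
        using lie_homD(4)[OF 2(2), of mat_f "gen i"] lie_homD(4)[OF 2(3), of mat_f "gen i"] car s
        by (simp add: lie_moduleD[OF V])
      then show ?case using Suc lie_module_act_zero[OF V] by simp
    qed (rule ab(2))
    then show "a \<odot>\<^bsub>V\<^esub> f (gen i) \<oplus>\<^bsub>V\<^esub> b \<odot>\<^bsub>V\<^esub> g (gen i) = 0 \<odot>\<^bsub>V\<^esub> f (gen i)" using s(4) car by simp
  qed
  then show ?case using ab(1) s(4) lin(1) by (auto simp: vlinear_def)
qed

subsection \<open>Reducibility\<close>

lemma lie_submodule_verma_model:
  assumes W: "lie_submodule sl2 W (verma_model \<nu>)"
  shows "fsubspace W" "p \<in> W \<Longrightarrow> verma_e \<nu> p \<in> W" "p \<in> W \<Longrightarrow> verma_f p \<in> W"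
proof -
  note w = W[unfolded lie_submodule_iff[OF lie_module_verma_model]]
  show "fsubspace W" using w by (simp add: fsubspace_def)
  show "p \<in> W \<Longrightarrow> verma_e \<nu> p \<in> W" using w mat_in_sl2(2) verma_model_simps(6) by metis
  show "p \<in> W \<Longrightarrow> verma_f p \<in> W" using w mat_in_sl2(3) verma_model_simps(7) by metis
qed

text \<open>
  The operator \<open>e\<close> multiplies the leading coefficient, in degree \<open>n + 1\<close>, by a nonzero multiple of \<open>\<nu> - n\<close>
  and lowers the degree by one. When this never vanishes, repeated application of \<open>e\<close> to a nonzero
  element of a submodule reaches the highest weight vector, which generates everything.
\<close>

lemma irreducible_verma_model:
  assumes \<nu>: "\<nu> \<notin> \<nat>"
  shows "\<not> reducible_module sl2 (verma_model \<nu>)"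
proof
  assume "reducible_module sl2 (verma_model \<nu>)"
  then obtain W where W: "lie_submodule sl2 W (verma_model \<nu>)" "W \<noteq> {0}" "W \<noteq> UNIV"
    by (auto simp: reducible_module_def)
  note w = lie_submodule_verma_model[OF W(1)]
  obtain p where p: "p \<in> W" "p \<noteq> 0" using W(2) fsubspaceD(1)[OF w(1)] by blast
  have "\<lbrakk>p \<in> W; p \<noteq> 0; \<And>i. i > n \<Longrightarrow> Poly_Mapping.lookup p i = 0\<rbrakk> \<Longrightarrow> gen 0 \<in> W" for p n
  proof (induction n arbitrary: p)
    case 0
    have eq: "p = fscale (Poly_Mapping.lookup p 0) (gen 0)"
      using 0(3) by (intro poly_mapping_eqI) (auto simp: lookup_single when_def)
    then have "Poly_Mapping.lookup p 0 \<noteq> 0" using 0(2) by auto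
    then have "gen 0 = fscale (1 / Poly_Mapping.lookup p 0) p" by (subst (2) eq) simp
    then show ?case using fsubspaceD(3)[OF w(1) 0(1)] by metis
  next
    case (Suc n)
    show ?case
    proof (cases "Poly_Mapping.lookup p (Suc n) = 0")
      case True
      then show ?thesis using Suc by (metis Suc_lessI)
    next
      case False
      have "\<nu> \<noteq> of_nat n" using \<nu> by auto
      then have "Poly_Mapping.lookup (verma_e \<nu> p) n \<noteq> 0"
        using False by (simp add: lookup_verma_e del: of_nat_Suc)
      then have "verma_e \<nu> p \<noteq> 0" by auto
      then show ?thesis using Suc.IH[OF w(2)[OF Suc.prems(1)]] Suc.prems(3) by (simp add: lookup_verma_e)
    qed
  qed
  moreover obtain n where "Poly_Mapping.keys p \<subseteq> {..n}"
    using finite_nat_set_iff_bounded_le[of "Poly_Mapping.keys p"] by auto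
  then have "\<And>i. i > n \<Longrightarrow> Poly_Mapping.lookup p i = 0" by (auto simp: in_keys_iff subset_iff)
  ultimately have g0: "gen 0 \<in> W" using p by blast
  have g: "gen i \<in> W" for i
    by (induction i) (use g0 w(3) in \<open>auto simp flip: verma_gen(3)\<close>)
  have "q \<in> W" for q
  proof -
    have "Poly_Mapping.keys q \<subseteq> UNIV" by simp
    then show ?thesis by (induction q rule: free_induct) (use g fsubspaceD[OF w(1)] in auto)
  qed
  then show False using W(3) by blast
qed

text \<open>
  For weight \<open>n\<close> the operator \<open>e\<close> kills the basis element \<open>n + 1\<close>, so the elements without
  coefficients in the degrees up to \<open>n\<close> form a submodule.
\<close>

lemma reducible_verma_model:
  shows "reducible_module sl2 (verma_model (of_nat n))"
proof -
  let ?W = "{p :: nat \<Rightarrow>\<^sub>0 complex. \<forall>i\<le>n. Poly_Mapping.lookup p i = 0}"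
  have "lie_submodule sl2 ?W (verma_model (of_nat n))"
    unfolding lie_submodule_iff[OF lie_module_verma_model]
  proof (intro conjI ballI allI)
    fix X p assume "X \<in> sl2" and p: "p \<in> ?W"
    have "(\<forall>i\<le>n. Poly_Mapping.lookup (verma_e (of_nat n) p) i = 0)"
    proof (intro allI impI)
      fix i assume "i \<le> n"
      then show "Poly_Mapping.lookup (verma_e (of_nat n) p) i = 0"
        using p by (cases "i = n") (auto simp: lookup_verma_e)
    qed
    then show "act (verma_model (of_nat n)) X p \<in> ?W"
      using p by (auto simp: verma_model_def lookup_add lookup_verma_h lookup_verma_f split: nat.split)
  qed (auto simp: lookup_add)
  moreover have "gen (Suc n) \<in> ?W" "gen 0 \<notin> ?W" "gen (Suc n) \<noteq> (0 :: nat \<Rightarrow>\<^sub>0 complex)"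
    by (auto simp: lookup_single poly_mapping_eq_iff fun_eq_iff when_def)
  then have "?W \<noteq> {0}" "?W \<noteq> UNIV" by blast+
  ultimately show ?thesis
    using lie_module_verma_model unfolding reducible_module_def verma_model_simps by blast
qed

lemma reducible_verma_model_iff: "reducible_module sl2 (verma_model \<nu>) \<longleftrightarrow> \<nu> \<in> \<nat>"
  using irreducible_verma_model reducible_verma_model by (metis Nats_cases)

subsection \<open>Category O\<close>

text \<open>
  The vectors \<open>f\<^sup>i v\<close> are weight vectors and span the module. A combination of the first \<open>n\<close> of them is
  killed by \<open>e\<^sup>n\<close>, hence generates over the nilradical the span of its first \<open>n\<close> images under powers
  of \<open>e\<close>.
\<close>

lemma category_O_highest_weight:
  assumes V: "lie_module sl2 V" and v: "singular_vector V \<nu> v"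
    and surj: "carrier V \<subseteq> range (highest_weight_hom V v)"
  shows "category_O V"
proof -
  interpret V: vectorspace complex_ring V by (rule lie_moduleD(1)[OF V])
  let ?\<theta> = "highest_weight_hom V v"
  note \<theta> = highest_weight_hom[OF V v] and s = lie_module_space[OF V] and d = lie_moduleD[OF V]
  note lin = \<theta>(3)[unfolded vlinear_def]
  have vc: "v \<in> carrier V" using v by (simp add: singular_vector_def)
  have sub: "carrier V \<subseteq> W"
    if W: "W \<subseteq> carrier V" "\<zero>\<^bsub>V\<^esub> \<in> W" "\<And>x y. x \<in> W \<Longrightarrow> y \<in> W \<Longrightarrow> x \<oplus>\<^bsub>V\<^esub> y \<in> W"
      "\<And>c x. x \<in> W \<Longrightarrow> c \<odot>\<^bsub>V\<^esub> x \<in> W" "\<And>i. (act V mat_f ^^ i) v \<in> W" for W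
  proof -
    have "?\<theta> p \<in> W" for p
    proof -
      have "Poly_Mapping.keys p \<subseteq> UNIV" by simp
      then show ?thesis
      proof (induction p rule: free_induct)
        case zero
        have "?\<theta> (fscale 0 0) = 0 \<odot>\<^bsub>V\<^esub> ?\<theta> 0" using lin by metis
        then show ?case using W(2) s(4) lin by simp
      qed (use W lin \<theta>(2) in auto)
    qed
    then show ?thesis using surj by auto
  qed
  have fg: "generated_submodule sl2 V {v} = carrier V"
  proof
    have "lie_submodule sl2 (carrier V) V" using s d by (simp add: lie_submodule_iff[OF V])
    then show "generated_submodule sl2 V {v} \<subseteq> carrier V"
      using vc by (auto simp: generated_submodule_def)
    show "carrier V \<subseteq> generated_submodule sl2 V {v}"
      unfolding generated_submodule_def
    proof (rule Inter_greatest, clarify)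
      fix W x assume W: "lie_submodule sl2 W V" "{v} \<subseteq> W" and x: "x \<in> carrier V"
      note w = W(1)[unfolded lie_submodule_iff[OF V]]
      have "(act V mat_f ^^ i) v \<in> W" for i
        by (induction i) (use W(2) w in auto)
      then show "x \<in> W" using sub[of W] w x by blast
    qed
  qed
  have ss: "cartan_semisimple V"
  proof -
    let ?U = "\<Union>\<nu>. weight_space V \<nu>"
    have U: "?U \<subseteq> carrier V" by (auto simp: weight_space_def)
    have sm: "LinearCombinations.submodule complex_ring (V.span ?U) V" by (rule V.span_is_submodule[OF U])
    have "carrier V \<subseteq> V.span ?U"
    proof (rule sub)
      fix i
      have car: "(act V mat_f ^^ i) v \<in> carrier V" by (rule funpow_act_closed[OF V mat_in_sl2(3) vc])
      have "act V H ((act V mat_f ^^ i) v) = ((\<nu> - 2 * of_nat i) * H$1$1) \<odot>\<^bsub>V\<^esub> (act V mat_f ^^ i) v"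
        if "H \<in> cartan" for H
      proof -
        have H: "H = mscale (H$1$1) mat_h" using that by (simp add: cartan_iff)
        show ?thesis
          by (subst H) (simp add: d car act_f_pow[OF V v] s mult.commute)
      qed
      then have "(act V mat_f ^^ i) v \<in> ?U" using car by (auto simp: weight_space_def)
      then show "(act V mat_f ^^ i) v \<in> V.span ?U" using V.in_own_span[OF U] by auto
    qed (use sm in \<open>auto simp: LinearCombinations.submodule_def\<close>)
    then show ?thesis
      using V.span_is_subset2[OF U] by (auto simp: cartan_semisimple_def)
  qed
  have nf: "vectorspace.fin_dim complex_ring (V\<lparr>carrier := generated_submodule nilradical V {x}\<rparr>)"
    if x: "x \<in> carrier V" for x
  proof -
    obtain p where p: "x = ?\<theta> p" using x surj by auto
    obtain n where n: "Poly_Mapping.keys p \<subseteq> {..<n}"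
      using finite_nat_set_iff_bounded[of "Poly_Mapping.keys p"] by auto
    define A where "A = (\<lambda>i. (act V mat_e ^^ i) x) ` {..<n}"
    have Ac: "A \<subseteq> carrier V" using funpow_act_closed[OF V mat_in_sl2(2) x] by (auto simp: A_def)
    have sm: "LinearCombinations.submodule complex_ring (V.span A) V" by (rule V.span_is_submodule[OF Ac])
    have pow: "(act V mat_e ^^ i) x = ?\<theta> ((verma_e \<nu> ^^ i) p)" for i
      using lie_homD(4)[OF \<theta>(1), of mat_e] by (induction i) (simp_all add: p)
    have look: "Poly_Mapping.lookup ((verma_e \<nu> ^^ i) p) j = 0" if "n \<le> i + j" for i j
      using that
    proof (induction i arbitrary: j)
      case 0 then show ?case using n by (auto simp: in_keys_iff subset_iff)
    next
      case (Suc i) then show ?case by (simp add: lookup_verma_e)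
    qed
    have "(verma_e \<nu> ^^ n) p = 0" by (rule poly_mapping_eqI) (simp add: look)
    then have top: "(act V mat_e ^^ n) x = \<zero>\<^bsub>V\<^esub>"
      using pow[of n] lie_hom_zero[OF lie_module_verma_model V \<theta>(1)] by simp
    have e_closed: "act V mat_e y \<in> V.span A" if "y \<in> V.span A" for y
    proof -
      let ?B = "{y \<in> carrier V. act V mat_e y \<in> V.span A}"
      have "V.span A \<subseteq> ?B"
      proof (rule V.span_is_subset)
        show "A \<subseteq> ?B"
        proof
          fix y assume "y \<in> A"
          then obtain i where i: "i < n" "y = (act V mat_e ^^ i) x" by (auto simp: A_def)
          have "act V mat_e y \<in> V.span A"
          proof (cases "Suc i < n")
            case True
            then have "act V mat_e y \<in> A" using i by (auto simp: A_def intro!: image_eqI[of _ _ "Suc i"])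
            then show ?thesis using V.in_own_span[OF Ac] by auto
          next
            case False
            then have "Suc i = n" using i by simp
            then have "act V mat_e y = \<zero>\<^bsub>V\<^esub>" using top i(2) by auto
            then show ?thesis using sm by (simp add: LinearCombinations.submodule_def)
          qed
          then show "y \<in> ?B" using \<open>y \<in> A\<close> Ac by auto
        qed
        show "LinearCombinations.submodule complex_ring ?B V"
          using sm V.module_axioms
          by (auto simp: LinearCombinations.submodule_def s d lie_module_act_zero[OF V])
      qed
      then show ?thesis using that by auto
    qed
    have "lie_submodule nilradical (V.span A) V"
      unfolding lie_submodule_def
    proof (intro conjI ballI sm)
      fix X y assume X: "X \<in> nilradical" and y: "y \<in> V.span A"
      have yc: "y \<in> carrier V" using y V.span_is_subset2[OF Ac] by auto
      have "X = mscale (X$1$2) mat_e" using X by (simp add: nilradical_iff)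
      then have "act V X y = X$1$2 \<odot>\<^bsub>V\<^esub> act V mat_e y" using d(6)[OF mat_in_sl2(2) yc] by metis
      then show "act V X y \<in> V.span A" using e_closed[OF y] sm by (simp add: LinearCombinations.submodule_def)
    qed
    moreover have "x \<in> V.span A"
    proof (cases "n = 0")
      case True
      then have "x = \<zero>\<^bsub>V\<^esub>" using top by simp
      then show ?thesis using sm by (simp add: LinearCombinations.submodule_def)
    next
      case False
      then have "x \<in> A" by (auto simp: A_def intro!: image_eqI[of _ _ 0])
      then show ?thesis using V.in_own_span[OF Ac] by auto
    qed
    moreover have "V.span A \<subseteq> W" if W: "lie_submodule nilradical W V" "x \<in> W" for W
    proof (rule V.span_is_subset)
      have "(act V mat_e ^^ i) x \<in> W" for i
        by (induction i) (use W mat_in_subalgebras(2) in \<open>auto simp: lie_submodule_def\<close>)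
      then show "A \<subseteq> W" by (auto simp: A_def)
      show "LinearCombinations.submodule complex_ring W V" using W by (simp add: lie_submodule_def)
    qed
    ultimately have G: "generated_submodule nilradical V {x} = V.span A"
      unfolding generated_submodule_def by blast
    interpret G: vectorspace complex_ring "V\<lparr>carrier := V.span A\<rparr>"
      by (rule V.subspace_is_vs) (use sm V.vectorspace_axioms in \<open>simp add: subspace_def\<close>)
    have "G.span A = V.span A"
      by (rule V.span_li_not_depend(1)[OF V.in_own_span[OF Ac] sm])
    then have "G.fin_dim"
      unfolding G.fin_dim_def using V.in_own_span[OF Ac]
      by (intro exI[of _ A]) (auto simp: A_def)
    then show ?thesis by (simp add: G)
  qed
  show ?thesis
    unfolding category_O_def using V fg ss nf vc by (intro conjI ballI exI[of _ "{v}"]) auto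
qed

section \<open>The tensor product of two Verma modules\<close>

text \<open>
  The pair \<open>(i, j)\<close> plays the part of \<open>f\<^sup>i v \<otimes> f\<^sup>j w\<close> for highest weight vectors of weights \<open>m\<close> and \<open>n\<close>.
\<close>

definition tensor_h :: "complex \<Rightarrow> complex \<Rightarrow> (nat \<times> nat \<Rightarrow>\<^sub>0 complex) \<Rightarrow> (nat \<times> nat \<Rightarrow>\<^sub>0 complex)" where
  "tensor_h m n = linear_extension (\<lambda>(i, j). fscale (m + n - 2 * of_nat (i + j)) (gen (i, j)))"

definition tensor_e :: "complex \<Rightarrow> complex \<Rightarrow> (nat \<times> nat \<Rightarrow>\<^sub>0 complex) \<Rightarrow> (nat \<times> nat \<Rightarrow>\<^sub>0 complex)" where
  "tensor_e m n = linear_extension (\<lambda>(i, j). fscale (of_nat i * (m - of_nat i + 1)) (gen (i - 1, j))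
     + fscale (of_nat j * (n - of_nat j + 1)) (gen (i, j - 1)))"

definition tensor_f :: "(nat \<times> nat \<Rightarrow>\<^sub>0 complex) \<Rightarrow> (nat \<times> nat \<Rightarrow>\<^sub>0 complex)" where
  "tensor_f = linear_extension (\<lambda>(i, j). gen (Suc i, j) + gen (i, Suc j))"

definition tensor_model :: "complex \<Rightarrow> complex \<Rightarrow> (nat \<times> nat \<Rightarrow>\<^sub>0 complex) lmodule" where
  "tensor_model m n = sl2_model (tensor_h m n) (tensor_e m n) tensor_f"

text \<open>
  The operators \<open>cotensor_e\<close> and \<open>cotensor_f\<close> are the transposes of \<open>tensor_f\<close> and \<open>tensor_e\<close> with
  respect to the basis of pairs. The case distinctions drop the terms with a negative index.
\<close>

definition cotensor_e :: "(nat \<times> nat \<Rightarrow>\<^sub>0 complex) \<Rightarrow> (nat \<times> nat \<Rightarrow>\<^sub>0 complex)" where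
  "cotensor_e = linear_extension (\<lambda>(i, j). fscale (if i = 0 then 0 else 1) (gen (i - 1, j))
     + fscale (if j = 0 then 0 else 1) (gen (i, j - 1)))"

definition cotensor_f :: "complex \<Rightarrow> complex \<Rightarrow> (nat \<times> nat \<Rightarrow>\<^sub>0 complex) \<Rightarrow> (nat \<times> nat \<Rightarrow>\<^sub>0 complex)" where
  "cotensor_f m n = linear_extension (\<lambda>(i, j). fscale (of_nat (Suc i) * (m - of_nat i)) (gen (Suc i, j))
     + fscale (of_nat (Suc j) * (n - of_nat j)) (gen (i, Suc j)))"

text \<open>
  The parameter \<open>a\<close> is the scalar for which the anti-involution of the duality sends \<open>e\<close> to \<open>a f\<close>.
\<close>

definition cotensor_model :: "complex \<Rightarrow> complex \<Rightarrow> complex \<Rightarrow> (nat \<times> nat \<Rightarrow>\<^sub>0 complex) lmodule" where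
  "cotensor_model a m n = sl2_model (tensor_h m n) (\<lambda>p. fscale a (cotensor_e p))
     (\<lambda>p. fscale (1 / a) (cotensor_f m n p))"

lemma flinear_tensor [simp]:
  "flinear (tensor_h m n)" "flinear (tensor_e m n)" "flinear tensor_f"
  "flinear cotensor_e" "flinear (cotensor_f m n)"
  by (simp_all add: tensor_h_def tensor_e_def tensor_f_def cotensor_e_def cotensor_f_def flinear_linear_extension)

lemmas tensor_linear [simp] = flinearD[OF flinear_tensor(1)] flinearD[OF flinear_tensor(2)]
  flinearD[OF flinear_tensor(3)] flinearD[OF flinear_tensor(4)] flinearD[OF flinear_tensor(5)]

lemma tensor_gen [simp]:
  "tensor_h m n (gen (i, j)) = fscale (m + n - 2 * of_nat (i + j)) (gen (i, j))"
  "tensor_e m n (gen (i, j)) = fscale (of_nat i * (m - of_nat i + 1)) (gen (i - 1, j))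
     + fscale (of_nat j * (n - of_nat j + 1)) (gen (i, j - 1))"
  "tensor_f (gen (i, j)) = gen (Suc i, j) + gen (i, Suc j)"
  "cotensor_e (gen (i, j)) = fscale (if i = 0 then 0 else 1) (gen (i - 1, j))
     + fscale (if j = 0 then 0 else 1) (gen (i, j - 1))"
  "cotensor_f m n (gen (i, j)) = fscale (of_nat (Suc i) * (m - of_nat i)) (gen (Suc i, j))
     + fscale (of_nat (Suc j) * (n - of_nat j)) (gen (i, Suc j))"
  by (simp_all add: tensor_h_def tensor_e_def tensor_f_def cotensor_e_def cotensor_f_def)

text \<open>Identities between linear maps are checked on the basis, where they are identities
  between coordinates.\<close>

lemma pair_flinear_eqI:
  assumes "flinear g" "flinear h" "\<And>i j. g (gen (i, j)) = h (gen (i, j))"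
  shows "g p = h p"
  by (rule flinear_eqI[OF assms(1,2)]) (use assms(3) in auto)

lemma lie_module_tensor_model: "lie_module sl2 (tensor_model m n)"
  unfolding tensor_model_def
proof (rule lie_module_sl2_model)
  show "tensor_h m n (tensor_e m n p) = tensor_e m n (tensor_h m n p) + fscale 2 (tensor_e m n p)" for p
  proof (rule pair_flinear_eqI[of "\<lambda>p. tensor_h m n (tensor_e m n p)"
        "\<lambda>p. tensor_e m n (tensor_h m n p) + fscale 2 (tensor_e m n p)"])
    fix i j show "tensor_h m n (tensor_e m n (gen (i, j))) =
      tensor_e m n (tensor_h m n (gen (i, j))) + fscale 2 (tensor_e m n (gen (i, j)))"
      by (cases i; cases j; rule poly_mapping_eqI) (simp_all add: lookup_add lookup_gen algebra_simps)
  qed (simp_all add: flinear_def fscale_distribs ac_simps)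
  show "tensor_h m n (tensor_f p) = tensor_f (tensor_h m n p) - fscale 2 (tensor_f p)" for p
  proof (rule pair_flinear_eqI[of "\<lambda>p. tensor_h m n (tensor_f p)"
        "\<lambda>p. tensor_f (tensor_h m n p) - fscale 2 (tensor_f p)"])
    fix i j show "tensor_h m n (tensor_f (gen (i, j))) =
      tensor_f (tensor_h m n (gen (i, j))) - fscale 2 (tensor_f (gen (i, j)))"
      by (rule poly_mapping_eqI) (simp add: lookup_add lookup_minus lookup_gen algebra_simps)
  qed (simp_all add: flinear_def fscale_distribs algebra_simps)
  show "tensor_e m n (tensor_f p) = tensor_f (tensor_e m n p) + tensor_h m n p" for p
  proof (rule pair_flinear_eqI[of "\<lambda>p. tensor_e m n (tensor_f p)"
        "\<lambda>p. tensor_f (tensor_e m n p) + tensor_h m n p"])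
    fix i j show "tensor_e m n (tensor_f (gen (i, j))) =
      tensor_f (tensor_e m n (gen (i, j))) + tensor_h m n (gen (i, j))"
      by (cases i; cases j; rule poly_mapping_eqI) (auto simp: lookup_add lookup_gen algebra_simps)
  qed (simp_all add: flinear_def fscale_distribs ac_simps)
qed simp_all

lemma lie_module_cotensor_model:
  assumes "a \<noteq> 0"
  shows "lie_module sl2 (cotensor_model a m n)"
  unfolding cotensor_model_def
proof (rule lie_module_sl2_model)
  have he: "tensor_h m n (cotensor_e p) = cotensor_e (tensor_h m n p) + fscale 2 (cotensor_e p)" for p
  proof (rule pair_flinear_eqI[of "\<lambda>p. tensor_h m n (cotensor_e p)"
        "\<lambda>p. cotensor_e (tensor_h m n p) + fscale 2 (cotensor_e p)"])
    fix i j show "tensor_h m n (cotensor_e (gen (i, j))) =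
      cotensor_e (tensor_h m n (gen (i, j))) + fscale 2 (cotensor_e (gen (i, j)))"
      by (cases i; cases j; rule poly_mapping_eqI) (simp_all add: lookup_add lookup_gen algebra_simps)
  qed (simp_all add: flinear_def fscale_distribs ac_simps)
  have hf: "tensor_h m n (cotensor_f m n p) = cotensor_f m n (tensor_h m n p) - fscale 2 (cotensor_f m n p)" for p
  proof (rule pair_flinear_eqI[of "\<lambda>p. tensor_h m n (cotensor_f m n p)"
        "\<lambda>p. cotensor_f m n (tensor_h m n p) - fscale 2 (cotensor_f m n p)"])
    fix i j show "tensor_h m n (cotensor_f m n (gen (i, j))) =
      cotensor_f m n (tensor_h m n (gen (i, j))) - fscale 2 (cotensor_f m n (gen (i, j)))"
      by (rule poly_mapping_eqI) (simp add: lookup_add lookup_minus lookup_gen algebra_simps)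
  qed (simp_all add: flinear_def fscale_distribs algebra_simps)
  have ef: "cotensor_e (cotensor_f m n p) = cotensor_f m n (cotensor_e p) + tensor_h m n p" for p
  proof (rule pair_flinear_eqI[of "\<lambda>p. cotensor_e (cotensor_f m n p)"
        "\<lambda>p. cotensor_f m n (cotensor_e p) + tensor_h m n p"])
    fix i j show "cotensor_e (cotensor_f m n (gen (i, j))) =
      cotensor_f m n (cotensor_e (gen (i, j))) + tensor_h m n (gen (i, j))"
      by (cases i; cases j; rule poly_mapping_eqI) (auto simp: lookup_add lookup_gen algebra_simps)
  qed (simp_all add: flinear_def fscale_distribs ac_simps)
  show "tensor_h m n (fscale a (cotensor_e p)) =
      fscale a (cotensor_e (tensor_h m n p)) + fscale 2 (fscale a (cotensor_e p))" for p
    by (simp add: he fscale_distribs mult.commute)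
  show "tensor_h m n (fscale (1 / a) (cotensor_f m n p)) =
      fscale (1 / a) (cotensor_f m n (tensor_h m n p)) - fscale 2 (fscale (1 / a) (cotensor_f m n p))" for p
    by (simp add: hf fscale_distribs mult.commute)
  show "fscale a (cotensor_e (fscale (1 / a) (cotensor_f m n p))) =
      fscale (1 / a) (cotensor_f m n (fscale a (cotensor_e p))) + tensor_h m n p" for p
    using assms by (simp add: ef)
qed (simp_all add: flinear_ops)

lemma tensor_model_simps [simp]:
  "carrier (tensor_model m n) = UNIV" "zero (tensor_model m n) = 0" "add (tensor_model m n) = (+)"
  "smult (tensor_model m n) = fscale"
  "act (tensor_model m n) mat_h = tensor_h m n" "act (tensor_model m n) mat_e = tensor_e m n"
  "act (tensor_model m n) mat_f = tensor_f"
  by (auto simp: tensor_model_def)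

lemma cotensor_model_simps [simp]:
  "carrier (cotensor_model a m n) = UNIV" "zero (cotensor_model a m n) = 0" "add (cotensor_model a m n) = (+)"
  "smult (cotensor_model a m n) = fscale"
  "act (cotensor_model a m n) mat_h = tensor_h m n"
  "act (cotensor_model a m n) mat_e = (\<lambda>p. fscale a (cotensor_e p))"
  "act (cotensor_model a m n) mat_f = (\<lambda>p. fscale (1 / a) (cotensor_f m n p))"
  by (auto simp: cotensor_model_def)

lemma lookup_tensor_h:
  "Poly_Mapping.lookup (tensor_h m n p) (i, j) = (m + n - 2 * of_nat (i + j)) * Poly_Mapping.lookup p (i, j)"
proof -
  have "Poly_Mapping.keys p \<subseteq> UNIV" by simp
  then show ?thesis
    by (induction p rule: free_induct)
      (auto simp: lookup_add lookup_gen distrib_left mult.left_commute simp del: of_nat_add split: if_splits)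
qed

lemma lookup_tensor_e:
  "Poly_Mapping.lookup (tensor_e m n p) (i, j) =
    of_nat (Suc i) * (m - of_nat i) * Poly_Mapping.lookup p (Suc i, j)
    + of_nat (Suc j) * (n - of_nat j) * Poly_Mapping.lookup p (i, Suc j)"
proof -
  have "Poly_Mapping.keys p \<subseteq> UNIV" by simp
  then show ?thesis
  proof (induction p rule: free_induct)
    case (gen x)
    obtain i' j' where x: "x = (i', j')" by (cases x)
    show ?case unfolding x by (cases i'; cases j') (auto simp: lookup_add lookup_gen)
  qed (simp_all add: lookup_add distrib_left mult.left_commute del: of_nat_Suc)
qed

lemma lookup_tensor_f:
  "Poly_Mapping.lookup (tensor_f p) (i, j) =
    (if i = 0 then 0 else Poly_Mapping.lookup p (i - 1, j))
    + (if j = 0 then 0 else Poly_Mapping.lookup p (i, j - 1))"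
proof -
  have "Poly_Mapping.keys p \<subseteq> UNIV" by simp
  then show ?thesis
  proof (induction p rule: free_induct)
    case (gen x)
    obtain i' j' where x: "x = (i', j')" by (cases x)
    show ?case unfolding x by (cases i; cases j) (auto simp: lookup_add lookup_gen)
  qed (simp_all add: lookup_add distrib_left)
qed

lemma lookup_cotensor_e:
  "Poly_Mapping.lookup (cotensor_e p) (i, j) =
    Poly_Mapping.lookup p (Suc i, j) + Poly_Mapping.lookup p (i, Suc j)"
proof -
  have "Poly_Mapping.keys p \<subseteq> UNIV" by simp
  then show ?thesis
  proof (induction p rule: free_induct)
    case (gen x)
    obtain i' j' where x: "x = (i', j')" by (cases x)
    show ?case unfolding x by (cases i'; cases j') (auto simp: lookup_add lookup_gen)
  qed (simp_all add: lookup_add distrib_left)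
qed

lemma lookup_cotensor_f:
  "Poly_Mapping.lookup (cotensor_f m n p) (i, j) =
    (if i = 0 then 0 else of_nat i * (m - of_nat (i - 1)) * Poly_Mapping.lookup p (i - 1, j))
    + (if j = 0 then 0 else of_nat j * (n - of_nat (j - 1)) * Poly_Mapping.lookup p (i, j - 1))"
proof -
  have "Poly_Mapping.keys p \<subseteq> UNIV" by simp
  then show ?thesis
  proof (induction p rule: free_induct)
    case (gen x)
    obtain i' j' where x: "x = (i', j')" by (cases x)
    show ?case unfolding x by (cases i; cases j) (auto simp: lookup_add lookup_gen)
  qed (simp_all add: lookup_add distrib_left mult.left_commute)
qed

subsection \<open>Exchanging the factors\<close>

definition swap_factors :: "(nat \<times> nat \<Rightarrow>\<^sub>0 complex) \<Rightarrow> (nat \<times> nat \<Rightarrow>\<^sub>0 complex)" where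
  "swap_factors = linear_extension (\<lambda>(i, j). gen (j, i))"

lemma swap_factors_facts [simp]:
  "flinear swap_factors" "swap_factors (gen (i, j)) = gen (j, i)" "swap_factors (swap_factors p) = p"
proof -
  show lin: "flinear swap_factors" by (simp add: swap_factors_def flinear_linear_extension)
  show g: "swap_factors (gen (i, j)) = gen (j, i)" for i j by (simp add: swap_factors_def)
  show "swap_factors (swap_factors p) = p"
    by (rule pair_flinear_eqI[of "\<lambda>p. swap_factors (swap_factors p)" "\<lambda>p. p"])
      (simp_all add: g lin flinear_comp flinear_ops)
qed

lemma bij_swap_factors: "bij swap_factors"
  by (rule bij_betw_byWitness[of _ swap_factors]) auto

lemma swap_intertwines:
  "swap_factors (tensor_h m n p) = tensor_h n m (swap_factors p)"
  "swap_factors (tensor_e m n p) = tensor_e n m (swap_factors p)"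
  "swap_factors (tensor_f p) = tensor_f (swap_factors p)"
  "swap_factors (cotensor_e p) = cotensor_e (swap_factors p)"
  "swap_factors (cotensor_f m n p) = cotensor_f n m (swap_factors p)"
proof -
  note lin = flinearD[OF swap_factors_facts(1)]
  show "swap_factors (tensor_h m n p) = tensor_h n m (swap_factors p)"
    by (rule pair_flinear_eqI[of "\<lambda>p. swap_factors (tensor_h m n p)" "\<lambda>p. tensor_h n m (swap_factors p)"])
      (simp_all add: flinear_comp lin ac_simps)
  show "swap_factors (tensor_e m n p) = tensor_e n m (swap_factors p)"
    by (rule pair_flinear_eqI[of "\<lambda>p. swap_factors (tensor_e m n p)" "\<lambda>p. tensor_e n m (swap_factors p)"])
      (simp_all add: flinear_comp lin ac_simps)
  show "swap_factors (tensor_f p) = tensor_f (swap_factors p)"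
    by (rule pair_flinear_eqI[of "\<lambda>p. swap_factors (tensor_f p)" "\<lambda>p. tensor_f (swap_factors p)"])
      (simp_all add: flinear_comp lin ac_simps)
  show "swap_factors (cotensor_e p) = cotensor_e (swap_factors p)"
    by (rule pair_flinear_eqI[of "\<lambda>p. swap_factors (cotensor_e p)" "\<lambda>p. cotensor_e (swap_factors p)"])
      (simp_all add: flinear_comp lin ac_simps)
  show "swap_factors (cotensor_f m n p) = cotensor_f n m (swap_factors p)"
    by (rule pair_flinear_eqI[of "\<lambda>p. swap_factors (cotensor_f m n p)" "\<lambda>p. cotensor_f n m (swap_factors p)"])
      (simp_all add: flinear_comp lin ac_simps)
qed

lemma tensor_model_swap: "lie_isomorphic sl2 (tensor_model m n) (tensor_model n m)"
  unfolding lie_isomorphic_def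
proof (rule bexI)
  show "bij_betw swap_factors (carrier (tensor_model m n)) (carrier (tensor_model n m))"
    by (simp add: bij_swap_factors)
  show "swap_factors \<in> lie_hom sl2 (tensor_model m n) (tensor_model n m)"
    using lie_module_tensor_model unfolding tensor_model_def
    by (intro sl2_model_homI) (simp_all add: swap_intertwines)
qed

lemma cotensor_model_swap:
  assumes "a \<noteq> 0"
  shows "lie_isomorphic sl2 (cotensor_model a m n) (cotensor_model a n m)"
  unfolding lie_isomorphic_def
proof (rule bexI)
  show "bij_betw swap_factors (carrier (cotensor_model a m n)) (carrier (cotensor_model a n m))"
    by (simp add: bij_swap_factors)
  show "swap_factors \<in> lie_hom sl2 (cotensor_model a m n) (cotensor_model a n m)"
    using lie_module_cotensor_model[OF assms] unfolding cotensor_model_def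
    by (intro sl2_model_homI) (simp_all add: swap_intertwines flinearD[OF swap_factors_facts(1)])
qed

subsection \<open>The weight spaces\<close>

definition graded :: "nat \<Rightarrow> (nat \<times> nat \<Rightarrow>\<^sub>0 complex) set" where
  "graded k = {p. Poly_Mapping.keys p \<subseteq> {(i, j). i + j = k}}"

lemma graded_iff: "p \<in> graded k \<longleftrightarrow> (\<forall>i j. i + j \<noteq> k \<longrightarrow> Poly_Mapping.lookup p (i, j) = 0)"
  by (auto simp: graded_def in_keys_iff)

lemma fsubspace_graded: "fsubspace (graded k)"
  unfolding graded_def by (rule fsubspace_keys)

lemma gen_graded: "gen (i, j) \<in> graded (i + j)"
  by (simp add: graded_def)

lemma graded_operators:
  "p \<in> graded k \<Longrightarrow> tensor_f p \<in> graded (Suc k)"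
  "p \<in> graded (Suc k) \<Longrightarrow> tensor_e m n p \<in> graded k"
  "p \<in> graded 0 \<Longrightarrow> tensor_e m n p = 0"
  "p \<in> graded k \<Longrightarrow> cotensor_f m n p \<in> graded (Suc k)"
  "p \<in> graded (Suc k) \<Longrightarrow> cotensor_e p \<in> graded k"
  "p \<in> graded 0 \<Longrightarrow> cotensor_e p = 0"
  "p \<in> graded k \<Longrightarrow> tensor_h m n p = fscale (m + n - 2 * of_nat k) p"
proof -
  show "tensor_f p \<in> graded (Suc k)" if "p \<in> graded k"
    unfolding graded_iff
  proof (intro allI impI)
    fix i j assume "i + j \<noteq> Suc k"
    then show "Poly_Mapping.lookup (tensor_f p) (i, j) = 0"
      using that by (cases i; cases j) (simp_all add: graded_iff lookup_tensor_f)
  qed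
  show "cotensor_f m n p \<in> graded (Suc k)" if "p \<in> graded k"
    unfolding graded_iff
  proof (intro allI impI)
    fix i j assume "i + j \<noteq> Suc k"
    then show "Poly_Mapping.lookup (cotensor_f m n p) (i, j) = 0"
      using that by (cases i; cases j) (simp_all add: graded_iff lookup_cotensor_f)
  qed
  show "tensor_h m n p = fscale (m + n - 2 * of_nat k) p" if "p \<in> graded k"
  proof (rule poly_mapping_eqI)
    fix x :: "nat \<times> nat"
    obtain i j where x: "x = (i, j)" by (cases x)
    show "Poly_Mapping.lookup (tensor_h m n p) x = Poly_Mapping.lookup (fscale (m + n - 2 * of_nat k) p) x"
      using that by (cases "i + j = k") (auto simp: x lookup_tensor_h graded_iff simp del: of_nat_add)
  qed
  show "tensor_e m n p = 0" if "p \<in> graded 0"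
    by (rule poly_mapping_eqI) (use that in \<open>auto simp: graded_iff lookup_tensor_e\<close>)
  show "cotensor_e p = 0" if "p \<in> graded 0"
    by (rule poly_mapping_eqI) (use that in \<open>auto simp: graded_iff lookup_cotensor_e\<close>)
qed (simp_all add: graded_iff lookup_tensor_e lookup_cotensor_e)

text \<open>
  The coefficient of \<open>f p\<close> at \<open>(i, j + 1)\<close> is the one of \<open>p\<close> at \<open>(i, j)\<close> plus one with a smaller first
  index.
\<close>

lemma tensor_f_injective:
  assumes "tensor_f p = 0"
  shows "p = 0"
proof -
  have "Poly_Mapping.lookup p (i, j) = 0" for i j
  proof (induction i arbitrary: j)
    case 0 then show ?case using lookup_tensor_f[of p 0 "Suc j"] assms by simp
  next
    case (Suc i) then show ?case using lookup_tensor_f[of p "Suc i" "Suc j"] assms by simp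
  qed
  then show ?thesis by (intro poly_mapping_eqI) auto
qed

lemma not_Nats_of_nat: "n \<notin> \<nat> \<Longrightarrow> n - of_nat j \<noteq> (0 :: complex)"
  by auto

text \<open>
  As for \<open>tensor_f\<close>, except that the coefficient at \<open>(i, j)\<close> now comes with the factor
  \<open>(j + 1) (n - j)\<close>.
\<close>

lemma cotensor_f_injective:
  assumes n: "n \<notin> \<nat>" and "cotensor_f m n p = 0"
  shows "p = 0"
proof -
  have "Poly_Mapping.lookup p (i, j) = 0" for i j
  proof (induction i arbitrary: j)
    case 0
    show ?case
      using lookup_cotensor_f[of m n p 0 "Suc j"] assms(2) not_Nats_of_nat[OF n, of j] by (simp del: of_nat_Suc)
  next
    case (Suc i)
    then show ?case
      using lookup_cotensor_f[of m n p "Suc i" "Suc j"] assms(2) not_Nats_of_nat[OF n, of j] by (simp del: of_nat_Suc)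
  qed
  then show ?thesis by (intro poly_mapping_eqI) auto
qed

text \<open>
  Modulo the image of \<open>f\<close> every basis element of degree \<open>k + 1\<close> is a multiple of the next one, with
  first index increased, and so of the last one, \<open>(k + 1, 0)\<close>.
\<close>

lemma graded_Suc_decomposition:
  assumes lin: "flinear f" and gen: "\<And>i j. i + j = k \<Longrightarrow> \<exists>a b. a \<noteq> 0 \<and> f (gen (i, j)) = fscale a (gen (i, Suc j)) + fscale b (gen (Suc i, j))"
    and p: "p \<in> graded (Suc k)"
  shows "\<exists>x\<in>graded k. \<exists>c. p = f x + fscale c (gen (Suc k, 0))"
proof -
  let ?D = "{p. \<exists>x\<in>graded k. \<exists>c. p = f x + fscale c (gen (Suc k, 0))}"
  note gr = fsubspaceD[OF fsubspace_graded] and l = flinearD[OF lin]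
  have sub: "fsubspace ?D"
    unfolding fsubspace_def
  proof (intro conjI ballI allI)
    show "0 \<in> ?D" using gr(1)[of k] l(3) by (auto intro!: bexI[of _ 0] exI[of _ 0])
  next
    fix p q assume "p \<in> ?D" "q \<in> ?D"
    then obtain x c y d where "x \<in> graded k" "p = f x + fscale c (gen (Suc k, 0))"
      "y \<in> graded k" "q = f y + fscale d (gen (Suc k, 0))" by blast
    then have "x + y \<in> graded k" "p + q = f (x + y) + fscale (c + d) (gen (Suc k, 0))"
      using gr(2) by (auto simp: l fscale_distribs)
    then show "p + q \<in> ?D" by blast
  next
    fix a p assume "p \<in> ?D"
    then obtain x c where "x \<in> graded k" "p = f x + fscale c (gen (Suc k, 0))" by blast
    then have "fscale a x \<in> graded k" "fscale a p = f (fscale a x) + fscale (a * c) (gen (Suc k, 0))"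
      using gr(3) by (auto simp: l fscale_distribs)
    then show "fscale a p \<in> ?D" by blast
  qed
  note D = fsubspaceD[OF sub]
  have g: "gen (i, j) \<in> ?D" if "i + j = Suc k" for i j
    using that
  proof (induction j arbitrary: i)
    case 0
    then show ?case using gr(1)[of k] l(3) by (auto intro!: bexI[of _ 0] exI[of _ 1])
  next
    case (Suc j)
    then obtain a b where ab: "a \<noteq> 0" "f (gen (i, j)) = fscale a (gen (i, Suc j)) + fscale b (gen (Suc i, j))"
      using gen[of i j] by auto
    have ij: "gen (i, j) \<in> graded k" using Suc.prems gen_graded[of i j] by simp
    have "f (gen (i, j)) = f (gen (i, j)) + fscale 0 (gen (Suc k, 0))" by simp
    then have 1: "f (gen (i, j)) \<in> ?D" using ij by blast
    have 2: "gen (Suc i, j) \<in> ?D" using Suc by simp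
    have eq: "gen (i, Suc j) = fscale (1 / a) (f (gen (i, j)) - fscale b (gen (Suc i, j)))"
      using ab by simp
    show ?case by (subst eq) (rule D(3)[OF D(5)[OF 1 D(3)[OF 2]]])
  qed
  have "Poly_Mapping.keys p \<subseteq> {(i, j). i + j = Suc k}" using p by (simp add: graded_def)
  then have "p \<in> ?D"
    by (induction p rule: free_induct) (use D g in auto)
  then show ?thesis by blast
qed

lemma tensor_f_decomposition:
  "p \<in> graded (Suc k) \<Longrightarrow> \<exists>x\<in>graded k. \<exists>c. p = tensor_f x + fscale c (gen (Suc k, 0))"
  by (rule graded_Suc_decomposition) (auto intro!: exI[of _ 1])

lemma cotensor_f_decomposition:
  assumes n: "n \<notin> \<nat>" and "p \<in> graded (Suc k)"
  shows "\<exists>x\<in>graded k. \<exists>c. p = cotensor_f m n x + fscale c (gen (Suc k, 0))"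
proof (rule graded_Suc_decomposition[OF _ _ assms(2)])
  fix i j :: nat
  show "\<exists>a b. a \<noteq> 0 \<and> cotensor_f m n (gen (i, j)) = fscale a (gen (i, Suc j)) + fscale b (gen (Suc i, j))"
    using not_Nats_of_nat[OF n, of j]
    by (intro exI[of _ "of_nat (Suc j) * (n - of_nat j)"] exI[of _ "of_nat (Suc i) * (m - of_nat i)"])
      (simp add: add.commute del: of_nat_Suc)
qed simp

lemma gen_notin_tensor_f:
  assumes "x \<in> graded k"
  shows "gen (Suc k, 0) \<noteq> tensor_f x"
proof
  assume eq: "gen (Suc k, 0) = tensor_f x"
  have "Poly_Mapping.lookup x (i, j) = 0" for i j
  proof (induction i arbitrary: j)
    case 0 then show ?case using lookup_tensor_f[of x 0 "Suc j"] by (simp flip: eq add: lookup_gen)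
  next
    case (Suc i) then show ?case using lookup_tensor_f[of x "Suc i" "Suc j"] by (simp flip: eq add: lookup_gen)
  qed
  then have "x = 0" by (intro poly_mapping_eqI) auto
  then have "Poly_Mapping.lookup (gen (Suc k, 0 :: nat)) (Suc k, 0) = (0 :: complex)" using eq by simp
  then show False by (simp add: lookup_gen)
qed

text \<open>If \<open>n\<close> is not a natural number, the equations for a singular vector determine each coefficient
  from its left neighbour, hence all of them from the one at \<open>(k, 0)\<close>.\<close>

lemma tensor_singular_unique:
  assumes n: "n \<notin> \<nat>" and pq: "p \<in> graded k" "q \<in> graded k" "tensor_e m n p = 0" "tensor_e m n q = 0" "p \<noteq> 0"
  shows "\<exists>c. q = fscale c p"
proof -
  have zero: "r = 0" if r: "r \<in> graded k" "tensor_e m n r = 0" "Poly_Mapping.lookup r (k, 0) = 0" for r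
  proof -
    have "Poly_Mapping.lookup r (i, j) = 0" for i j
    proof (induction j arbitrary: i)
      case 0 then show ?case using r by (cases "i = k") (auto simp: graded_iff)
    next
      case (Suc j)
      then show ?case using lookup_tensor_e[of m n r i j] r(2) not_Nats_of_nat[OF n, of j] by (simp del: of_nat_Suc)
    qed
    then show ?thesis by (intro poly_mapping_eqI) auto
  qed
  let ?c = "Poly_Mapping.lookup q (k, 0) / Poly_Mapping.lookup p (k, 0)"
  have p0: "Poly_Mapping.lookup p (k, 0) \<noteq> 0" using zero[of p] pq by blast
  have "q - fscale ?c p \<in> graded k"
    by (rule fsubspaceD(5)[OF fsubspace_graded pq(2) fsubspaceD(3)[OF fsubspace_graded pq(1)]])
  then have "q - fscale ?c p = 0"
    by (rule zero) (use pq(3,4) p0 in \<open>simp_all add: lookup_minus\<close>)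
  then show ?thesis by (intro exI[of _ ?c]) simp
qed

text \<open>
  The operator \<open>e\<close> sends \<open>(i, j + 1)\<close> to a nonzero multiple of \<open>(i, j)\<close> plus a term whose first index is
  smaller.
\<close>

lemma tensor_e_surjective:
  assumes n: "n \<notin> \<nat>"
  shows "\<exists>q. tensor_e m n q = p"
proof -
  have sub: "fsubspace (range (tensor_e m n))"
    by (rule fsubspace_image) (simp_all add: fsubspace_def)
  note r = fsubspaceD[OF sub]
  have g: "gen (i, j) \<in> range (tensor_e m n)" for i j
  proof -
    define a where "a j = of_nat (Suc j) * (n - of_nat j)" for j
    have a: "a j \<noteq> 0" for j using not_Nats_of_nat[OF n, of j] by (simp add: a_def del: of_nat_Suc)
    show ?thesis
    proof (induction i arbitrary: j)
      case 0
      have "tensor_e m n (gen (0, Suc j)) = fscale (a j) (gen (0, j))" by (simp add: a_def)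
      then have eq: "gen (0, j) = fscale (1 / a j) (tensor_e m n (gen (0, Suc j)))" using a by simp
      show ?case by (subst eq) (rule r(3)[OF rangeI])
    next
      case (Suc i)
      have "tensor_e m n (gen (Suc i, Suc j))
        = fscale (of_nat (Suc i) * (m - of_nat i)) (gen (i, Suc j)) + fscale (a j) (gen (Suc i, j))"
        by (simp add: a_def)
      then have eq: "gen (Suc i, j) = fscale (1 / a j)
          (tensor_e m n (gen (Suc i, Suc j)) - fscale (of_nat (Suc i) * (m - of_nat i)) (gen (i, Suc j)))"
        using a by simp
      show ?case by (subst eq) (rule r(3)[OF r(5)[OF rangeI r(3)[OF Suc]]])
    qed
  qed
  have "Poly_Mapping.keys p \<subseteq> UNIV" by simp
  then have "p \<in> range (tensor_e m n)"
    by (induction p rule: free_induct) (use r g in auto)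
  then show ?thesis by auto
qed

lemma cotensor_e_surjective:
  assumes "p \<in> graded k"
  shows "\<exists>q\<in>graded (Suc k). cotensor_e q = p"
proof -
  have sub: "fsubspace (cotensor_e ` graded (Suc k))"
    by (rule fsubspace_image) (simp_all add: fsubspace_graded)
  note r = fsubspaceD[OF sub]
  have g: "gen (i, j) \<in> cotensor_e ` graded (Suc k)" if "i + j = k" for i j
    using that
  proof (induction j arbitrary: i)
    case 0
    then show ?case using gen_graded[of "Suc i" 0] by (intro image_eqI[of _ _ "gen (Suc i, 0)"]) auto
  next
    case (Suc j)
    have "cotensor_e (gen (Suc i, Suc j)) - gen (Suc i, j) = gen (i, Suc j)" by simp
    moreover have "gen (Suc i, Suc j) \<in> graded (Suc k)" using gen_graded[of "Suc i" "Suc j"] Suc.prems by simp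
    moreover have "gen (Suc i, j) \<in> cotensor_e ` graded (Suc k)" using Suc by simp
    ultimately show ?case using r(5)[OF imageI, of "gen (Suc i, Suc j)" "gen (Suc i, j)"] by simp
  qed
  have "Poly_Mapping.keys p \<subseteq> {(i, j). i + j = k}" using assms by (simp add: graded_def)
  then have "p \<in> cotensor_e ` graded (Suc k)"
    by (induction p rule: free_induct) (use r g in auto)
  then show ?thesis by auto
qed

text \<open>
  In degree \<open>k\<close> the transpose of \<open>f\<close> adds neighbouring coefficients, so it kills the element whose
  coefficients are alternating signs.
\<close>

lemma cotensor_singular_exists: "\<exists>p\<in>graded k. p \<noteq> 0 \<and> cotensor_e p = 0"
proof -
  let ?p = "\<Sum>i\<le>k. fscale ((- 1) ^ i) (gen (i, k - i))"
  have look: "Poly_Mapping.lookup ?p (i, j) = (if i + j = k then (- 1) ^ i else 0)" for i j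
  proof -
    have "Poly_Mapping.lookup ?p (i, j) = (\<Sum>l\<le>k. if l = i then (if i + j = k then (- 1) ^ i else 0) else 0)"
      unfolding lookup_sum by (rule sum.cong) (auto simp: lookup_gen)
    then show ?thesis by simp
  qed
  have "?p \<in> graded k" by (simp add: graded_iff look del: lookup_sum)
  moreover have "cotensor_e ?p = 0"
    by (rule poly_mapping_eqI) (auto simp: lookup_cotensor_e look simp del: tensor_linear)
  moreover have "Poly_Mapping.lookup ?p (0, k) \<noteq> 0" unfolding look by simp
  ultimately show ?thesis by (metis lookup_zero)
qed

section \<open>Self-duality\<close>

text \<open>
  An isomorphism \<open>\<phi>\<close> in degree \<open>k\<close> is continued to degree \<open>k + 1\<close>. Compatibility with \<open>f\<close> prescribes it
  on the image of \<open>f\<close>, which has codimension one. A vector \<open>w\<close> outside this image has to go to some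
  \<open>w'\<close> with \<open>e' w' = \<phi> (e w)\<close>, which exists as \<open>e'\<close> is surjective; it remains to keep \<open>w'\<close> outside the
  image of \<open>f'\<close>. If the kernel of \<open>e\<close> is not contained in the image of \<open>f\<close>, both \<open>w\<close> and \<open>w'\<close> are
  taken from the kernels. Otherwise every choice of \<open>w'\<close> will do: a relation \<open>w' = f' (\<phi> x)\<close> would put
  \<open>w - f x\<close> into the kernel of \<open>e\<close>, hence \<open>w\<close> into the image of \<open>f\<close>.
\<close>

lemma graded_iso_step:
  fixes f e f' e' :: "(nat \<times> nat \<Rightarrow>\<^sub>0 complex) \<Rightarrow> (nat \<times> nat \<Rightarrow>\<^sub>0 complex)"
  assumes lin: "flinear f" "flinear e" "flinear f'" "flinear e'" "flinear \<phi>"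
    and f: "\<And>x. x \<in> graded k \<Longrightarrow> f x \<in> graded (Suc k)"
    and f': "\<And>x. x \<in> graded k \<Longrightarrow> f' x \<in> graded (Suc k)"
    and e: "\<And>y. y \<in> graded (Suc k) \<Longrightarrow> e y \<in> graded k"
    and f_inj: "\<And>x. f x = 0 \<Longrightarrow> x = 0" and f'_inj: "\<And>x. f' x = 0 \<Longrightarrow> x = 0"
    and dec: "\<And>y. y \<in> graded (Suc k) \<Longrightarrow> \<exists>x\<in>graded k. \<exists>c. y = f x + fscale c z"
    and z: "z \<in> graded (Suc k)" "\<And>x. x \<in> graded k \<Longrightarrow> z \<noteq> f x"
    and dec': "\<And>y. y \<in> graded (Suc k) \<Longrightarrow> \<exists>x\<in>graded k. \<exists>c. y = f' x + fscale c z'"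
    and sing: "\<And>p q. p \<in> graded (Suc k) \<Longrightarrow> q \<in> graded (Suc k) \<Longrightarrow> e p = 0 \<Longrightarrow> e q = 0 \<Longrightarrow> p \<noteq> 0
      \<Longrightarrow> \<exists>c. q = fscale c p"
    and sing': "\<exists>u\<in>graded (Suc k). u \<noteq> 0 \<and> e' u = 0"
    and surj': "\<And>x. x \<in> graded k \<Longrightarrow> \<exists>y\<in>graded (Suc k). e' y = x"
    and \<phi>: "inj_on \<phi> (graded k)" "\<phi> ` graded k = graded k"
    and ef: "\<And>x. x \<in> graded k \<Longrightarrow> e' (f' (\<phi> x)) = \<phi> (e (f x))"
  shows "\<exists>\<psi>. flinear \<psi> \<and> inj_on \<psi> (graded (Suc k)) \<and> \<psi> ` graded (Suc k) = graded (Suc k) \<and>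
    (\<forall>x\<in>graded k. \<psi> (f x) = f' (\<phi> x)) \<and> (\<forall>y\<in>graded (Suc k). e' (\<psi> y) = \<phi> (e y))"
proof -
  note l = flinearD[OF lin(1)] flinearD[OF lin(2)] flinearD[OF lin(3)] flinearD[OF lin(4)] flinearD[OF lin(5)]
  note g = fsubspaceD[OF fsubspace_graded]
  have \<phi>_mem: "\<phi> x \<in> graded k" if "x \<in> graded k" for x using \<phi>(2) that by blast
  have \<phi>_inj: "x = 0" if "\<phi> x = 0" "x \<in> graded k" for x
    using inj_onD[OF \<phi>(1), of x 0] that g(1) l by simp
  have \<phi>_surj: "\<exists>x\<in>graded k. y = \<phi> x" if "y \<in> graded k" for y using \<phi>(2) that by blast
  \<comment> \<open>A complement \<open>w\<close> of the image of \<open>f\<close>, and its partner.\<close>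
  have "\<exists>w\<in>graded (Suc k). \<exists>w'\<in>graded (Suc k). (\<forall>x\<in>graded k. w \<noteq> f x) \<and> (\<forall>x\<in>graded k. w' \<noteq> f' x) \<and>
      e' w' = \<phi> (e w)"
  proof (cases "\<exists>u\<in>graded (Suc k). e u = 0 \<and> (\<forall>x\<in>graded k. u \<noteq> f x)")
    case True
    then obtain u where u: "u \<in> graded (Suc k)" "e u = 0" "\<forall>x\<in>graded k. u \<noteq> f x" by blast
    obtain u' where u': "u' \<in> graded (Suc k)" "u' \<noteq> 0" "e' u' = 0" using sing' by blast
    have "u' \<noteq> f' y" if y: "y \<in> graded k" for y
    proof
      assume eq: "u' = f' y"
      obtain x where x: "x \<in> graded k" "y = \<phi> x" using \<phi>_surj[OF y] by blast
      have "\<phi> (e (f x)) = 0" using ef[OF x(1)] u'(3) eq x(2) by simp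
      then have "e (f x) = 0" using \<phi>_inj e f x(1) by blast
      moreover have "f x \<noteq> 0" using f_inj[of x] u'(2) eq x(2) l by auto
      ultimately obtain c where "u = fscale c (f x)" using sing[of "f x" u] f x(1) u(1,2) by blast
      then have "u = f (fscale c x)" by (simp add: l)
      then show False using u(3) g(3)[OF x(1)] by blast
    qed
    then show ?thesis using u u' l by (intro bexI[of _ u] bexI[of _ u']) auto
  next
    case False
    obtain z'' where z'': "z'' \<in> graded (Suc k)" "e' z'' = \<phi> (e z)"
      using surj'[OF \<phi>_mem[OF e[OF z(1)]]] by blast
    have "z'' \<noteq> f' y" if y: "y \<in> graded k" for y
    proof
      assume eq: "z'' = f' y"
      obtain x where x: "x \<in> graded k" "y = \<phi> x" using \<phi>_surj[OF y] by blast
      have "\<phi> (e (z - f x)) = 0" using ef[OF x(1)] z''(2) eq x(2) by (simp add: l)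
      then have "e (z - f x) = 0" using \<phi>_inj e g(5)[OF z(1) f[OF x(1)]] by blast
      then obtain y where y: "y \<in> graded k" "z - f x = f y"
        using False g(5)[OF z(1) f[OF x(1)]] by blast
      then have "z = f (x + y)" by (simp add: l algebra_simps)
      then show False using z(2) g(2)[OF x(1) y(1)] by blast
    qed
    then show ?thesis using z z'' by blast
  qed
  then obtain w w' where w: "w \<in> graded (Suc k)" "\<And>x. x \<in> graded k \<Longrightarrow> w \<noteq> f x"
    and w': "w' \<in> graded (Suc k)" "\<And>x. x \<in> graded k \<Longrightarrow> w' \<noteq> f' x" and ew: "e' w' = \<phi> (e w)" by blast
  have complement: "\<exists>x\<in>graded k. \<exists>c. y = h x + fscale c v"
    if h: "flinear h" and d: "\<And>y. y \<in> graded (Suc k) \<Longrightarrow> \<exists>x\<in>graded k. \<exists>c. y = h x + fscale c t"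
      and v: "v \<in> graded (Suc k)" "\<And>x. x \<in> graded k \<Longrightarrow> v \<noteq> h x" and y: "y \<in> graded (Suc k)" for h t v y
  proof -
    note lh = flinearD[OF h]
    obtain a c where a: "a \<in> graded k" "v = h a + fscale c t" using d[OF v(1)] by blast
    have "c \<noteq> 0" using v(2)[OF a(1)] a(2) by auto
    then have t: "t = fscale (1 / c) (v - h a)" using a(2) by simp
    obtain b d where b: "b \<in> graded k" "y = h b + fscale d t" using d[OF y] by blast
    have "y = h (b - fscale (d / c) a) + fscale (d / c) v"
      by (simp add: b(2) t lh fscale_distribs)
    then show ?thesis using g(5)[OF b(1) g(3)[OF a(1)]] by blast
  qed
  have unique: "x = y \<and> c = d"
    if h: "flinear h" "\<And>x. h x = 0 \<Longrightarrow> x = 0" and v: "\<And>x. x \<in> graded k \<Longrightarrow> v \<noteq> h x"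
      and xy: "x \<in> graded k" "y \<in> graded k" and eq: "h x + fscale c v = h y + fscale d v" for h v x y c d
  proof -
    note lh = flinearD[OF h(1)]
    have eq': "fscale (c - d) v = h (y - x)" using eq by (simp add: lh fscale_distribs algebra_simps)
    have "c = d"
    proof (rule ccontr)
      assume "c \<noteq> d"
      then have "v = fscale (1 / (c - d)) (fscale (c - d) v)" by simp
      also have "\<dots> = h (fscale (1 / (c - d)) (y - x))" by (simp add: eq' lh)
      finally show False using v g(3)[OF g(5)[OF xy(2,1)]] by blast
    qed
    then show ?thesis using eq' h(2)[of "y - x"] by simp
  qed
  define \<psi>0 where "\<psi>0 y = (THE t. \<exists>x\<in>graded k. \<exists>c. y = f x + fscale c w \<and> t = f' (\<phi> x) + fscale c w')" for y
  have \<psi>0: "\<psi>0 (f x + fscale c w) = f' (\<phi> x) + fscale c w'" if x: "x \<in> graded k" for x c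
    unfolding \<psi>0_def
  proof (rule the_equality)
    show "\<exists>y\<in>graded k. \<exists>d. f x + fscale c w = f y + fscale d w \<and> f' (\<phi> x) + fscale c w' = f' (\<phi> y) + fscale d w'"
      using x by blast
    fix t assume "\<exists>y\<in>graded k. \<exists>d. f x + fscale c w = f y + fscale d w \<and> t = f' (\<phi> y) + fscale d w'"
    then obtain y d where y: "y \<in> graded k" "f x + fscale c w = f y + fscale d w" "t = f' (\<phi> y) + fscale d w'" by blast
    show "t = f' (\<phi> x) + fscale c w'"
      using unique[OF lin(1) f_inj w(2) x y(1,2)] y(3) by simp
  qed
  define \<psi> where "\<psi> = linear_extension (\<lambda>x. if fst x + snd x = Suc k then \<psi>0 (gen x) else 0)"
  have lin\<psi>: "flinear \<psi>" unfolding \<psi>_def by (rule flinear_linear_extension)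
  note l\<psi> = flinearD[OF lin\<psi>]
  have \<psi>_eq: "\<psi> y = \<psi>0 y" if "y \<in> graded (Suc k)" for y
  proof -
    have "Poly_Mapping.keys y \<subseteq> {(i, j). i + j = Suc k}" using that by (simp add: graded_def)
    then show ?thesis
    proof (induction y rule: free_induct)
      case zero
      show ?case using \<psi>0[OF g(1), of 0] by (simp add: l\<psi> l)
    next
      case (add p q)
      then have "p \<in> graded (Suc k)" "q \<in> graded (Suc k)" by (simp_all add: graded_def)
      then obtain x c y d where x: "x \<in> graded k" "p = f x + fscale c w"
        and y: "y \<in> graded k" "q = f y + fscale d w"
        using complement[OF lin(1) dec w] by meson
      have "p + q = f (x + y) + fscale (c + d) w" by (simp add: x y l fscale_distribs)
      then have "\<psi>0 (p + q) = f' (\<phi> (x + y)) + fscale (c + d) w'" using \<psi>0[OF g(2)[OF x(1) y(1)]] by simp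
      also have "\<dots> = \<psi>0 p + \<psi>0 q" using \<psi>0 x y by (simp add: l fscale_distribs)
      finally show ?case using add by (simp add: l\<psi>)
    next
      case (scale a p)
      then have "p \<in> graded (Suc k)" by (simp add: graded_def)
      then obtain x c where x: "x \<in> graded k" "p = f x + fscale c w"
        using complement[OF lin(1) dec w] by meson
      have "fscale a p = f (fscale a x) + fscale (a * c) w" by (simp add: x l fscale_distribs)
      then have "\<psi>0 (fscale a p) = f' (\<phi> (fscale a x)) + fscale (a * c) w'" using \<psi>0[OF g(3)[OF x(1)]] by simp
      also have "\<dots> = fscale a (\<psi>0 p)" using \<psi>0 x by (simp add: l fscale_distribs)
      finally show ?case using scale by (simp add: l\<psi>)
    next
      case (gen x)
      then show ?case by (auto simp: \<psi>_def)
    qed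
  qed
  have \<psi>: "\<psi> (f x + fscale c w) = f' (\<phi> x) + fscale c w'" if "x \<in> graded k" for x c
    using \<psi>_eq[of "f x + fscale c w"] \<psi>0[OF that] g(2)[OF f[OF that] g(3)[OF w(1)]] by simp
  have repr: "\<exists>x\<in>graded k. \<exists>c. y = f x + fscale c w" if "y \<in> graded (Suc k)" for y
    by (rule complement[OF lin(1) dec w that])
  have 1: "\<psi> (f x) = f' (\<phi> x)" if "x \<in> graded k" for x
    using \<psi>[OF that, of 0] by simp
  have 2: "e' (\<psi> y) = \<phi> (e y)" if y: "y \<in> graded (Suc k)" for y
  proof -
    obtain x c where x: "x \<in> graded k" "y = f x + fscale c w" using repr[OF y] by blast
    have "e' (\<psi> y) = e' (f' (\<phi> x)) + fscale c (e' w')" using \<psi>[OF x(1), of c] x(2) by (simp add: l)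
    also have "\<dots> = \<phi> (e y)" by (simp add: ef[OF x(1)] ew x(2) l)
    finally show ?thesis .
  qed
  have 3: "inj_on \<psi> (graded (Suc k))"
  proof (rule inj_onI)
    fix y y' assume y: "y \<in> graded (Suc k)" "y' \<in> graded (Suc k)" "\<psi> y = \<psi> y'"
    obtain x c where x: "x \<in> graded k" "y = f x + fscale c w" using repr[OF y(1)] by blast
    obtain x' c' where x': "x' \<in> graded k" "y' = f x' + fscale c' w" using repr[OF y(2)] by blast
    have eq: "f' (\<phi> x) + fscale c w' = f' (\<phi> x') + fscale c' w'"
      using y(3) \<psi>[OF x(1)] \<psi>[OF x'(1)] x(2) x'(2) by simp
    have "\<phi> x = \<phi> x' \<and> c = c'"
      by (rule unique[OF lin(3) f'_inj w'(2) \<phi>_mem[OF x(1)] \<phi>_mem[OF x'(1)] eq])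
    then show "y = y'" using inj_onD[OF \<phi>(1)] x x' by blast
  qed
  have 4: "\<psi> ` graded (Suc k) = graded (Suc k)"
  proof
    show "\<psi> ` graded (Suc k) \<subseteq> graded (Suc k)"
    proof
      fix t assume "t \<in> \<psi> ` graded (Suc k)"
      then obtain x c where "x \<in> graded k" "t = \<psi> (f x + fscale c w)" using repr by blast
      then show "t \<in> graded (Suc k)"
        using \<psi> g(2)[OF f'[OF \<phi>_mem] g(3)[OF w'(1)]] by simp
    qed
    show "graded (Suc k) \<subseteq> \<psi> ` graded (Suc k)"
    proof
      fix t assume t: "t \<in> graded (Suc k)"
      obtain y c where y: "y \<in> graded k" "t = f' y + fscale c w'"
        using complement[OF lin(3) dec' w' t] by blast
      obtain x where x: "x \<in> graded k" "y = \<phi> x" using \<phi>_surj[OF y(1)] by blast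
      have "t = \<psi> (f x + fscale c w)" using \<psi>[OF x(1)] y(2) x(2) by simp
      then show "t \<in> \<psi> ` graded (Suc k)" using g(2)[OF f[OF x(1)] g(3)[OF w(1)]] by blast
    qed
  qed
  show ?thesis using lin\<psi> 1 2 3 4 by blast
qed

text \<open>
  Isomorphisms \<open>\<Phi> k\<close> of the degree \<open>k\<close> parts are chosen one after the other. The next step needs
  \<open>\<Phi> k\<close> to commute with \<open>e f\<close>, and this is inherited, because \<open>e f - f e = h\<close> acts on both sides in
  degree \<open>k\<close> by the same scalar.
\<close>

lemma tensor_model_self_dual:
  assumes a: "a \<noteq> 0" and n: "n \<notin> \<nat>"
  shows "lie_isomorphic sl2 (tensor_model m n) (cotensor_model a m n)"
proof -
  define f where "f = tensor_f"
  define e where "e = tensor_e m n"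
  define h where "h = tensor_h m n"
  define f' where "f' = (\<lambda>p. fscale (1 / a) (cotensor_f m n p))"
  define e' where "e' = (\<lambda>p. fscale a (cotensor_e p))"
  have lin: "flinear f" "flinear e" "flinear h" "flinear f'" "flinear e'"
    by (simp_all add: f_def e_def h_def f'_def e'_def flinear_ops)
  note l = flinearD[OF lin(1)] flinearD[OF lin(2)] flinearD[OF lin(4)] flinearD[OF lin(5)]
  note gr = fsubspaceD[OF fsubspace_graded]
  have grf: "f p \<in> graded (Suc k)" and grf': "f' p \<in> graded (Suc k)"
    and hp: "h p = fscale (m + n - 2 * of_nat k) p" if "p \<in> graded k" for p k
    using graded_operators(1,4,7)[OF that] gr(3) by (simp_all add: f_def f'_def h_def)
  have gre: "e p \<in> graded k" and gre': "e' p \<in> graded k" if "p \<in> graded (Suc k)" for p k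
    using graded_operators(2,5)[OF that] gr(3) by (simp_all add: e_def e'_def)
  have e0: "e p = 0" and e'0: "e' p = 0" if "p \<in> graded 0" for p
    using graded_operators(3,6)[OF that] by (simp_all add: e_def e'_def)
  have comm: "e (f p) = f (e p) + h p" "e' (f' p) = f' (e' p) + h p" for p
  proof -
    show "e (f p) = f (e p) + h p"
      using sl2_commute(3)[OF lie_module_tensor_model, of p m n] by (simp add: e_def f_def h_def add.commute)
    show "e' (f' p) = f' (e' p) + h p"
      using sl2_commute(3)[OF lie_module_cotensor_model[OF a], of p m n] by (simp add: e'_def f'_def h_def add.commute)
  qed
  define P where "P k \<phi> \<longleftrightarrow> flinear \<phi> \<and> inj_on \<phi> (graded k) \<and> \<phi> ` graded k = graded k \<and>
    (\<forall>x\<in>graded k. e' (f' (\<phi> x)) = \<phi> (e (f x)))" for k and \<phi> :: "(nat \<times> nat \<Rightarrow>\<^sub>0 complex) \<Rightarrow> (nat \<times> nat \<Rightarrow>\<^sub>0 complex)"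
  define Q where "Q k \<phi> \<psi> \<longleftrightarrow> (\<forall>x\<in>graded k. \<psi> (f x) = f' (\<phi> x)) \<and> (\<forall>y\<in>graded (Suc k). e' (\<psi> y) = \<phi> (e y))"
    for k and \<phi> \<psi> :: "(nat \<times> nat \<Rightarrow>\<^sub>0 complex) \<Rightarrow> (nat \<times> nat \<Rightarrow>\<^sub>0 complex)"
  have "\<exists>\<Phi>. \<forall>k. P k (\<Phi> k) \<and> Q k (\<Phi> k) (\<Phi> (Suc k))"
  proof (rule dependent_nat_choice)
    show "\<exists>\<phi>. P 0 \<phi>"
      unfolding P_def by (rule exI[of _ "\<lambda>p. p"]) (simp add: comm e0 e'0 l flinear_ops)
  next
    fix \<phi> k assume P: "P k \<phi>"
    have "\<exists>\<psi>. flinear \<psi> \<and> inj_on \<psi> (graded (Suc k)) \<and> \<psi> ` graded (Suc k) = graded (Suc k) \<and>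
      (\<forall>x\<in>graded k. \<psi> (f x) = f' (\<phi> x)) \<and> (\<forall>y\<in>graded (Suc k). e' (\<psi> y) = \<phi> (e y))"
    proof (rule graded_iso_step[of f e f' e' \<phi> k "gen (Suc k, 0)" "gen (Suc k, 0)"])
      show "f x = 0 \<Longrightarrow> x = 0" for x using tensor_f_injective by (simp add: f_def)
      show "f' x = 0 \<Longrightarrow> x = 0" for x using cotensor_f_injective[OF n] a by (simp add: f'_def)
      show "y \<in> graded (Suc k) \<Longrightarrow> \<exists>x\<in>graded k. \<exists>c. y = f x + fscale c (gen (Suc k, 0))" for y
        using tensor_f_decomposition by (simp add: f_def)
      show "gen (Suc k, 0) \<in> graded (Suc k)" using gen_graded[of "Suc k" 0] by simp
      show "x \<in> graded k \<Longrightarrow> gen (Suc k, 0) \<noteq> f x" for x using gen_notin_tensor_f by (simp add: f_def)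
      show "\<exists>x\<in>graded k. \<exists>c. y = f' x + fscale c (gen (Suc k, 0))" if y: "y \<in> graded (Suc k)" for y
      proof -
        obtain x c where x: "x \<in> graded k" "y = cotensor_f m n x + fscale c (gen (Suc k, 0))"
          using cotensor_f_decomposition[OF n y] by blast
        then have "y = f' (fscale a x) + fscale c (gen (Suc k, 0))" using a by (simp add: f'_def)
        then show ?thesis using gr(3)[OF x(1)] by blast
      qed
      show "\<exists>c. q = fscale c p" if "p \<in> graded (Suc k)" "q \<in> graded (Suc k)" "e p = 0" "e q = 0" "p \<noteq> 0" for p q
        using tensor_singular_unique[OF n that(1,2)] that(3-) by (simp add: e_def)
      show "\<exists>u\<in>graded (Suc k). u \<noteq> 0 \<and> e' u = 0"
        using cotensor_singular_exists[of "Suc k"] by (auto simp: e'_def)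
      show "\<exists>y\<in>graded (Suc k). e' y = x" if x: "x \<in> graded k" for x
      proof -
        obtain y where y: "y \<in> graded (Suc k)" "cotensor_e y = x" using cotensor_e_surjective[OF x] by blast
        then have "e' (fscale (1 / a) y) = x" using a by (simp add: e'_def)
        then show ?thesis using gr(3)[OF y(1)] by blast
      qed
    qed (use P lin grf grf' gre in \<open>auto simp: P_def\<close>)
    then obtain \<psi> where \<psi>: "flinear \<psi>" "inj_on \<psi> (graded (Suc k))" "\<psi> ` graded (Suc k) = graded (Suc k)"
      "Q k \<phi> \<psi>" unfolding Q_def by blast
    have "e' (f' (\<psi> x)) = \<psi> (e (f x))" if x: "x \<in> graded (Suc k)" for x
    proof -
      have "\<psi> x \<in> graded (Suc k)" using \<psi>(3) x by blast
      then have "e' (f' (\<psi> x)) = f' (e' (\<psi> x)) + fscale (m + n - 2 * of_nat (Suc k)) (\<psi> x)"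
        by (simp add: comm hp del: of_nat_Suc)
      also have "\<dots> = \<psi> (f (e x)) + fscale (m + n - 2 * of_nat (Suc k)) (\<psi> x)"
        using \<psi>(4) x gre[OF x] by (simp add: Q_def del: of_nat_Suc)
      also have "\<dots> = \<psi> (e (f x))"
        by (simp add: comm hp[OF x] flinearD[OF \<psi>(1)] del: of_nat_Suc)
      finally show ?thesis .
    qed
    then show "\<exists>\<psi>. P (Suc k) \<psi> \<and> Q k \<phi> \<psi>" using \<psi> unfolding P_def by blast
  qed
  then obtain \<Phi> where \<Phi>: "\<And>k. P k (\<Phi> k)" "\<And>k. Q k (\<Phi> k) (\<Phi> (Suc k))" by blast
  have \<Phi>lin: "flinear (\<Phi> k)" and \<Phi>inj: "inj_on (\<Phi> k) (graded k)" and \<Phi>im: "\<Phi> k ` graded k = graded k" for k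
    using \<Phi>(1)[of k] by (simp_all add: P_def)
  define \<theta> where "\<theta> = linear_extension (\<lambda>x. \<Phi> (fst x + snd x) (gen x))"
  have \<theta>lin: "flinear \<theta>" unfolding \<theta>_def by (rule flinear_linear_extension)
  have \<theta>: "\<theta> p = \<Phi> k p" if "p \<in> graded k" for p k
  proof -
    have "Poly_Mapping.keys p \<subseteq> {(i, j). i + j = k}" using that by (simp add: graded_def)
    then show ?thesis
      by (induction p rule: free_induct)
        (auto simp: flinearD[OF \<theta>lin] flinearD[OF \<Phi>lin], auto simp: \<theta>_def)
  qed
  define \<eta> where "\<eta> = linear_extension (\<lambda>x. inv_into (graded (fst x + snd x)) (\<Phi> (fst x + snd x)) (gen x))"
  have \<eta>lin: "flinear \<eta>" unfolding \<eta>_def by (rule flinear_linear_extension)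
  have gen_in: "gen (i, j) \<in> \<Phi> (i + j) ` graded (i + j)" for i j using \<Phi>im gen_graded by simp
  have \<eta>gen: "\<eta> (gen (i, j)) \<in> graded (i + j)" "\<Phi> (i + j) (\<eta> (gen (i, j))) = gen (i, j)" for i j
    using inv_into_into[OF gen_in[of i j]] f_inv_into_f[OF gen_in[of i j]] by (simp_all add: \<eta>_def)
  have \<eta>_graded: "\<eta> p \<in> graded k" if "p \<in> graded k" for p k
  proof -
    have "Poly_Mapping.keys p \<subseteq> {(i, j). i + j = k}" using that by (simp add: graded_def)
    then show ?thesis
      by (induction p rule: free_induct) (use \<eta>gen in \<open>auto simp: flinearD[OF \<eta>lin] gr\<close>)
  qed
  have \<theta>\<eta>: "\<theta> (\<eta> p) = p" for p
    by (rule pair_flinear_eqI[of "\<lambda>p. \<theta> (\<eta> p)" "\<lambda>p. p"])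
      (simp_all add: flinear_comp \<theta>lin \<eta>lin flinear_ops \<theta>[OF \<eta>gen(1)] \<eta>gen(2))
  have \<eta>\<theta>: "\<eta> (\<theta> p) = p" for p
  proof (rule pair_flinear_eqI[of "\<lambda>p. \<eta> (\<theta> p)" "\<lambda>p. p"])
    fix i j
    have "\<theta> (gen (i, j)) \<in> graded (i + j)" using \<theta>[OF gen_graded] \<Phi>im gen_graded by blast
    then have g: "\<eta> (\<theta> (gen (i, j))) \<in> graded (i + j)" by (rule \<eta>_graded)
    have "\<Phi> (i + j) (\<eta> (\<theta> (gen (i, j)))) = \<Phi> (i + j) (gen (i, j))"
      using \<theta>[OF g] \<theta>\<eta>[of "\<theta> (gen (i, j))"] \<theta>[OF gen_graded] by simp
    then show "\<eta> (\<theta> (gen (i, j))) = gen (i, j)"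
      using inj_onD[OF \<Phi>inj] g gen_graded by blast
  qed (simp_all add: flinear_comp \<theta>lin \<eta>lin flinear_ops)
  have "bij \<theta>" by (rule bij_betw_byWitness[of _ \<eta>]) (auto simp: \<theta>\<eta> \<eta>\<theta>)
  moreover have "\<theta> \<in> lie_hom sl2 (tensor_model m n) (cotensor_model a m n)"
  proof -
    have \<theta>gr: "\<theta> p \<in> graded k" if "p \<in> graded k" for p k using \<theta>[OF that] \<Phi>im that by blast
    have "\<theta> (h p) = h (\<theta> p)" for p
    proof (rule pair_flinear_eqI[of "\<lambda>p. \<theta> (h p)" "\<lambda>p. h (\<theta> p)"])
      fix i j show "\<theta> (h (gen (i, j))) = h (\<theta> (gen (i, j)))"
        by (simp only: hp[OF gen_graded] hp[OF \<theta>gr[OF gen_graded]] flinearD[OF \<theta>lin])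
    qed (simp_all add: flinear_comp \<theta>lin lin)
    moreover have "\<theta> (f p) = f' (\<theta> p)" for p
    proof (rule pair_flinear_eqI[of "\<lambda>p. \<theta> (f p)" "\<lambda>p. f' (\<theta> p)"])
      fix i j show "\<theta> (f (gen (i, j))) = f' (\<theta> (gen (i, j)))"
        using \<Phi>(2)[of "i + j"] gen_graded[of i j] \<theta>[OF gen_graded[of i j]] \<theta>[OF grf[OF gen_graded[of i j]]]
        by (simp add: Q_def)
    qed (simp_all add: flinear_comp \<theta>lin lin)
    moreover have "\<theta> (e p) = e' (\<theta> p)" for p
    proof (rule pair_flinear_eqI[of "\<lambda>p. \<theta> (e p)" "\<lambda>p. e' (\<theta> p)"])
      fix i j show "\<theta> (e (gen (i, j))) = e' (\<theta> (gen (i, j)))"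
      proof (cases "i + j")
        case 0
        then have "gen (i, j) \<in> graded 0" using gen_graded[of i j] by simp
        then show ?thesis using e0 e'0 \<theta>gr flinearD(3)[OF \<theta>lin] by metis
      next
        case (Suc k)
        then have g: "gen (i, j) \<in> graded (Suc k)" using gen_graded[of i j] by simp
        show ?thesis using \<Phi>(2)[of k] g \<theta>[OF g] \<theta>[OF gre[OF g]] by (simp add: Q_def)
      qed
    qed (simp_all add: flinear_comp \<theta>lin lin)
    ultimately show ?thesis
      using lie_module_tensor_model[of m n] lie_module_cotensor_model[OF a, of m n] \<theta>lin
      unfolding tensor_model_def cotensor_model_def f_def e_def h_def f'_def e'_def
      by (intro sl2_model_homI) auto
  qed
  ultimately show ?thesis unfolding lie_isomorphic_def by (intro bexI) simp_all
qed

section \<open>The four conditions on the tensor product\<close>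

subsection \<open>Homomorphisms from Verma modules\<close>

text \<open>
  The weight \<open>\<nu>\<close> determines the degree, and in one degree singular vectors are proportional.
\<close>

lemma tensor_singular_dependent:
  assumes n: "n \<notin> \<nat>" and u: "singular_vector (tensor_model m n) \<nu> u" and v: "singular_vector (tensor_model m n) \<nu> v"
  shows "\<exists>a b. (a \<noteq> 0 \<or> b \<noteq> 0) \<and> fscale a u + fscale b v = 0"
proof (cases "u = 0")
  case True
  then show ?thesis by (intro exI[of _ 1] exI[of _ 0]) simp
next
  case False
  have weight: "(m + n - 2 * of_nat (i + j) - \<nu>) * Poly_Mapping.lookup w (i, j) = 0"
    if "singular_vector (tensor_model m n) \<nu> w" for w i j
    using that lookup_tensor_h[of m n w i j] by (simp add: singular_vector_def algebra_simps)
  obtain i j where ij: "Poly_Mapping.lookup u (i, j) \<noteq> 0"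
    using False by (metis poly_mapping_eqI lookup_zero surj_pair)
  have \<nu>: "\<nu> = m + n - 2 * of_nat (i + j)" using weight[OF u, of i j] ij by simp
  have graded: "w \<in> graded (i + j)" if "singular_vector (tensor_model m n) \<nu> w" for w
    unfolding graded_iff
  proof (intro allI impI)
    fix i' j' assume "i' + j' \<noteq> i + j"
    then have "of_nat (i' + j') \<noteq> (of_nat (i + j) :: complex)" unfolding of_nat_eq_iff .
    then show "Poly_Mapping.lookup w (i', j') = 0" using weight[OF that, of i' j'] by (simp add: \<nu> del: of_nat_add)
  qed
  obtain c where "v = fscale c u"
    using tensor_singular_unique[OF n graded[OF u] graded[OF v] _ _ False] u v by (auto simp: singular_vector_def)
  then show ?thesis by (intro exI[of _ c] exI[of _ "-1"]) (simp add: fscale_distribs)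
qed

text \<open>
  Exchanging the factors reduces the statement to the case that \<open>n\<close> is not a natural number.
\<close>

lemma dim_hom_tensor_model:
  assumes "\<not> (m \<in> \<nat> \<and> n \<in> \<nat>)"
  shows "dim_hom_le_1 sl2 (verma_model \<nu>) (tensor_model m n)"
proof -
  have *: "dim_hom_le_1 sl2 (verma_model \<nu>) (tensor_model m n)" if "n \<notin> \<nat>" for m n
    using tensor_singular_dependent[OF that] by (simp add: dim_hom_verma_model[OF lie_module_tensor_model])
  show ?thesis
  proof (cases "n \<in> \<nat>")
    case True
    then have "m \<notin> \<nat>" using assms by simp
    from *[OF this, of n] show ?thesis
      by (rule dim_hom_le_1_iso[rotated -1])
        (simp_all add: lie_module_verma_model lie_module_tensor_model lie_isomorphic_refl tensor_model_swap)
  qed (rule *)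
qed

text \<open>
  The vector \<open>f\<^sup>K (v \<otimes> w)\<close> with \<open>K = M + N + 1\<close> has binomial coefficients and is singular. The equation
  that links its coefficients at \<open>(i, K - i)\<close> and \<open>(i + 1, K - i - 1)\<close> carries the factor \<open>M - i\<close> and is
  void for \<open>i = M\<close>. So the vector can be cut there into two pieces that are both singular.
\<close>

lemma tensor_two_singular_vectors:
  fixes M N :: nat
  defines "m \<equiv> of_nat M :: complex" and "n \<equiv> of_nat N :: complex"
  obtains u v where "singular_vector (tensor_model m n) (- m - n - 2) u"
    "singular_vector (tensor_model m n) (- m - n - 2) v"
    "\<And>a b. fscale a u + fscale b v = 0 \<Longrightarrow> a = 0 \<and> b = 0"
proof -
  define K where "K = Suc (M + N)"
  define part where "part I = (\<Sum>i\<in>I. fscale (of_nat (K choose i)) (gen (i, K - i)))" for I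
  have look: "Poly_Mapping.lookup (part I) (i, j) = (if i \<in> I \<and> i + j = K then of_nat (K choose i) else 0)"
    if "finite I" "I \<subseteq> {..K}" for I i j
  proof -
    have "Poly_Mapping.lookup (part I) (i, j)
      = (\<Sum>l\<in>I. if l = i then (if i + j = K then of_nat (K choose i) else 0) else 0)"
      unfolding part_def lookup_sum by (rule sum.cong) (use that in \<open>auto simp: lookup_gen\<close>)
    then show ?thesis using that by simp
  qed
  have binom: "of_nat (Suc i) * of_nat (K choose Suc i) = (of_nat (K - i) * of_nat (K choose i) :: complex)" for i
  proof -
    have "Suc i * (K choose Suc i) = (K - i) * (K choose i)"
      using binomial_absorb_comp[of K i] Suc_times_binomial[of i "M + N"]
      by (simp add: K_def del: binomial_Suc_Suc mult_Suc)
    then show ?thesis by (simp only: of_nat_mult[symmetric])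
  qed
  have sing: "singular_vector (tensor_model m n) (- m - n - 2) (part I)"
    if I: "finite I" "I \<subseteq> {..K}" and closed: "\<And>i. i < K \<Longrightarrow> i \<noteq> M \<Longrightarrow> i \<in> I \<longleftrightarrow> Suc i \<in> I" for I
  proof -
    note lk = look[OF I]
    have e: "tensor_e m n (part I) = 0"
    proof (rule poly_mapping_eqI)
      fix x :: "nat \<times> nat"
      obtain i j where x: "x = (i, j)" by (cases x)
      have "Poly_Mapping.lookup (tensor_e m n (part I)) (i, j) = 0"
      proof (cases "i + j = M + N \<and> i \<noteq> M")
        case True
        then have Kij: "Suc i + j = K" "i + Suc j = K" "K - i = Suc j" by (auto simp: K_def)
        have nj: "n - of_nat j = - (m - of_nat i)"
        proof -
          have "(of_nat (i + j) :: complex) = of_nat (M + N)" using True by simp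
          then show ?thesis by (simp add: m_def n_def algebra_simps)
        qed
        have "Suc i \<in> I \<longleftrightarrow> i \<in> I" using closed[of i] True by (simp add: K_def)
        then show ?thesis
          unfolding lookup_tensor_e lk nj using Kij binom[of i]
          by (simp add: algebra_simps del: of_nat_Suc binomial_Suc_Suc)
      next
        case False
        then show ?thesis unfolding lookup_tensor_e lk by (auto simp: K_def m_def n_def)
      qed
      then show "Poly_Mapping.lookup (tensor_e m n (part I)) x = Poly_Mapping.lookup 0 x" by (simp add: x)
    qed
    have "part I \<in> graded K" by (simp add: graded_iff lk)
    from graded_operators(7)[OF this, of m n]
    have "tensor_h m n (part I) = fscale (- m - n - 2) (part I)" by (simp add: K_def m_def n_def algebra_simps)
    then show ?thesis using e by (simp add: singular_vector_def)
  qed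
  show thesis
  proof (rule that[of "part {..M}" "part {Suc M..K}"])
    fix a b assume eq: "fscale a (part {..M}) + fscale b (part {Suc M..K}) = 0"
    have "Poly_Mapping.lookup (fscale a (part {..M}) + fscale b (part {Suc M..K})) (M, Suc N) = a * of_nat (K choose M)"
      unfolding lookup_add by (simp add: look K_def)
    moreover have "Poly_Mapping.lookup (fscale a (part {..M}) + fscale b (part {Suc M..K})) (Suc M, N) = b * of_nat (K choose Suc M)"
      unfolding lookup_add by (simp add: look K_def)
    moreover have "(of_nat (K choose M) :: complex) \<noteq> 0" "(of_nat (K choose Suc M) :: complex) \<noteq> 0"
      unfolding of_nat_eq_0_iff by (simp_all add: K_def binomial_eq_0_iff del: binomial_Suc_Suc)
    ultimately show "a = 0 \<and> b = 0" unfolding eq by simp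
  qed (auto intro!: sing simp: K_def)
qed

lemma dim_hom_tensor_model_fails:
  assumes "m \<in> \<nat>" "n \<in> \<nat>"
  shows "\<not> dim_hom_le_1 sl2 (verma_model (- m - n - 2)) (tensor_model m n)"
proof -
  obtain M N where MN: "m = of_nat M" "n = of_nat N" using assms by (auto elim!: Nats_cases)
  show ?thesis
    unfolding dim_hom_verma_model[OF lie_module_tensor_model] MN
    using tensor_two_singular_vectors[of M N] by (metis tensor_model_simps(2,3,4))
qed

lemma minus_Nats_not_Nats: "m \<in> \<nat> \<Longrightarrow> n \<in> \<nat> \<Longrightarrow> - m - n - 2 \<notin> (\<nat> :: complex set)"
proof
  assume "m \<in> \<nat>" "n \<in> \<nat>" "- m - n - 2 \<in> (\<nat> :: complex set)"
  then obtain a b c where abc: "m = of_nat a" "n = of_nat b" "- m - n - 2 = (of_nat c :: complex)"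
    by (auto elim!: Nats_cases)
  have "of_nat (a + b + c + 2) = of_nat a + of_nat b + of_nat c + (2 :: complex)" by simp
  also have "\<dots> = 0" by (simp add: abc(1,2) flip: abc(3))
  finally have "of_nat (a + b + c + 2) = (0 :: complex)" .
  then show False unfolding of_nat_eq_0_iff by simp
qed

subsection \<open>Duality\<close>

lemma self_dual_tensor_model:
  assumes a: "a \<noteq> 0" and "\<not> (m \<in> \<nat> \<and> n \<in> \<nat>)"
  shows "lie_isomorphic sl2 (cotensor_model a m n) (tensor_model m n)"
proof -
  have *: "lie_isomorphic sl2 (cotensor_model a m n) (tensor_model m n)" if "n \<notin> \<nat>" for m n
    by (rule lie_isomorphic_sym[OF lie_module_tensor_model tensor_model_self_dual[OF a that]])
  show ?thesis
  proof (cases "n \<in> \<nat>")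
    case True
    then have "m \<notin> \<nat>" using assms by simp
    from *[OF this, of n] show ?thesis
      using lie_isomorphic_trans lie_module_cotensor_model[OF a] cotensor_model_swap[OF a] tensor_model_swap by metis
  qed (rule *)
qed

text \<open>
  The transpose of \<open>e\<close> kills the basis element \<open>(m, n)\<close>, while \<open>f\<close> is injective on the tensor product.
\<close>

lemma not_self_dual_tensor_model:
  assumes a: "a \<noteq> 0" and mn: "m \<in> \<nat>" "n \<in> \<nat>"
  shows "\<not> lie_isomorphic sl2 (cotensor_model a m n) (tensor_model m n)"
proof
  assume "lie_isomorphic sl2 (cotensor_model a m n) (tensor_model m n)"
  then obtain g where g: "g \<in> lie_hom sl2 (cotensor_model a m n) (tensor_model m n)" "bij g"
    by (auto simp: lie_isomorphic_def)
  obtain M N where MN: "m = of_nat M" "n = of_nat N" using mn by (auto elim!: Nats_cases)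
  let ?p = "gen (M, N) :: nat \<times> nat \<Rightarrow>\<^sub>0 complex"
  have g0: "g 0 = 0"
    using lie_hom_zero[OF lie_module_cotensor_model[OF a] lie_module_tensor_model g(1)] by simp
  have "cotensor_f m n ?p = 0" by (simp add: MN)
  then have "tensor_f (g ?p) = 0" using lie_homD(4)[OF g(1), of mat_f ?p] g0 by simp
  then have "g ?p = g 0" using tensor_f_injective g0 by simp
  then have "?p = 0" using g(2) by (simp add: bij_def inj_eq)
  then have "Poly_Mapping.lookup ?p (M, N) = 0" by simp
  then show False by (simp add: lookup_gen)
qed

subsection \<open>Direct summands\<close>

text \<open>
  A retraction onto \<open>M(\<nu>)\<close> would make \<open>e\<close> surjective on \<open>M(\<nu>)\<close>, since it is surjective on the tensor
  product. But for \<open>\<nu> \<in> \<nat>\<close> the vector \<open>f\<^sup>\<nu> v\<close> is not in its image.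
\<close>

lemma no_reducible_summand:
  assumes "\<not> (m \<in> \<nat> \<and> n \<in> \<nat>)" and \<nu>: "\<nu> \<in> \<nat>"
  shows "\<not> has_direct_summand sl2 (tensor_model m n) (verma_model \<nu>)"
proof -
  have *: "\<not> has_direct_summand sl2 (tensor_model m n) (verma_model \<nu>)" if n: "n \<notin> \<nat>" for m n
  proof
    assume "has_direct_summand sl2 (tensor_model m n) (verma_model \<nu>)"
    then obtain q p where p: "p \<in> lie_hom sl2 (tensor_model m n) (verma_model \<nu>)" and pq: "\<And>d. p (q d) = d"
      unfolding has_direct_summand_iff[OF lie_module_tensor_model lie_module_verma_model] by auto
    obtain N where N: "\<nu> = of_nat N" using \<nu> by (auto elim: Nats_cases)
    obtain t where "tensor_e m n t = q (gen N)" using tensor_e_surjective[OF n] by blast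
    then have "verma_e \<nu> (p t) = gen N" using lie_homD(4)[OF p, of mat_e t] pq by simp
    moreover have "Poly_Mapping.lookup (verma_e \<nu> (p t)) N = 0" by (simp add: lookup_verma_e N)
    ultimately show False by (simp add: lookup_gen)
  qed
  show ?thesis
  proof (cases "n \<in> \<nat>")
    case True
    then have "m \<notin> \<nat>" using assms by simp
    from *[OF this, of n] show ?thesis
      using has_direct_summand_iso lie_module_tensor_model lie_module_verma_model lie_isomorphic_refl
        tensor_model_swap by metis
  qed (rule *)
qed

text \<open>
  A retraction of the tensor product onto the submodule generated by the highest weight vector must
  send \<open>(i, j)\<close> to a multiple \<open>d i j\<close> of \<open>f\<^bsup>i + j\<^esup> v\<close>. It intertwines \<open>f\<close> and \<open>e\<close> if and only if \<open>d\<close>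
  satisfies the two recursions \<open>d_f\<close> and \<open>d_e\<close>, and a product of a falling and a rising factorial
  solves both. It maps the generator to a nonzero vector as \<open>d 0 0 = (M + 1) \<dots> (M + N)\<close>.
\<close>

lemma verma_summand:
  fixes M N :: nat
  defines "m \<equiv> of_nat M :: complex" and "n \<equiv> of_nat N :: complex"
  shows "has_direct_summand sl2 (tensor_model m n) (verma_model (m + n))"
proof -
  define d where "d i j = (if j \<le> N then fact N / fact (N - j) * pochhammer (m - of_nat i + 1) (N - j) else 0)" for i j
  have d_f: "d (Suc i) j + d i (Suc j) = d i j" for i j
  proof -
    consider "j < N" | "j = N" | "j > N" by linarith
    then show ?thesis
    proof cases
      case 1
      then obtain r where r: "N - j = Suc r" by (metis Suc_diff_Suc)
      then have j: "N - Suc j = r" "Suc j \<le> N" "j \<le> N" by auto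
      let ?c = "fact N / fact (Suc r) :: complex" and ?a = "m - of_nat i + 1"
      define x where "x = ?c * pochhammer ?a r"
      have d1: "d i (Suc j) = of_nat (Suc r) * x"
        using j by (simp add: d_def x_def field_simps del: of_nat_Suc)
      have d2: "d (Suc i) j = (?a - 1) * x"
        using r j by (simp add: d_def x_def pochhammer_rec)
      have d3: "d i j = (?a + of_nat r) * x"
        using r j by (simp add: d_def x_def pochhammer_Suc)
      show ?thesis unfolding d1 d2 d3 by (simp add: algebra_simps)
    qed (simp_all add: d_def)
  qed
  have d_e: "of_nat i * (m - of_nat i + 1) * d (i - 1) j + of_nat j * (n - of_nat j + 1) * d i (j - 1)
      = of_nat (i + j) * (m + n - of_nat (i + j) + 1) * d i j" for i j
  proof (cases "j \<le> N")
    case True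
    define r where "r = N - j"
    have n: "n = of_nat j + of_nat r" using True by (simp add: n_def r_def flip: of_nat_add)
    define c where "c = (fact N / fact r :: complex)"
    let ?a = "m - of_nat i + 1"
    have 0: "d i j = c * pochhammer ?a r" using True by (simp add: d_def r_def c_def)
    have 1: "of_nat i * ?a * d (i - 1) j = of_nat i * (c * pochhammer ?a (Suc r))"
    proof (cases i)
      case (Suc k)
      then show ?thesis using True by (simp add: d_def c_def pochhammer_rec flip: r_def)
    qed simp
    have 2: "of_nat j * (n - of_nat j + 1) * d i (j - 1) = of_nat j * (c * pochhammer ?a (Suc r))"
    proof (cases j)
      case (Suc k)
      have "N - k = Suc r" "k \<le> N" using Suc True by (auto simp: r_def)
      then have "d i k = fact N / fact (Suc r) * pochhammer ?a (Suc r)" by (simp add: d_def)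
      moreover have "n - of_nat j + 1 = of_nat (Suc r)" by (simp add: n)
      ultimately show ?thesis using Suc by (simp add: c_def field_simps del: of_nat_Suc)
    qed simp
    have "?a + of_nat r = m + n - of_nat (i + j) + 1" by (simp add: n)
    then have 3: "pochhammer ?a (Suc r) = pochhammer ?a r * (m + n - of_nat (i + j) + 1)"
      by (simp add: pochhammer_Suc del: of_nat_add)
    show ?thesis unfolding 1 2 3 unfolding 0 by (simp add: algebra_simps)
  next
    case False
    then have "n - of_nat j + 1 = 0 \<or> \<not> j - 1 \<le> N"
      by (cases "j = Suc N") (auto simp: n_def)
    then show ?thesis using False by (auto simp: d_def)
  qed
  have d0: "d 0 0 \<noteq> 0"
  proof -
    have "pochhammer (of_nat (Suc M)) N \<noteq> (0 :: complex)" 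
      using pochhammer_pos[of "Suc M" N] unfolding pochhammer_of_nat of_nat_eq_0_iff by simp
    then show ?thesis by (simp add: d_def m_def add.commute)
  qed
  define \<pi> where "\<pi> = linear_extension (\<lambda>(i, j). fscale (d i j / d 0 0) (gen (i + j)))"
  have lin: "flinear \<pi>" by (simp add: \<pi>_def flinear_linear_extension)
  have gen: "\<pi> (gen (i, j)) = fscale (d i j / d 0 0) (gen (i + j))" for i j by (simp add: \<pi>_def)
  note l = flinearD[OF lin]
  have "\<pi> \<in> lie_hom sl2 (tensor_model m n) (verma_model (m + n))"
    unfolding tensor_model_def verma_model_def
  proof (rule sl2_model_homI[OF _ _ lin])
    show "lie_module sl2 (sl2_model (tensor_h m n) (tensor_e m n) tensor_f)"
      "lie_module sl2 (sl2_model (verma_h (m + n)) (verma_e (m + n)) verma_f)"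
      using lie_module_tensor_model lie_module_verma_model by (simp_all flip: tensor_model_def verma_model_def)
    show "\<pi> (tensor_h m n p) = verma_h (m + n) (\<pi> p)" for p
      by (rule pair_flinear_eqI[of "\<lambda>p. \<pi> (tensor_h m n p)" "\<lambda>p. verma_h (m + n) (\<pi> p)"])
        (simp_all add: flinear_comp lin l gen mult.commute)
    show "\<pi> (tensor_f p) = verma_f (\<pi> p)" for p
    proof (rule pair_flinear_eqI[of "\<lambda>p. \<pi> (tensor_f p)" "\<lambda>p. verma_f (\<pi> p)"])
      fix i j
      have "\<pi> (tensor_f (gen (i, j))) = fscale ((d (Suc i) j + d i (Suc j)) / d 0 0) (gen (Suc (i + j)))"
        by (simp add: l gen fscale_distribs add_divide_distrib)
      then show "\<pi> (tensor_f (gen (i, j))) = verma_f (\<pi> (gen (i, j)))" by (simp add: d_f gen)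
    qed (simp_all add: flinear_comp lin)
    show "\<pi> (tensor_e m n p) = verma_e (m + n) (\<pi> p)" for p
    proof (rule pair_flinear_eqI[of "\<lambda>p. \<pi> (tensor_e m n p)" "\<lambda>p. verma_e (m + n) (\<pi> p)"])
      fix i j
      have "\<pi> (tensor_e m n (gen (i, j))) = fscale ((of_nat i * (m - of_nat i + 1) * d (i - 1) j
          + of_nat j * (n - of_nat j + 1) * d i (j - 1)) / d 0 0) (gen (i + j - 1))"
        by (cases i; cases j) (simp_all add: l gen fscale_distribs add_divide_distrib del: of_nat_Suc)
      then show "\<pi> (tensor_e m n (gen (i, j))) = verma_e (m + n) (\<pi> (gen (i, j)))"
        unfolding d_e by (simp add: gen mult.commute)
    qed (simp_all add: flinear_comp lin)
  qed
  moreover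
  have s: "singular_vector (tensor_model m n) (m + n) (gen (0, 0))" by (simp add: singular_vector_def)
  note \<iota> = highest_weight_hom[OF lie_module_tensor_model s]
  let ?\<iota> = "highest_weight_hom (tensor_model m n) (gen (0, 0))"
  have "\<pi> (?\<iota> p) = p" for p
  proof -
    have "(\<lambda>u\<in>carrier (verma_model (m + n)). \<pi> (?\<iota> u)) \<in> lie_hom sl2 (verma_model (m + n)) (verma_model (m + n))"
      by (rule lie_hom_compose[OF lie_module_verma_model \<iota>(1) calculation])
    then have h: "(\<lambda>u. \<pi> (?\<iota> u)) \<in> lie_hom sl2 (verma_model (m + n)) (verma_model (m + n))"
      by (simp add: restrict_def)
    have "vlinear (verma_model (m + n)) (\<lambda>u. \<pi> (?\<iota> u))" by (rule vlinear_hom_comp[OF calculation \<iota>(3)])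
    then show ?thesis
    proof (rule vlinear_eqI[of _ "\<lambda>u. \<pi> (?\<iota> u)" "\<lambda>u. u"])
      show "vlinear (verma_model (m + n)) (\<lambda>u. u)" by (simp add: vlinear_def)
      fix i
      have "?\<iota> (gen 0) = gen (0, 0)" using \<iota>(2)[of 0] by simp
      then have "\<pi> (?\<iota> (gen 0)) = gen 0" using gen[of 0 0] d0 by simp
      then show "\<pi> (?\<iota> (gen i)) = gen i"
        using verma_model_hom_f_pow[OF h, of i] by (simp add: verma_f_pow)
    qed
  qed
  ultimately show ?thesis
    unfolding has_direct_summand_iff[OF lie_module_tensor_model lie_module_verma_model]
    using \<iota>(1) by blast
qed

subsection \<open>Homomorphisms from simple modules\<close>

lemma lie_module_mono: "lie_module L V \<Longrightarrow> L' \<subseteq> L \<Longrightarrow> lie_module L' V"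
  unfolding lie_module_def by (meson subsetD)

lemma nilradical_subset_sl2: "nilradical \<subseteq> sl2"
  by (auto simp: nilradical_def)

lemma submodule_vlinear_image:
  assumes V: "vectorspace complex_ring V" and g: "vlinear V g" and K: "fsubspace K"
  shows "LinearCombinations.submodule complex_ring (g ` K) V"
proof -
  interpret V: vectorspace complex_ring V by fact
  note gD = g[unfolded vlinear_def]
  have "g 0 = \<zero>\<^bsub>V\<^esub>"
  proof -
    have "g (fscale 0 0) = 0 \<odot>\<^bsub>V\<^esub> g 0" using gD by metis
    then show ?thesis using V.smult_l_null[of "g 0"] gD by simp
  qed
  then have "\<zero>\<^bsub>V\<^esub> \<in> g ` K" using fsubspaceD(1)[OF K] by (metis image_eqI)
  moreover have "v \<oplus>\<^bsub>V\<^esub> w \<in> g ` K" if vw: "v \<in> g ` K" "w \<in> g ` K" for v w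
  proof -
    obtain p q where "p \<in> K" "q \<in> K" "v = g p" "w = g q" using vw by blast
    then show ?thesis using gD fsubspaceD(2)[OF K] by (intro image_eqI[of _ _ "p + q"]) auto
  qed
  moreover have "c \<odot>\<^bsub>V\<^esub> v \<in> g ` K" if v: "v \<in> g ` K" for c v
  proof -
    obtain p where "p \<in> K" "v = g p" using v by blast
    then show ?thesis using gD fsubspaceD(3)[OF K] by (intro image_eqI[of _ _ "fscale c p"]) auto
  qed
  ultimately show ?thesis
    using V.module_axioms gD by (auto simp: LinearCombinations.submodule_def)
qed

text \<open>
  Repeated application of \<open>e\<close> to a weight vector gives vectors \<open>w k\<close> of distinct weights, which are
  independent as long as none of them vanishes. They lie in a finite-dimensional space by local
  finiteness over the nilradical, so some \<open>w k\<close> vanishes, and the last nonzero one is singular.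
\<close>

lemma category_O_singular_vector:
  assumes O: "category_O V" and nz: "carrier V \<noteq> {\<zero>\<^bsub>V\<^esub>}"
  shows "\<exists>\<nu> v. singular_vector V \<nu> v \<and> v \<noteq> \<zero>\<^bsub>V\<^esub>"
proof -
  have V: "lie_module sl2 V" using O by (simp add: category_O_def)
  interpret V: vectorspace complex_ring V by (rule lie_moduleD(1)[OF V])
  note s = lie_module_space[OF V] and d = lie_moduleD[OF V]
  obtain \<nu> v where v: "v \<in> weight_space V \<nu>" "v \<noteq> \<zero>\<^bsub>V\<^esub>"
  proof (rule ccontr)
    assume "\<not> thesis"
    then have "(\<Union>\<nu>. weight_space V \<nu>) \<subseteq> {\<zero>\<^bsub>V\<^esub>}" using that by blast
    moreover have "LinearCombinations.submodule complex_ring {\<zero>\<^bsub>V\<^esub>} V"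
      using V.module_axioms s by (auto simp: LinearCombinations.submodule_def)
    ultimately have "V.span (\<Union>\<nu>. weight_space V \<nu>) \<subseteq> {\<zero>\<^bsub>V\<^esub>}" by (rule V.span_is_subset)
    then show False using O nz s(1) by (auto simp: category_O_def cartan_semisimple_def)
  qed
  have vc: "v \<in> carrier V" and hv: "act V mat_h v = \<nu> \<odot>\<^bsub>V\<^esub> v" using v by (simp_all add: weight_space_def)
  define w where "w k = (act V mat_e ^^ k) v" for k
  have wc: "w k \<in> carrier V" for k unfolding w_def by (rule funpow_act_closed[OF V mat_in_sl2(2) vc])
  have wS: "act V mat_e (w k) = w (Suc k)" for k by (simp add: w_def)
  have hw: "act V mat_h (w k) = (\<nu> + 2 * of_nat k) \<odot>\<^bsub>V\<^esub> w k" for k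
  proof (induction k)
    case 0 then show ?case using hv by (simp add: w_def)
  next
    case (Suc k)
    have "act V mat_h (w (Suc k)) = 2 \<odot>\<^bsub>V\<^esub> w (Suc k) \<oplus>\<^bsub>V\<^esub> (\<nu> + 2 * of_nat k) \<odot>\<^bsub>V\<^esub> w (Suc k)"
      using sl2_commute(1)[OF V wc[of k]] Suc by (simp add: d wc flip: wS)
    also have "\<dots> = (\<nu> + 2 * of_nat (Suc k)) \<odot>\<^bsub>V\<^esub> w (Suc k)"
      using wc by (simp flip: s(7) add: algebra_simps)
    finally show ?case .
  qed
  have "\<exists>k. w k = \<zero>\<^bsub>V\<^esub>"
  proof (rule ccontr)
    assume "\<not> (\<exists>k. w k = \<zero>\<^bsub>V\<^esub>)"
    then have wnz: "w k \<noteq> \<zero>\<^bsub>V\<^esub>" for k by blast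
    define \<eta> where "\<eta> = free_lift V w"
    have lin: "vlinear V \<eta>" and \<eta>gen: "\<And>k. \<eta> (gen k) = w k"
      unfolding \<eta>_def by (rule vlinear_free_lift[OF d(1) wc], rule free_lift_gen[OF d(1) wc])
    note \<eta>D = lin[unfolded vlinear_def]
    let ?D = "linear_extension (\<lambda>k. fscale (\<nu> + 2 * of_nat k) (gen k))"
    have h\<eta>: "act V mat_h (\<eta> p) = \<eta> (?D p)" for p
      by (rule vlinear_eqI[of V "\<lambda>p. act V mat_h (\<eta> p)" "\<lambda>p. \<eta> (?D p)"])
        (simp_all add: vlinear_act[OF V _ lin] vlinear_flinear[OF lin flinear_linear_extension] \<eta>gen hw \<eta>D)
    have e\<eta>: "act V mat_e (\<eta> p) = \<eta> (verma_f p)" for p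
      by (rule vlinear_eqI[of V "\<lambda>p. act V mat_e (\<eta> p)" "\<lambda>p. \<eta> (verma_f p)"])
        (simp_all add: vlinear_act[OF V _ lin] vlinear_flinear[OF lin] \<eta>gen wS)
    have inj: "p = 0" if "\<eta> p = \<zero>\<^bsub>V\<^esub>" for p
    proof (rule ccontr)
      assume "p \<noteq> 0"
      have "\<exists>k. gen k \<in> {p. \<eta> p = \<zero>\<^bsub>V\<^esub>}"
      proof (rule fsubspace_diagonal[OF _ _ _ _ \<open>p \<noteq> 0\<close>])
        show "inj (\<lambda>k. \<nu> + 2 * of_nat k)" by (auto simp: inj_def)
        have "\<eta> 0 = \<zero>\<^bsub>V\<^esub>"
        proof -
          have "\<eta> (fscale 0 0) = 0 \<odot>\<^bsub>V\<^esub> \<eta> 0" using \<eta>D by metis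
          then show ?thesis using s(4) \<eta>D by simp
        qed
        then show "fsubspace {p. \<eta> p = \<zero>\<^bsub>V\<^esub>}" using \<eta>D s by (simp add: fsubspace_def)
        show "?D p \<in> {p. \<eta> p = \<zero>\<^bsub>V\<^esub>}" if "p \<in> {p. \<eta> p = \<zero>\<^bsub>V\<^esub>}" for p
          using that lie_module_act_zero[OF V mat_in_sl2(1)] by (simp flip: h\<eta>)
      qed (use that in simp)
      then show False using \<eta>gen wnz by simp
    qed
    let ?G = "generated_submodule nilradical V {v}"
    have N: "lie_module nilradical V" by (rule lie_module_mono[OF V nilradical_subset_sl2])
    have G_sub: "lie_submodule nilradical ?G V"
    proof -
      have car: "lie_submodule nilradical (carrier V) V"
        using s lie_moduleD[OF N] by (simp add: lie_submodule_iff[OF N])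
      show ?thesis
        unfolding lie_submodule_iff[OF N]
      proof (intro conjI ballI allI)
        show "?G \<subseteq> carrier V" using car vc by (auto simp: generated_submodule_def)
      qed (auto simp: generated_submodule_def lie_submodule_iff[OF N])
    qed
    have wG: "w k \<in> ?G" for k
    proof (induction k)
      case 0 then show ?case by (auto simp: w_def generated_submodule_def)
    next
      case (Suc k)
      then show ?case using G_sub mat_in_subalgebras(2) by (auto simp: lie_submodule_def simp flip: wS)
    qed
    have "lie_submodule nilradical (range \<eta>) V"
      unfolding lie_submodule_def
    proof (intro conjI ballI)
      show "LinearCombinations.submodule complex_ring (range \<eta>) V"
        by (rule submodule_vlinear_image[OF d(1) lin]) (simp add: fsubspace_def)
      fix X x assume X: "X \<in> nilradical" and "x \<in> range \<eta>"
      then obtain p where p: "x = \<eta> p" by blast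
      have "X = mscale (X$1$2) mat_e" using X by (simp add: nilradical_iff)
      then have "act V X x = X$1$2 \<odot>\<^bsub>V\<^esub> act V mat_e x" using d(6)[OF mat_in_sl2(2), of x] p \<eta>D by metis
      then have "act V X x = \<eta> (fscale (X$1$2) (verma_f p))" using p e\<eta> \<eta>D by simp
      then show "act V X x \<in> range \<eta>" by blast
    qed
    moreover have "v \<in> range \<eta>" using \<eta>gen[of 0] by (auto simp: w_def)
    ultimately have G_range: "?G \<subseteq> range \<eta>" unfolding generated_submodule_def by blast
    have smG: "LinearCombinations.submodule complex_ring ?G V" using G_sub by (simp add: lie_submodule_def)
    interpret G: vectorspace complex_ring "V\<lparr>carrier := ?G\<rparr>"
      by (rule V.subspace_is_vs) (use smG V.vectorspace_axioms in \<open>simp add: subspace_def\<close>)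
    have "G.fin_dim" using O vc by (simp add: category_O_def)
    then obtain A where A: "finite A" "A \<subseteq> ?G" "G.span A = ?G" unfolding G.fin_dim_def by auto
    have spanA: "V.span A = ?G" using V.span_li_not_depend(1)[OF A(2) smG] A(3) by simp
    obtain B where B: "finite B" "A = \<eta> ` B"
      using A(1,2) G_range finite_subset_image[of A \<eta> UNIV] by blast
    obtain b where b: "(\<Union>p\<in>B. Poly_Mapping.keys p) \<subseteq> {..<b}"
      using finite_nat_set_iff_bounded[of "\<Union>p\<in>B. Poly_Mapping.keys p"] B(1) by auto
    have "?G \<subseteq> \<eta> ` {p. Poly_Mapping.keys p \<subseteq> {..<b}}"
      unfolding spanA[symmetric]
      by (rule V.span_is_subset[OF _ submodule_vlinear_image[OF d(1) lin fsubspace_keys]]) (use B b in auto)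
    then obtain p where p: "Poly_Mapping.keys p \<subseteq> {..<b}" "w b = \<eta> p" using wG[of b] by auto
    have "\<eta> (gen b + fscale (- 1) p) = w b \<oplus>\<^bsub>V\<^esub> (- 1) \<odot>\<^bsub>V\<^esub> w b" using \<eta>D \<eta>gen p by simp
    also have "\<dots> = \<zero>\<^bsub>V\<^esub>" using s(7)[of "w b" 1 "-1"] s(4,5) wc by simp
    finally have "Poly_Mapping.lookup (gen b + fscale (- 1) p) b = 0" using inj by (metis lookup_zero)
    moreover have "Poly_Mapping.lookup p b = 0" using p(1) by (auto simp: in_keys_iff subset_iff)
    ultimately show False by (simp add: lookup_add lookup_gen)
  qed
  then obtain k where k: "w k = \<zero>\<^bsub>V\<^esub>" "\<And>j. j < k \<Longrightarrow> w j \<noteq> \<zero>\<^bsub>V\<^esub>"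
    using exists_least_iff[of "\<lambda>k. w k = \<zero>\<^bsub>V\<^esub>"] by auto
  have "k \<noteq> 0" using k(1) v(2) by (cases k) (simp_all add: w_def)
  then obtain j where j: "k = Suc j" by (cases k) auto
  have "singular_vector V (\<nu> + 2 * of_nat j) (w j)" using wc hw wS[of j] k(1) j by (simp add: singular_vector_def)
  moreover have "w j \<noteq> \<zero>\<^bsub>V\<^esub>" using k(2) j by simp
  ultimately show ?thesis by blast
qed

text \<open>
  A homomorphism from a simple module that kills a nonzero singular vector is zero. So homomorphisms
  are determined by their values at this vector, which are singular vectors of a fixed weight.
\<close>

lemma dim_hom_simple:
  assumes W: "lie_module sl2 W" and verma: "\<And>\<nu>. dim_hom_le_1 sl2 (verma_model \<nu>) W"
    and N: "category_O N" "simple_module sl2 N"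
  shows "dim_hom_le_1 sl2 N W"
proof -
  have NL: "lie_module sl2 N" using N by (simp add: category_O_def)
  obtain \<nu> v where v: "singular_vector N \<nu> v" "v \<noteq> \<zero>\<^bsub>N\<^esub>"
    using category_O_singular_vector[OF N(1)] N(2) by (auto simp: simple_module_def)
  have vc: "v \<in> carrier N" using v by (simp add: singular_vector_def)
  interpret W: vectorspace complex_ring W by (rule lie_moduleD(1)[OF W])
  note s = lie_module_space[OF W]
  have sing: "singular_vector W \<nu> (f v)" if f: "f \<in> lie_hom sl2 N W" for f
    using v(1) lie_homD[OF f] lie_homD(4)[OF f, of mat_e v, symmetric] lie_homD(4)[OF f, of mat_h v, symmetric]
      lie_hom_zero[OF NL W f] by (simp add: singular_vector_def)
  show ?thesis
    unfolding dim_hom_le_1_iff[OF NL W]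
  proof (intro ballI)
    fix f g assume f: "f \<in> lie_hom sl2 N W" and g: "g \<in> lie_hom sl2 N W"
    obtain a b where ab: "a \<noteq> 0 \<or> b \<noteq> 0" "a \<odot>\<^bsub>W\<^esub> f v \<oplus>\<^bsub>W\<^esub> b \<odot>\<^bsub>W\<^esub> g v = \<zero>\<^bsub>W\<^esub>"
      using verma[of \<nu>] sing[OF f] sing[OF g] unfolding dim_hom_verma_model[OF W] by meson
    define h where "h = (\<lambda>x\<in>carrier N. a \<odot>\<^bsub>W\<^esub> f x \<oplus>\<^bsub>W\<^esub> b \<odot>\<^bsub>W\<^esub> g x)"
    have h: "h \<in> lie_hom sl2 N W"
      unfolding h_def
      by (rule lie_hom_restrictI[OF NL])
        (simp_all add: lie_homD[OF f] lie_homD[OF g] s lie_moduleD[OF W] W.M.a_ac mult.commute)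
    let ?K = "{x \<in> carrier N. h x = \<zero>\<^bsub>W\<^esub>}"
    have "lie_submodule sl2 ?K N" by (rule lie_submodule_kernel[OF NL W h])
    moreover have "v \<in> ?K" using vc ab(2) by (simp add: h_def)
    ultimately have K: "?K = carrier N" using N(2) v(2) by (auto simp: simple_module_def)
    have "a \<odot>\<^bsub>W\<^esub> f x \<oplus>\<^bsub>W\<^esub> b \<odot>\<^bsub>W\<^esub> g x = \<zero>\<^bsub>W\<^esub>" if x: "x \<in> carrier N" for x
    proof -
      have "h x = \<zero>\<^bsub>W\<^esub>" using K x by blast
      then show ?thesis using x by (simp add: h_def)
    qed
    then show "\<exists>a b. (a \<noteq> 0 \<or> b \<noteq> 0) \<and> (\<forall>x\<in>carrier N. a \<odot>\<^bsub>W\<^esub> f x \<oplus>\<^bsub>W\<^esub> b \<odot>\<^bsub>W\<^esub> g x = \<zero>\<^bsub>W\<^esub>)"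
      using ab(1) by blast
  qed
qed

definition transport_module :: "('v \<Rightarrow> 'w) \<Rightarrow> 'v lmodule \<Rightarrow> 'w lmodule" where
  "transport_module emb V = (let g = inv_into UNIV emb in
     \<lparr>carrier = emb ` carrier V, mult = (\<lambda>x y. emb \<zero>\<^bsub>V\<^esub>), one = emb \<zero>\<^bsub>V\<^esub>, zero = emb \<zero>\<^bsub>V\<^esub>,
      add = (\<lambda>x y. emb (g x \<oplus>\<^bsub>V\<^esub> g y)), smult = (\<lambda>c x. emb (c \<odot>\<^bsub>V\<^esub> g x)),
      act = (\<lambda>X x. emb (act V X (g x)))\<rparr>)"

lemma transport_module_simps:
  assumes "inj emb"
  shows "carrier (transport_module emb V) = emb ` carrier V" "zero (transport_module emb V) = emb \<zero>\<^bsub>V\<^esub>"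
    "add (transport_module emb V) (emb x) (emb y) = emb (x \<oplus>\<^bsub>V\<^esub> y)"
    "smult (transport_module emb V) c (emb x) = emb (c \<odot>\<^bsub>V\<^esub> x)"
    "act (transport_module emb V) X (emb x) = emb (act V X x)"
  using assms by (simp_all add: transport_module_def Let_def)

text \<open>
  The Verma module is simple, and its model has the type on which \<open>emb\<close> is defined.
\<close>

lemma simple_verma_copy:
  fixes emb :: "(nat \<Rightarrow>\<^sub>0 complex) \<Rightarrow> 'n"
  assumes emb: "inj emb" and \<nu>: "\<nu> \<notin> \<nat>"
  obtains N :: "'n lmodule" where "category_O N" "simple_module sl2 N" "lie_module sl2 N"
    "lie_isomorphic sl2 (verma_model \<nu>) N"
proof -
  let ?N = "transport_module emb (verma_model \<nu>)"
  note simps = transport_module_simps[OF emb, of "verma_model \<nu>"]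
  have N: "lie_module sl2 ?N"
    by (rule sl2_module_image[OF lie_module_verma_model[of \<nu>], where q = emb]) (simp_all only: simps)
  have hom: "emb \<in> lie_hom sl2 (verma_model \<nu>) ?N"
    using lie_hom_restrictI[OF lie_module_verma_model[of \<nu>], of emb ?N] by (simp add: simps restrict_def)
  have iso: "lie_isomorphic sl2 (verma_model \<nu>) ?N"
    unfolding lie_isomorphic_def using hom emb by (intro bexI[of _ emb]) (auto simp: simps bij_betw_def)
  have v: "singular_vector ?N \<nu> (emb (gen 0))" by (rule verma_model_hom_singular[OF N hom])
  have "category_O ?N"
  proof (rule category_O_highest_weight[OF N v])
    have eq: "emb p = highest_weight_hom ?N (emb (gen 0)) p" for p
    proof (rule vlinear_eqI[of ?N])
      show "vlinear ?N emb" using hom vlinear_hom unfolding verma_model_def by blast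
      show "vlinear ?N (highest_weight_hom ?N (emb (gen 0)))" by (rule highest_weight_hom(3)[OF N v])
      show "emb (gen i) = highest_weight_hom ?N (emb (gen 0)) (gen i)" for i
        by (rule trans[OF verma_model_hom_f_pow[OF hom] highest_weight_hom(2)[OF N v, symmetric]])
    qed
    show "carrier ?N \<subseteq> range (highest_weight_hom ?N (emb (gen 0)))"
      unfolding simps(1) by (intro image_subsetI range_eqI) (rule eq)
  qed
  moreover have "simple_module sl2 ?N"
    unfolding simple_module_iff
  proof (intro conjI N notI)
    assume "carrier ?N = {\<zero>\<^bsub>?N\<^esub>}"
    then have "emb (gen 0) = emb 0" by (auto simp: simps)
    then have "gen 0 = (0 :: nat \<Rightarrow>\<^sub>0 complex)" using emb by (simp add: inj_eq)
    then have "Poly_Mapping.lookup (gen (0 :: nat)) 0 = (0 :: complex)" by (metis lookup_zero)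
    then show False by (simp add: lookup_gen)
  next
    assume "reducible_module sl2 ?N"
    then have "reducible_module sl2 (verma_model \<nu>)"
      by (rule reducible_module_iso[OF N lie_module_verma_model lie_isomorphic_sym[OF lie_module_verma_model iso]])
    then show False using irreducible_verma_model[OF \<nu>] by blast
  qed
  ultimately show thesis using that N iso by blast
qed

section \<open>The enveloping algebra\<close>

subsection \<open>The free algebra\<close>

definition word_mult :: "('x list \<Rightarrow>\<^sub>0 complex) \<Rightarrow> ('x list \<Rightarrow>\<^sub>0 complex) \<Rightarrow> ('x list \<Rightarrow>\<^sub>0 complex)" where
  "word_mult = bilinear_extension (\<lambda>u v. gen (u @ v))"

lemma flinear_word_mult: "flinear (\<lambda>p. word_mult p q)" "flinear (word_mult p)"
  unfolding word_mult_def by (rule flinear_bilinear_extension)+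

lemmas word_mult_linear = flinearD[OF flinear_word_mult(1)] flinearD[OF flinear_word_mult(2)]

lemma word_mult_gen [simp]: "word_mult (gen u) (gen v) = gen (u @ v)"
  by (simp add: word_mult_def bilinear_extension_def)

lemma word_mult_assoc: "word_mult (word_mult p q) r = word_mult p (word_mult q r)"
proof -
  have g1: "word_mult (word_mult (gen u) (gen v)) r = word_mult (gen u) (word_mult (gen v) r)" for u v
    by (rule flinear_eqI[of "word_mult (word_mult (gen u) (gen v))" "\<lambda>r. word_mult (gen u) (word_mult (gen v) r)"])
      (simp_all add: flinear_word_mult flinear_comp)
  have g2: "word_mult (word_mult (gen u) q) r = word_mult (gen u) (word_mult q r)" for u
    by (rule flinear_eqI[of "\<lambda>q. word_mult (word_mult (gen u) q) r" "\<lambda>q. word_mult (gen u) (word_mult q r)"])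
      (simp_all only: g1 flinear_word_mult flinear_comp[OF flinear_word_mult(1) flinear_word_mult(2)]
        flinear_comp[OF flinear_word_mult(2) flinear_word_mult(1)])
  show ?thesis
    by (rule flinear_eqI[of "\<lambda>p. word_mult (word_mult p q) r" "\<lambda>p. word_mult p (word_mult q r)"])
      (simp_all only: g2 flinear_word_mult flinear_comp[OF flinear_word_mult(1) flinear_word_mult(1)])
qed

lemma word_mult_one [simp]: "word_mult (gen []) p = p" "word_mult p (gen []) = p"
proof -
  show "word_mult (gen []) p = p"
    by (rule flinear_eqI[OF flinear_word_mult(2) flinear_ops(1)]) simp
  show "word_mult p (gen []) = p"
    by (rule flinear_eqI[OF flinear_word_mult(1) flinear_ops(1)]) simp
qed

lemma fscale_single: "fscale c (Poly_Mapping.single x d) = Poly_Mapping.single x (c * d)"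
  by (rule poly_mapping_eqI) (simp add: lookup_single when_def)

lemma free_algebra_simps [simp]:
  "carrier (free_algebra L) = {p. Poly_Mapping.keys p \<subseteq> lists L}"
  "add (free_algebra L) = (+)" "zero (free_algebra L) = 0" "smult (free_algebra L) = fscale"
  "one (free_algebra L) = gen []" "mult (free_algebra L) = word_mult"
proof -
  show "mult (free_algebra L) = word_mult"
    by (intro ext)
      (simp add: free_algebra_def word_mult_def bilinear_extension_def linear_extension_def fscale_sum fscale_single)
qed (simp_all add: free_algebra_def free_space_def)

lemma word_mult_closed:
  assumes "Poly_Mapping.keys p \<subseteq> lists L" "Poly_Mapping.keys q \<subseteq> lists L"
  shows "Poly_Mapping.keys (word_mult p q) \<subseteq> lists L"
  unfolding word_mult_def bilinear_extension_def
proof (intro keys_linear_extension)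
  fix u v assume "u \<in> Poly_Mapping.keys p" "v \<in> Poly_Mapping.keys q"
  then show "Poly_Mapping.keys (gen (u @ v)) \<subseteq> lists L" using assms by auto
qed

lemma ring_free_algebra: "ring (free_algebra L)"
proof -
  interpret vectorspace complex_ring "free_algebra L"
    by (rule vectorspace_fscale[of _ "lists L"]) simp_all
  show ?thesis
  proof (rule ringI)
    show "abelian_group (free_algebra L)" by (rule M.abelian_group_axioms)
    show "Group.monoid (free_algebra L)"
      by (rule monoidI) (simp_all add: word_mult_closed word_mult_assoc)
  qed (simp_all add: word_mult_linear)
qed

lemma ideal_free_algebra_iff:
  "ideal J (free_algebra L) \<longleftrightarrow> fsubspace J \<and> J \<subseteq> {p. Poly_Mapping.keys p \<subseteq> lists L} \<and>
    (\<forall>p\<in>J. \<forall>q. Poly_Mapping.keys q \<subseteq> lists L \<longrightarrow> word_mult p q \<in> J \<and> word_mult q p \<in> J)"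
proof
  interpret R: ring "free_algebra L" by (rule ring_free_algebra)
  assume "ideal J (free_algebra L)"
  then interpret J: ideal J "free_algebra L" .
  have sub: "J \<subseteq> {p. Poly_Mapping.keys p \<subseteq> lists L}" using J.a_subset by simp
  have mult: "word_mult p q \<in> J" "word_mult q p \<in> J" if "p \<in> J" "Poly_Mapping.keys q \<subseteq> lists L" for p q
    using J.I_r_closed[of p q] J.I_l_closed[of p q] that by simp_all
  have "fscale c p \<in> J" if "p \<in> J" for c p
  proof -
    have "Poly_Mapping.keys (fscale c (gen [])) \<subseteq> lists L" by (auto dest!: subsetD[OF keys_fscale_subset])
    from mult(2)[OF that this] show ?thesis by (simp add: word_mult_linear)
  qed
  moreover have "0 \<in> J" using J.zero_closed by simp
  moreover have "p + q \<in> J" if "p \<in> J" "q \<in> J" for p q using J.a_closed[OF that] by simp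
  ultimately show "fsubspace J \<and> J \<subseteq> {p. Poly_Mapping.keys p \<subseteq> lists L} \<and>
    (\<forall>p\<in>J. \<forall>q. Poly_Mapping.keys q \<subseteq> lists L \<longrightarrow> word_mult p q \<in> J \<and> word_mult q p \<in> J)"
    using sub mult by (simp add: fsubspace_def)
next
  interpret R: ring "free_algebra L" by (rule ring_free_algebra)
  assume J: "fsubspace J \<and> J \<subseteq> {p. Poly_Mapping.keys p \<subseteq> lists L} \<and>
    (\<forall>p\<in>J. \<forall>q. Poly_Mapping.keys q \<subseteq> lists L \<longrightarrow> word_mult p q \<in> J \<and> word_mult q p \<in> J)"
  have minus: "\<ominus>\<^bsub>free_algebra L\<^esub> p = - p" if "Poly_Mapping.keys p \<subseteq> lists L" for p
    by (rule R.minus_equality) (use that in simp_all)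
  show "ideal J (free_algebra L)"
  proof (rule idealI[OF ring_free_algebra])
    show "subgroup J (add_monoid (free_algebra L))"
    proof (rule R.add.subgroupI)
      show "J \<subseteq> carrier (free_algebra L)" using J by simp
      show "J \<noteq> {}" using J fsubspaceD(1) by blast
      show "\<ominus>\<^bsub>free_algebra L\<^esub> p \<in> J" if "p \<in> J" for p
      proof -
        have "Poly_Mapping.keys p \<subseteq> lists L" using J that by blast
        then show ?thesis using J that by (simp add: minus fsubspaceD(4))
      qed
      show "p \<oplus>\<^bsub>free_algebra L\<^esub> q \<in> J" if "p \<in> J" "q \<in> J" for p q
        using that J fsubspaceD(2) by auto
    qed
  qed (use J in auto)
qed

definition closed_under_bracket :: "(complex^2^2) set \<Rightarrow> bool" where
  "closed_under_bracket L \<longleftrightarrow> (\<forall>X\<in>L. \<forall>Y\<in>L. X + Y \<in> L \<and> commutator X Y \<in> L) \<and> (\<forall>c. \<forall>X\<in>L. mscale c X \<in> L)"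

lemma closed_under_bracket_sl2: "closed_under_bracket sl2"
  by (simp add: closed_under_bracket_def sl2_closed)

lemma closed_under_bracket_borel: "closed_under_bracket borel_subalgebra"
  by (simp add: closed_under_bracket_def borel_iff)

definition enveloping_relations :: "(complex^2^2) set \<Rightarrow> ((complex^2^2) list \<Rightarrow>\<^sub>0 complex) set" where
  "enveloping_relations L =
     {gen [X + Y] - gen [X] - gen [Y] | X Y. X \<in> L \<and> Y \<in> L} \<union>
     {gen [mscale c X] - fscale c (gen [X]) | c X. X \<in> L} \<union>
     {gen [X, Y] - gen [Y, X] - gen [commutator X Y] | X Y. X \<in> L \<and> Y \<in> L}"

lemma enveloping_ideal_alt: "enveloping_ideal L = genideal (free_algebra L) (enveloping_relations L)"
  by (simp add: enveloping_ideal_def enveloping_relations_def)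

lemma enveloping_relations_subset:
  assumes "closed_under_bracket L"
  shows "enveloping_relations L \<subseteq> {p. Poly_Mapping.keys p \<subseteq> lists L}"
proof -
  define S where "S = {p :: (complex^2^2) list \<Rightarrow>\<^sub>0 complex. Poly_Mapping.keys p \<subseteq> lists L}"
  have "fsubspace S" unfolding S_def by (rule fsubspace_keys)
  note s = fsubspaceD(3,5)[OF this]
  have g: "gen w \<in> S" if "w \<in> lists L" for w
    using that by (simp add: S_def)
  have "enveloping_relations L \<subseteq> S"
    unfolding enveloping_relations_def
    using assms by (auto simp: closed_under_bracket_def intro!: s g)
  then show ?thesis by (simp add: S_def)
qed

lemma enveloping_ideal_facts:
  assumes L: "closed_under_bracket L"
  shows "ideal (enveloping_ideal L) (free_algebra L)" "enveloping_relations L \<subseteq> enveloping_ideal L"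
    "ideal J (free_algebra L) \<Longrightarrow> enveloping_relations L \<subseteq> J \<Longrightarrow> enveloping_ideal L \<subseteq> J"
proof -
  interpret R: ring "free_algebra L" by (rule ring_free_algebra)
  have sub: "enveloping_relations L \<subseteq> carrier (free_algebra L)" using enveloping_relations_subset[OF L] by simp
  show "ideal (enveloping_ideal L) (free_algebra L)"
    unfolding enveloping_ideal_alt by (rule R.genideal_ideal[OF sub])
  show "enveloping_relations L \<subseteq> enveloping_ideal L"
    unfolding enveloping_ideal_alt by (rule R.genideal_self[OF sub])
  show "ideal J (free_algebra L) \<Longrightarrow> enveloping_relations L \<subseteq> J \<Longrightarrow> enveloping_ideal L \<subseteq> J"
    unfolding enveloping_ideal_alt by (rule R.genideal_minimal)
qed

text \<open>
  Elements of the larger ideal that only involve words over \<open>L'\<close> form an ideal in the smaller free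
  algebra. This makes the inclusion of enveloping algebras well defined.
\<close>

lemma enveloping_ideal_mono:
  assumes L: "closed_under_bracket L" and L': "closed_under_bracket L'" and sub: "L' \<subseteq> L"
  shows "enveloping_ideal L' \<subseteq> enveloping_ideal L"
proof -
  let ?J = "enveloping_ideal L \<inter> {p. Poly_Mapping.keys p \<subseteq> lists L'}"
  have lists: "lists L' \<subseteq> lists L" by (rule lists_mono[OF sub])
  note I = enveloping_ideal_facts(1)[OF L, unfolded ideal_free_algebra_iff]
  have "ideal ?J (free_algebra L')"
    unfolding ideal_free_algebra_iff
  proof (intro conjI ballI allI impI)
    show "fsubspace ?J" using I fsubspace_keys[of "lists L'"] by (auto simp: fsubspace_def)
    show "word_mult p q \<in> ?J" "word_mult q p \<in> ?J" if "p \<in> ?J" "Poly_Mapping.keys q \<subseteq> lists L'" for p q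
      using that I lists word_mult_closed[of p L' q] word_mult_closed[of q L' p] by (auto dest!: order_trans[OF _ lists])
  qed auto
  moreover have "enveloping_relations L' \<subseteq> enveloping_relations L"
    unfolding enveloping_relations_def using sub by blast
  then have "enveloping_relations L' \<subseteq> ?J"
    using enveloping_ideal_facts(2)[OF L] enveloping_relations_subset[OF L'] by auto
  ultimately show ?thesis using enveloping_ideal_facts(3)[OF L'] by blast
qed

subsection \<open>Classes\<close>

definition uclass :: "(complex^2^2) set \<Rightarrow> ((complex^2^2) list \<Rightarrow>\<^sub>0 complex) \<Rightarrow> ((complex^2^2) list \<Rightarrow>\<^sub>0 complex) set" where
  "uclass L p = fcoset (enveloping_ideal L) p"

lemma fsubspace_enveloping_ideal: "closed_under_bracket L \<Longrightarrow> fsubspace (enveloping_ideal L)"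
  using enveloping_ideal_facts(1) ideal_free_algebra_iff by blast

lemma uclass_eqI: "closed_under_bracket L \<Longrightarrow> p - q \<in> enveloping_ideal L \<Longrightarrow> uclass L p = uclass L q"
  unfolding uclass_def by (simp add: fcoset_eq_iff fsubspace_enveloping_ideal)

lemma enveloping_algebra_facts:
  assumes L: "closed_under_bracket L"
  shows "carrier (enveloping_algebra L) = uclass L ` {p. Poly_Mapping.keys p \<subseteq> lists L}"
    "add (enveloping_algebra L) (uclass L p) (uclass L q) = uclass L (p + q)"
    "smult (enveloping_algebra L) c (uclass L p) = uclass L (fscale c p)"
    "Poly_Mapping.keys p \<subseteq> lists L \<Longrightarrow> Poly_Mapping.keys q \<subseteq> lists L \<Longrightarrow>
      mult (enveloping_algebra L) (uclass L p) (uclass L q) = uclass L (word_mult p q)"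
    "enveloping_gen L X = uclass L (gen [X])"
proof -
  note qf = quotient_space_facts[OF fsubspace_enveloping_ideal[OF L], of "free_algebra L"]
  show "carrier (enveloping_algebra L) = uclass L ` {p. Poly_Mapping.keys p \<subseteq> lists L}"
    "add (enveloping_algebra L) (uclass L p) (uclass L q) = uclass L (p + q)"
    "smult (enveloping_algebra L) c (uclass L p) = uclass L (fscale c p)"
    using qf(1,3,4) by (simp_all add: enveloping_algebra_def uclass_def[abs_def])
  interpret I: ideal "enveloping_ideal L" "free_algebra L" by (rule enveloping_ideal_facts(1)[OF L])
  show "mult (enveloping_algebra L) (uclass L p) (uclass L q) = uclass L (word_mult p q)"
    if "Poly_Mapping.keys p \<subseteq> lists L" "Poly_Mapping.keys q \<subseteq> lists L"
    using I.rcoset_mult_add[of p q] that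
    by (simp add: enveloping_algebra_def quotient_space_def uclass_def a_r_coset_fcoset)
  show "enveloping_gen L X = uclass L (gen [X])"
    by (simp add: enveloping_gen_def uclass_def a_r_coset_fcoset)
qed

lemma enveloping_incl_uclass:
  assumes L: "closed_under_bracket L" and L': "closed_under_bracket L'" and sub: "L' \<subseteq> L"
  shows "enveloping_incl L (uclass L' p) = uclass L p"
  unfolding enveloping_incl_def uclass_def a_r_coset_fcoset[OF free_algebra_simps(2)]
  by (rule fcoset_map) (use fsubspace_enveloping_ideal L L' enveloping_ideal_mono[OF L L' sub] in auto)

subsection \<open>The action on a module\<close>

definition word_action :: "'v lmodule \<Rightarrow> ((complex^2^2) list \<Rightarrow>\<^sub>0 complex) \<Rightarrow> 'v \<Rightarrow> 'v" where
  "word_action V p v = free_lift V (\<lambda>w. foldr (act V) w v) p"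

lemma foldr_act:
  assumes V: "lie_module L V" and w: "w \<in> lists L"
  shows "v \<in> carrier V \<Longrightarrow> foldr (act V) w v \<in> carrier V"
    and "v \<in> carrier V \<Longrightarrow> v' \<in> carrier V \<Longrightarrow>
      foldr (act V) w (v \<oplus>\<^bsub>V\<^esub> v') = foldr (act V) w v \<oplus>\<^bsub>V\<^esub> foldr (act V) w v'"
    and "v \<in> carrier V \<Longrightarrow> foldr (act V) w (c \<odot>\<^bsub>V\<^esub> v) = c \<odot>\<^bsub>V\<^esub> foldr (act V) w v"
proof -
  show cl: "foldr (act V) w v \<in> carrier V" if "v \<in> carrier V" for v
    using w by induction (simp_all add: that lie_moduleD(2)[OF V])
  show "foldr (act V) w (v \<oplus>\<^bsub>V\<^esub> v') = foldr (act V) w v \<oplus>\<^bsub>V\<^esub> foldr (act V) w v'"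
    if "v \<in> carrier V" "v' \<in> carrier V"
    using w
  proof induction
    case (Cons X w)
    have "foldr (act V) w u \<in> carrier V" if "u \<in> carrier V" for u
      using Cons.hyps(2) by induction (simp_all add: that lie_moduleD(2)[OF V])
    then show ?case using Cons that by (simp add: lie_moduleD(3)[OF V])
  qed simp
  show "foldr (act V) w (c \<odot>\<^bsub>V\<^esub> v) = c \<odot>\<^bsub>V\<^esub> foldr (act V) w v" if "v \<in> carrier V"
    using w
  proof induction
    case (Cons X w)
    have "foldr (act V) w v \<in> carrier V"
      using Cons.hyps(2) by induction (simp_all add: that lie_moduleD(2)[OF V])
    then show ?case using Cons by (simp add: lie_moduleD(4)[OF V])
  qed simp
qed

lemma word_action_facts:
  assumes V: "lie_module L V" and p: "Poly_Mapping.keys p \<subseteq> lists L" and v: "v \<in> carrier V"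
  shows "word_action V p v \<in> carrier V"
    and "Poly_Mapping.keys q \<subseteq> lists L \<Longrightarrow> word_action V (p + q) v = word_action V p v \<oplus>\<^bsub>V\<^esub> word_action V q v"
    and "word_action V (fscale c p) v = c \<odot>\<^bsub>V\<^esub> word_action V p v"
    and "word_action V 0 v = \<zero>\<^bsub>V\<^esub>"
  unfolding word_action_def
  using free_lift_facts(1,2,3,5)[where A = "lists L" and g = "\<lambda>w. foldr (act V) w v",
      OF lie_moduleD(1)[OF V] foldr_act(1)[OF V _ v]] p
  by simp_all

lemma word_action_gen:
  assumes V: "lie_module L V" and "w \<in> lists L" and v: "v \<in> carrier V"
  shows "word_action V (gen w) v = foldr (act V) w v"
  unfolding word_action_def
  using free_lift_facts(4)[where A = "lists L" and g = "\<lambda>w. foldr (act V) w v" and p = 0,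
      OF lie_moduleD(1)[OF V] foldr_act(1)[OF V _ v]] assms(2) by simp

lemma word_action_linear:
  assumes V: "lie_module L V" and p: "Poly_Mapping.keys p \<subseteq> lists L" and v: "v \<in> carrier V"
  shows "v' \<in> carrier V \<Longrightarrow> word_action V p (v \<oplus>\<^bsub>V\<^esub> v') = word_action V p v \<oplus>\<^bsub>V\<^esub> word_action V p v'"
    and "word_action V p (c \<odot>\<^bsub>V\<^esub> v) = c \<odot>\<^bsub>V\<^esub> word_action V p v"
proof -
  interpret V: vectorspace complex_ring V by (rule lie_moduleD(1)[OF V])
  note s = lie_module_space[OF V] and wa = word_action_facts[OF V]
  show "word_action V p (v \<oplus>\<^bsub>V\<^esub> v') = word_action V p v \<oplus>\<^bsub>V\<^esub> word_action V p v'" if v': "v' \<in> carrier V"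
    using p
  proof (induction p rule: free_induct)
    case zero
    then show ?case using wa(4)[of 0] v v' s by simp
  next
    case (add p q)
    then show ?case using wa(1,2) v v' s(2) by (simp add: V.M.a_ac)
  next
    case (scale c p)
    then show ?case using wa(1,3) v v' s(2,8) by simp
  next
    case (gen w)
    then show ?case using word_action_gen[OF V gen] foldr_act(2)[OF V gen] v v' s(2) by simp
  qed
  show "word_action V p (c \<odot>\<^bsub>V\<^esub> v) = c \<odot>\<^bsub>V\<^esub> word_action V p v"
    using p
  proof (induction p rule: free_induct)
    case zero
    then show ?case using wa(4)[of 0] v s by simp
  next
    case (add p q)
    then show ?case using wa(1,2) v s(3,8) by simp
  next
    case (scale d p)
    then show ?case using wa(1,3) v s(3,9) by (simp add: mult.commute)
  next
    case (gen w)
    then show ?case using word_action_gen[OF V gen] foldr_act(3)[OF V gen] v s(3) by simp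
  qed
qed

lemma word_action_mult:
  assumes V: "lie_module L V" and p: "Poly_Mapping.keys p \<subseteq> lists L" and q: "Poly_Mapping.keys q \<subseteq> lists L"
    and v: "v \<in> carrier V"
  shows "word_action V (word_mult p q) v = word_action V p (word_action V q v)"
proof -
  note wa = word_action_facts[OF V] and wl = word_action_linear[OF V]
  have wa0: "word_action V 0 x = \<zero>\<^bsub>V\<^esub>" if "x \<in> carrier V" for x using wa(4)[of 0] that by simp
  have gg: "word_action V (word_mult (gen u) q) v = word_action V (gen u) (word_action V q v)" if u: "u \<in> lists L" for u
    using q
  proof (induction q rule: free_induct)
    case zero
    have "word_action V (gen u) (0 \<odot>\<^bsub>V\<^esub> v) = 0 \<odot>\<^bsub>V\<^esub> word_action V (gen u) v" using wl(2) u v by simp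
    then show ?case using wa(1)[of "gen u" v] wa0 v u lie_module_space(4)[OF V] by (simp add: word_mult_linear)
  next
    case (add q r)
    then show ?case using wa(1,2) wl(1) v u word_mult_closed[of "gen u" L] by (simp add: word_mult_linear)
  next
    case (scale c q)
    then show ?case using wa(1,3) wl(2) v u word_mult_closed[of "gen u" L] by (simp add: word_mult_linear)
  next
    case (gen w)
    then show ?case using u v word_action_gen[OF V] foldr_act(1)[OF V] by simp
  qed
  show ?thesis
    using p
  proof (induction p rule: free_induct)
    case zero
    then show ?case using wa(1) wa0 v q by (simp add: word_mult_linear)
  next
    case (add p r)
    then show ?case using wa v q word_mult_closed[of _ L q] by (simp add: word_mult_linear)
  next
    case (scale c p)
    then show ?case using wa v q word_mult_closed[of _ L q] by (simp add: word_mult_linear)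
  qed (rule gg)
qed

text \<open>
  The elements that annihilate a module form an ideal, and it contains the defining relations.
\<close>

lemma word_action_ideal:
  assumes L: "closed_under_bracket L" and V: "lie_module L V" and k: "k \<in> enveloping_ideal L" and v: "v \<in> carrier V"
  shows "word_action V k v = \<zero>\<^bsub>V\<^esub>"
proof -
  interpret V: vectorspace complex_ring V by (rule lie_moduleD(1)[OF V])
  note wa = word_action_facts[OF V] and s = lie_module_space[OF V]
  let ?J = "{p. Poly_Mapping.keys p \<subseteq> lists L \<and> (\<forall>v\<in>carrier V. word_action V p v = \<zero>\<^bsub>V\<^esub>)}"
  have zero: "word_action V p \<zero>\<^bsub>V\<^esub> = \<zero>\<^bsub>V\<^esub>" if "Poly_Mapping.keys p \<subseteq> lists L" for p
    using word_action_linear(2)[OF V that, of "\<zero>\<^bsub>V\<^esub>" 0] wa(1)[OF that] s by simp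
  have diff: "word_action V (p - q) v = word_action V p v \<ominus>\<^bsub>V\<^esub> word_action V q v"
    if "Poly_Mapping.keys p \<subseteq> lists L" "Poly_Mapping.keys q \<subseteq> lists L" "v \<in> carrier V" for p q v
  proof -
    have "Poly_Mapping.keys (fscale (- 1) q) \<subseteq> lists L" by (rule order_trans[OF keys_fscale_subset that(2)])
    then have "word_action V (p + fscale (- 1) q) v = word_action V p v \<ominus>\<^bsub>V\<^esub> word_action V q v"
      using that by (simp add: wa(1,2,3) s(10))
    then show ?thesis by (simp add: fscale_minus_one)
  qed
  have sub: "fsubspace ?J"
    using fsubspace_keys[of "lists L"] wa(2,3) wa(4)[of 0] s(1,6,11) by (auto simp: fsubspace_def)
  have "ideal ?J (free_algebra L)"
    unfolding ideal_free_algebra_iff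
    using sub word_mult_closed[of _ L] word_action_mult[OF V] zero wa(1) by auto
  moreover have "enveloping_relations L \<subseteq> ?J"
  proof
    fix r assume r: "r \<in> enveloping_relations L"
    have keys: "Poly_Mapping.keys r \<subseteq> lists L" using enveloping_relations_subset[OF L] r by blast
    have "word_action V r v = \<zero>\<^bsub>V\<^esub>" if v: "v \<in> carrier V" for v
    proof -
      note g = word_action_gen[OF V _ v]
      have kd: "Poly_Mapping.keys (gen a - gen b) \<subseteq> lists L" if "a \<in> lists L" "b \<in> lists L" for a b :: "(complex^2^2) list"
        using fsubspaceD(5)[OF fsubspace_keys[of "lists L"]] that by simp
      have zz: "(x \<oplus>\<^bsub>V\<^esub> y) \<ominus>\<^bsub>V\<^esub> x \<ominus>\<^bsub>V\<^esub> y = \<zero>\<^bsub>V\<^esub>" if "x \<in> carrier V" "y \<in> carrier V" for x y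
        using that by (simp add: a_minus_def V.M.a_comm[of x y] V.M.a_assoc V.M.r_neg)
      have z1: "x \<ominus>\<^bsub>V\<^esub> x = \<zero>\<^bsub>V\<^esub>" if "x \<in> carrier V" for x using that by (simp add: a_minus_def V.M.r_neg)
      note LD = L[unfolded closed_under_bracket_def]
      note d = lie_moduleD[OF V]
      consider (a) X Y where "X \<in> L" "Y \<in> L" "r = gen [X + Y] - gen [X] - gen [Y]"
        | (b) c X where "X \<in> L" "r = gen [mscale c X] - fscale c (gen [X])"
        | (c) X Y where "X \<in> L" "Y \<in> L" "r = gen [X, Y] - gen [Y, X] - gen [commutator X Y]"
        using r unfolding enveloping_relations_def by blast
      then show ?thesis
      proof cases
        case a
        then show ?thesis using LD v d by (simp add: diff kd g zz)
      next
        case b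
        have "Poly_Mapping.keys (fscale c (gen [X])) \<subseteq> lists L"
          using b keys_fscale_subset[of c "gen [X]"] by auto
        then show ?thesis using b LD v d wa(3)[of "gen [X]" v c] by (simp add: diff g z1)
      next
        case c
        then show ?thesis using LD v d by (simp add: diff kd g z1)
      qed
    qed
    then show "r \<in> ?J" using keys by blast
  qed
  ultimately have "enveloping_ideal L \<subseteq> ?J" by (rule enveloping_ideal_facts(3)[OF L])
  then show ?thesis using k v by blast
qed

lemma enveloping_act_uclass:
  assumes L: "closed_under_bracket L" and V: "lie_module L V" and p: "Poly_Mapping.keys p \<subseteq> lists L"
    and v: "v \<in> carrier V"
  shows "enveloping_act V (uclass L p) v = word_action V p v"
proof -
  note wa = word_action_facts[OF V] and s = lie_module_space[OF V]
  have "word_action V (k + p) v = word_action V p v" if k: "k \<in> enveloping_ideal L" for k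
  proof -
    have "Poly_Mapping.keys k \<subseteq> lists L"
      using enveloping_ideal_facts(1)[OF L] k by (auto simp: ideal_free_algebra_iff)
    then show ?thesis using wa(1,2) p v word_action_ideal[OF L V k v] s(12) by simp
  qed
  then have "(\<lambda>p. word_action V p v) ` uclass L p = {word_action V p v}"
    using fsubspaceD(1)[OF fsubspace_enveloping_ideal[OF L]] unfolding uclass_def fcoset_def image_image by auto
  then show ?thesis
    by (simp add: enveloping_act_def word_action_def free_lift_def)
qed

section \<open>Verma modules\<close>

subsection \<open>Quotients of free spaces with an action\<close>

definition tensor_kernel ::
    "(complex, 'v, 'e) module_scheme \<Rightarrow> (complex, 'w, 'f) module_scheme
      \<Rightarrow> ('v \<times> 'w \<Rightarrow>\<^sub>0 complex) set \<Rightarrow> ('v \<times> 'w \<Rightarrow>\<^sub>0 complex) set" where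
  "tensor_kernel V W R = LinearCombinations.module.span complex_ring (free_space (carrier V \<times> carrier W))
     (bilinear_relations V W \<union> R)"

lemma bilinear_relations_subset:
  assumes "vectorspace complex_ring V" "vectorspace complex_ring W"
  shows "bilinear_relations V W \<subseteq> {p. Poly_Mapping.keys p \<subseteq> carrier V \<times> carrier W}"
proof -
  interpret V: vectorspace complex_ring V by fact
  interpret W: vectorspace complex_ring W by fact
  define S where "S = {p :: 'a \<times> 'c \<Rightarrow>\<^sub>0 complex. Poly_Mapping.keys p \<subseteq> carrier V \<times> carrier W}"
  have "fsubspace S" unfolding S_def by (rule fsubspace_keys)
  note s = fsubspaceD(3,5)[OF this]
  have g: "gen (v, w) \<in> S" if "v \<in> carrier V" "w \<in> carrier W" for v w
    using that by (simp add: S_def)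
  have "bilinear_relations V W \<subseteq> S"
    unfolding bilinear_relations_def
    using V.smult_closed W.smult_closed by (auto intro!: s g)
  then show ?thesis by (simp add: S_def)
qed

lemma tensor_kernel_facts:
  assumes V: "vectorspace complex_ring V" and W: "vectorspace complex_ring W"
    and R: "R \<subseteq> {p. Poly_Mapping.keys p \<subseteq> carrier V \<times> carrier W}"
  shows "fsubspace (tensor_kernel V W R)"
    "bilinear_relations V W \<subseteq> tensor_kernel V W R" "R \<subseteq> tensor_kernel V W R"
    "fsubspace M \<Longrightarrow> bilinear_relations V W \<subseteq> M \<Longrightarrow> R \<subseteq> M \<Longrightarrow> tensor_kernel V W R \<subseteq> M"
proof -
  have sub: "bilinear_relations V W \<union> R \<subseteq> {p. Poly_Mapping.keys p \<subseteq> carrier V \<times> carrier W}"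
    using bilinear_relations_subset[OF V W] R by blast
  note f = fspan_facts[OF sub]
  show "fsubspace (tensor_kernel V W R)"
    "bilinear_relations V W \<subseteq> tensor_kernel V W R" "R \<subseteq> tensor_kernel V W R"
    "fsubspace M \<Longrightarrow> bilinear_relations V W \<subseteq> M \<Longrightarrow> R \<subseteq> M \<Longrightarrow> tensor_kernel V W R \<subseteq> M"
    using f(1,3) f(4)[of M] by (auto simp: tensor_kernel_def)
qed

lemma bilinear_relations_cases:
  assumes "r \<in> bilinear_relations V W"
  obtains v v' w where "v \<in> carrier V" "v' \<in> carrier V" "w \<in> carrier W"
      "r = gen (v \<oplus>\<^bsub>V\<^esub> v', w) - gen (v, w) - gen (v', w)"
    | v w w' where "v \<in> carrier V" "w \<in> carrier W" "w' \<in> carrier W"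
      "r = gen (v, w \<oplus>\<^bsub>W\<^esub> w') - gen (v, w) - gen (v, w')"
    | c v w where "v \<in> carrier V" "w \<in> carrier W" "r = gen (c \<odot>\<^bsub>V\<^esub> v, w) - fscale c (gen (v, w))"
    | c v w where "v \<in> carrier V" "w \<in> carrier W" "r = gen (v, c \<odot>\<^bsub>W\<^esub> w) - fscale c (gen (v, w))"
  using assms unfolding bilinear_relations_def by blast

lemma bilinear_relationsI:
  "v \<in> carrier V \<Longrightarrow> v' \<in> carrier V \<Longrightarrow> w \<in> carrier W \<Longrightarrow>
    gen (v \<oplus>\<^bsub>V\<^esub> v', w) - gen (v, w) - gen (v', w) \<in> bilinear_relations V W"
  "v \<in> carrier V \<Longrightarrow> w \<in> carrier W \<Longrightarrow> w' \<in> carrier W \<Longrightarrow>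
    gen (v, w \<oplus>\<^bsub>W\<^esub> w') - gen (v, w) - gen (v, w') \<in> bilinear_relations V W"
  "v \<in> carrier V \<Longrightarrow> w \<in> carrier W \<Longrightarrow> gen (c \<odot>\<^bsub>V\<^esub> v, w) - fscale c (gen (v, w)) \<in> bilinear_relations V W"
  "v \<in> carrier V \<Longrightarrow> w \<in> carrier W \<Longrightarrow> gen (v, c \<odot>\<^bsub>W\<^esub> w) - fscale c (gen (v, w)) \<in> bilinear_relations V W"
  unfolding bilinear_relations_def by blast+

lemma tensor_quotient_facts:
  assumes K: "fsubspace (tensor_kernel V W R)"
  shows "carrier (tensor_quotient V W R \<phi>) =
      fcoset (tensor_kernel V W R) ` {p. Poly_Mapping.keys p \<subseteq> carrier V \<times> carrier W}"
    "zero (tensor_quotient V W R \<phi>) = fcoset (tensor_kernel V W R) 0"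
    "add (tensor_quotient V W R \<phi>) (fcoset (tensor_kernel V W R) p) (fcoset (tensor_kernel V W R) q) =
      fcoset (tensor_kernel V W R) (p + q)"
    "smult (tensor_quotient V W R \<phi>) c (fcoset (tensor_kernel V W R) p) = fcoset (tensor_kernel V W R) (fscale c p)"
    "(\<And>k. k \<in> tensor_kernel V W R \<Longrightarrow> linear_extension (\<phi> X) k \<in> tensor_kernel V W R) \<Longrightarrow>
      act (tensor_quotient V W R \<phi>) X (fcoset (tensor_kernel V W R) p) =
      fcoset (tensor_kernel V W R) (linear_extension (\<phi> X) p)"
proof -
  let ?F = "free_space (carrier V \<times> carrier W)" and ?K = "tensor_kernel V W R"
  note qf = quotient_space_facts[OF K, of ?F]
  have ext: "carrier (tensor_quotient V W R \<phi>) = carrier (quotient_space ?F ?K)"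
    "zero (tensor_quotient V W R \<phi>) = zero (quotient_space ?F ?K)"
    "add (tensor_quotient V W R \<phi>) = add (quotient_space ?F ?K)"
    "smult (tensor_quotient V W R \<phi>) = smult (quotient_space ?F ?K)"
    "act (tensor_quotient V W R \<phi>) = (\<lambda>X S. \<Union>p\<in>S. ?K +>\<^bsub>?F\<^esub> linear_extension (\<phi> X) p)"
    by (simp_all add: tensor_quotient_def tensor_kernel_def Let_def module.defs lmodule.defs)
  show "carrier (tensor_quotient V W R \<phi>) = fcoset ?K ` {p. Poly_Mapping.keys p \<subseteq> carrier V \<times> carrier W}"
    "zero (tensor_quotient V W R \<phi>) = fcoset ?K 0"
    "add (tensor_quotient V W R \<phi>) (fcoset ?K p) (fcoset ?K q) = fcoset ?K (p + q)"
    "smult (tensor_quotient V W R \<phi>) c (fcoset ?K p) = fcoset ?K (fscale c p)"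
    unfolding ext using qf by simp_all
  show "act (tensor_quotient V W R \<phi>) X (fcoset ?K p) = fcoset ?K (linear_extension (\<phi> X) p)"
    if "\<And>k. k \<in> ?K \<Longrightarrow> linear_extension (\<phi> X) k \<in> ?K"
    unfolding ext a_r_coset_fcoset[OF free_space_simps(2)]
    by (rule fcoset_map[OF K K]) (simp_all add: linear_extension_simps that)
qed

subsection \<open>Presentation of the Verma module\<close>

lemma complex_space_simps [simp]:
  "carrier complex_space = UNIV" "add complex_space = (+)" "zero complex_space = 0" "smult complex_space = (*)"
  by (simp_all add: complex_space_def ring.defs module.defs)

lemma weight_module_simps [simp]:
  "carrier (weight_module \<mu>) = UNIV" "add (weight_module \<mu>) = (+)" "zero (weight_module \<mu>) = 0"
  "smult (weight_module \<mu>) = (*)" "act (weight_module \<mu>) X z = \<mu> * X$1$1 * z"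
  by (simp_all add: weight_module_def complex_space_def ring.defs module.defs lmodule.defs)

lemma vectorspace_weight_module: "vectorspace complex_ring (weight_module \<mu>)"
proof (rule complex_vectorspaceI)
  fix v show "\<exists>w\<in>carrier (weight_module \<mu>). v \<oplus>\<^bsub>weight_module \<mu>\<^esub> w = \<zero>\<^bsub>weight_module \<mu>\<^esub>"
    by (rule bexI[of _ "- v"]) simp_all
qed (simp_all add: algebra_simps)

lemma lie_module_weight_module: "lie_module borel_subalgebra (weight_module \<mu>)"
  unfolding lie_module_def
proof (intro conjI ballI allI vectorspace_weight_module, goal_cases)
  case (4 X Y v)
  have "x \<ominus>\<^bsub>weight_module \<mu>\<^esub> y = x - y" for x y
    using vectorspace_minus[OF vectorspace_weight_module, of x \<mu> y] by simp
  then show ?case using 4 by (simp add: borel_iff)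
qed (simp_all add: module_hom_def algebra_simps)

lemma vectorspace_enveloping_algebra:
  assumes "closed_under_bracket L"
  shows "vectorspace complex_ring (enveloping_algebra L)"
proof -
  note ef = enveloping_algebra_facts[OF assms]
  have V: "vectorspace complex_ring (free_algebra L)" by (rule vectorspace_fscale[of _ "lists L"]) simp_all
  have z: "\<zero>\<^bsub>enveloping_algebra L\<^esub> = uclass L 0"
    by (simp add: enveloping_algebra_def quotient_space_def uclass_def fcoset_zero)
  show ?thesis
    by (rule vectorspace_image[OF V, of "uclass L"]) (simp_all add: ef(1,2,3) z)
qed

definition verma_relations :: "complex \<Rightarrow> (((complex^2^2) list \<Rightarrow>\<^sub>0 complex) set \<times> complex \<Rightarrow>\<^sub>0 complex) set" where
  "verma_relations \<mu> = {gen (u \<otimes>\<^bsub>enveloping_algebra sl2\<^esub> enveloping_incl sl2 b, z) - gen (u, enveloping_act (weight_module \<mu>) b z)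
     | u b z. u \<in> carrier (enveloping_algebra sl2) \<and> b \<in> carrier (enveloping_algebra borel_subalgebra)}"

definition verma_kernel :: "complex \<Rightarrow> (((complex^2^2) list \<Rightarrow>\<^sub>0 complex) set \<times> complex \<Rightarrow>\<^sub>0 complex) set" where
  "verma_kernel \<mu> = tensor_kernel (enveloping_algebra sl2) (weight_module \<mu>) (verma_relations \<mu>)"

definition verma_action ::
    "complex^2^2 \<Rightarrow> ((complex^2^2) list \<Rightarrow>\<^sub>0 complex) set \<times> complex \<Rightarrow> (((complex^2^2) list \<Rightarrow>\<^sub>0 complex) set \<times> complex \<Rightarrow>\<^sub>0 complex)" where
  "verma_action X = (\<lambda>(u, z). gen (enveloping_gen sl2 X \<otimes>\<^bsub>enveloping_algebra sl2\<^esub> u, z))"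

lemma verma_alt:
  "verma \<mu> = tensor_quotient (enveloping_algebra sl2) (weight_module \<mu>) (verma_relations \<mu>) verma_action"
  by (simp add: verma_def verma_relations_def verma_action_def[abs_def] Let_def)

abbreviation in_U :: "((complex^2^2) list \<Rightarrow>\<^sub>0 complex) \<Rightarrow> bool" where
  "in_U p \<equiv> Poly_Mapping.keys p \<subseteq> lists sl2"

abbreviation in_Ub :: "((complex^2^2) list \<Rightarrow>\<^sub>0 complex) \<Rightarrow> bool" where
  "in_Ub p \<equiv> Poly_Mapping.keys p \<subseteq> lists borel_subalgebra"

text \<open>
  The element \<open>u \<otimes> z\<close> for the class \<open>u\<close> of \<open>p\<close> in the enveloping algebra.
\<close>

definition pure :: "((complex^2^2) list \<Rightarrow>\<^sub>0 complex) \<Rightarrow> complex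
    \<Rightarrow> (((complex^2^2) list \<Rightarrow>\<^sub>0 complex) set \<times> complex \<Rightarrow>\<^sub>0 complex)" where
  "pure p z = gen (uclass sl2 p, z)"

lemma borel_subset_sl2: "borel_subalgebra \<subseteq> sl2"
  by (auto simp: borel_iff sl2_iff)

lemma in_Ub_in_U: "in_Ub p \<Longrightarrow> in_U p"
  using lists_mono[OF borel_subset_sl2] by blast

lemma verma_relation_eq:
  assumes "in_U p" "in_Ub q"
  shows "gen (uclass sl2 p \<otimes>\<^bsub>enveloping_algebra sl2\<^esub> enveloping_incl sl2 (uclass borel_subalgebra q), z)
      - gen (uclass sl2 p, enveloping_act (weight_module \<mu>) (uclass borel_subalgebra q) z)
    = pure (word_mult p q) z - pure p (word_action (weight_module \<mu>) q z)"
  using assms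
  by (simp add: enveloping_incl_uclass[OF closed_under_bracket_sl2 closed_under_bracket_borel borel_subset_sl2]
      enveloping_algebra_facts(4)[OF closed_under_bracket_sl2] in_Ub_in_U pure_def
      enveloping_act_uclass[OF closed_under_bracket_borel lie_module_weight_module])

lemma verma_relations_subset:
  "verma_relations \<mu> \<subseteq> {p. Poly_Mapping.keys p \<subseteq> carrier (enveloping_algebra sl2) \<times> carrier (weight_module \<mu>)}"
proof
  fix r assume "r \<in> verma_relations \<mu>"
  then obtain p q z where pq: "in_U p" "in_Ub q"
    "r = pure (word_mult p q) z - pure p (word_action (weight_module \<mu>) q z)"
    unfolding verma_relations_def
    using verma_relation_eq
    by (auto simp: enveloping_algebra_facts(1)[OF closed_under_bracket_sl2]
        enveloping_algebra_facts(1)[OF closed_under_bracket_borel])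
  have "in_U (word_mult p q)" by (rule word_mult_closed[OF pq(1) in_Ub_in_U[OF pq(2)]])
  then show "r \<in> {p. Poly_Mapping.keys p \<subseteq> carrier (enveloping_algebra sl2) \<times> carrier (weight_module \<mu>)}"
    unfolding pq(3) using pq(1)
    by (intro fsubspaceD(5)[OF fsubspace_keys])
      (auto simp: pure_def enveloping_algebra_facts(1)[OF closed_under_bracket_sl2])
qed

lemmas verma_kernel_facts = tensor_kernel_facts[OF vectorspace_enveloping_algebra[OF closed_under_bracket_sl2]
    vectorspace_weight_module verma_relations_subset, folded verma_kernel_def]

text \<open>
  The relations of the tensor product over the enveloping algebra of the Borel subalgebra, expressed by
  representatives in the free algebra. By \<open>verma_kernel_least\<close> they generate all relations.
\<close>

lemma verma_kernel_pure:
  "in_U p \<Longrightarrow> in_U q \<Longrightarrow> pure (p + q) z - pure p z - pure q z \<in> verma_kernel \<mu>"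
  "in_U p \<Longrightarrow> pure p (z + z') - pure p z - pure p z' \<in> verma_kernel \<mu>"
  "in_U p \<Longrightarrow> pure (fscale c p) z - fscale c (pure p z) \<in> verma_kernel \<mu>"
  "in_U p \<Longrightarrow> pure p (c * z) - fscale c (pure p z) \<in> verma_kernel \<mu>"
  "in_U p \<Longrightarrow> in_Ub q \<Longrightarrow> pure (word_mult p q) z - pure p (word_action (weight_module \<mu>) q z) \<in> verma_kernel \<mu>"
proof -
  note ef = enveloping_algebra_facts[OF closed_under_bracket_sl2]
  have car: "uclass sl2 p \<in> carrier (enveloping_algebra sl2)" if "in_U p" for p using that by (simp add: ef(1))
  show "in_U p \<Longrightarrow> in_U q \<Longrightarrow> pure (p + q) z - pure p z - pure q z \<in> verma_kernel \<mu>"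
    using subsetD[OF verma_kernel_facts(2)[of \<mu>] bilinear_relationsI(1)[OF car[of p] car[of q]], of z]
    by (simp add: pure_def ef)
  show "in_U p \<Longrightarrow> pure p (z + z') - pure p z - pure p z' \<in> verma_kernel \<mu>"
    using subsetD[OF verma_kernel_facts(2)[of \<mu>] bilinear_relationsI(2)[OF car[of p]], of z z']
    by (simp add: pure_def)
  show "in_U p \<Longrightarrow> pure (fscale c p) z - fscale c (pure p z) \<in> verma_kernel \<mu>"
    using subsetD[OF verma_kernel_facts(2)[of \<mu>] bilinear_relationsI(3)[OF car[of p]], of z c]
    by (simp add: pure_def ef)
  show "in_U p \<Longrightarrow> pure p (c * z) - fscale c (pure p z) \<in> verma_kernel \<mu>"
    using subsetD[OF verma_kernel_facts(2)[of \<mu>] bilinear_relationsI(4)[OF car[of p]], of z c]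
    by (simp add: pure_def)
  show "pure (word_mult p q) z - pure p (word_action (weight_module \<mu>) q z) \<in> verma_kernel \<mu>" if "in_U p" "in_Ub q"
  proof (rule subsetD[OF verma_kernel_facts(3)])
    show "pure (word_mult p q) z - pure p (word_action (weight_module \<mu>) q z) \<in> verma_relations \<mu>"
      unfolding verma_relation_eq[OF that, symmetric] verma_relations_def
      using that(2) car[OF that(1)] enveloping_algebra_facts(1)[OF closed_under_bracket_borel] by blast
  qed
qed

lemma verma_kernel_least:
  assumes M: "fsubspace M"
    and "\<And>p q z. in_U p \<Longrightarrow> in_U q \<Longrightarrow> pure (p + q) z - pure p z - pure q z \<in> M"
    and "\<And>p z z'. in_U p \<Longrightarrow> pure p (z + z') - pure p z - pure p z' \<in> M"
    and "\<And>c p z. in_U p \<Longrightarrow> pure (fscale c p) z - fscale c (pure p z) \<in> M"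
    and "\<And>c p z. in_U p \<Longrightarrow> pure p (c * z) - fscale c (pure p z) \<in> M"
    and "\<And>p q z. in_U p \<Longrightarrow> in_Ub q \<Longrightarrow> pure (word_mult p q) z - pure p (word_action (weight_module \<mu>) q z) \<in> M"
  shows "verma_kernel \<mu> \<subseteq> M"
proof (rule verma_kernel_facts(4)[OF M])
  note ef = enveloping_algebra_facts[OF closed_under_bracket_sl2]
  show "bilinear_relations (enveloping_algebra sl2) (weight_module \<mu>) \<subseteq> M"
  proof
    fix r assume "r \<in> bilinear_relations (enveloping_algebra sl2) (weight_module \<mu>)"
    then show "r \<in> M"
    proof (cases rule: bilinear_relations_cases)
      case (1 v v' w)
      then show ?thesis using assms(2) by (auto simp: ef(1,2) pure_def)
    next
      case (2 v w w')
      then show ?thesis using assms(3) by (auto simp: ef(1) pure_def)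
    next
      case (3 c v w)
      then show ?thesis using assms(4) by (auto simp: ef(1,3) pure_def)
    next
      case (4 c v w)
      then show ?thesis using assms(5) by (auto simp: ef(1) pure_def)
    qed
  qed
  show "verma_relations \<mu> \<subseteq> M"
  proof
    fix r assume "r \<in> verma_relations \<mu>"
    then obtain p q z where "in_U p" "in_Ub q"
      "r = pure (word_mult p q) z - pure p (word_action (weight_module \<mu>) q z)"
      unfolding verma_relations_def
      using verma_relation_eq
      by (auto simp: enveloping_algebra_facts(1)[OF closed_under_bracket_sl2]
          enveloping_algebra_facts(1)[OF closed_under_bracket_borel])
    then show "r \<in> M" using assms(6) by simp
  qed
qed

lemma in_U_simps:
  "in_U p \<Longrightarrow> in_U q \<Longrightarrow> in_U (p + q)" "in_U p \<Longrightarrow> in_U (fscale c p)" "in_U p \<Longrightarrow> in_U q \<Longrightarrow> in_U (p - q)"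
  "in_U p \<Longrightarrow> in_U q \<Longrightarrow> in_U (word_mult p q)" "X \<in> sl2 \<Longrightarrow> in_U (gen [X])"
  using fsubspaceD(2,3,5)[OF fsubspace_keys[of "lists sl2"]] by (simp_all add: word_mult_closed)

lemma verma_action_pure:
  assumes "X \<in> sl2" "in_U p"
  shows "linear_extension (verma_action X) (pure p z) = pure (word_mult (gen [X]) p) z"
  using assms enveloping_algebra_facts(4,5)[OF closed_under_bracket_sl2]
  by (simp add: pure_def verma_action_def in_U_simps)

lemma verma_action_kernel:
  assumes X: "X \<in> sl2" and k: "k \<in> verma_kernel \<mu>"
  shows "linear_extension (verma_action X) k \<in> verma_kernel \<mu>"
proof -
  note va = verma_action_pure[OF X] and l = linear_extension_simps and u = in_U_simps(1-4) X
  let ?M = "{k. linear_extension (verma_action X) k \<in> verma_kernel \<mu>}"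
  have "verma_kernel \<mu> \<subseteq> ?M"
  proof (rule verma_kernel_least)
    show "fsubspace ?M" by (rule fsubspace_vimage[OF flinear_linear_extension verma_kernel_facts(1)])
    show "pure (p + q) z - pure p z - pure q z \<in> ?M" if "in_U p" "in_U q" for p q z
      using verma_kernel_pure(1)[of "word_mult (gen [X]) p" "word_mult (gen [X]) q" z \<mu>] that
      by (simp add: l va u word_mult_linear)
    show "pure p (z + z') - pure p z - pure p z' \<in> ?M" if "in_U p" for p z z'
      using verma_kernel_pure(2)[of "word_mult (gen [X]) p" z z' \<mu>] that by (simp add: l va u)
    show "pure (fscale c p) z - fscale c (pure p z) \<in> ?M" if "in_U p" for c p z
      using verma_kernel_pure(3)[of "word_mult (gen [X]) p" c z \<mu>] that by (simp add: l va u word_mult_linear)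
    show "pure p (c * z) - fscale c (pure p z) \<in> ?M" if "in_U p" for c p z
      using verma_kernel_pure(4)[of "word_mult (gen [X]) p" c z \<mu>] that by (simp add: l va u)
    show "pure (word_mult p q) z - pure p (word_action (weight_module \<mu>) q z) \<in> ?M" if "in_U p" "in_Ub q" for p q z
      using verma_kernel_pure(5)[of "word_mult (gen [X]) p" q z \<mu>] that in_Ub_in_U[OF that(2)]
      by (simp add: l va u word_mult_assoc)
  qed
  then show ?thesis using k by blast
qed

definition vclass :: "complex \<Rightarrow> (((complex^2^2) list \<Rightarrow>\<^sub>0 complex) set \<times> complex \<Rightarrow>\<^sub>0 complex) \<Rightarrow> verma_carrier" where
  "vclass \<mu> r = fcoset (verma_kernel \<mu>) r"

abbreviation in_F :: "(((complex^2^2) list \<Rightarrow>\<^sub>0 complex) set \<times> complex \<Rightarrow>\<^sub>0 complex) \<Rightarrow> bool" where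
  "in_F r \<equiv> Poly_Mapping.keys r \<subseteq> carrier (enveloping_algebra sl2) \<times> UNIV"

lemma verma_facts:
  "carrier (verma \<mu>) = vclass \<mu> ` {r. in_F r}"
  "zero (verma \<mu>) = vclass \<mu> 0"
  "add (verma \<mu>) (vclass \<mu> r) (vclass \<mu> r') = vclass \<mu> (r + r')"
  "smult (verma \<mu>) c (vclass \<mu> r) = vclass \<mu> (fscale c r)"
  "X \<in> sl2 \<Longrightarrow> act (verma \<mu>) X (vclass \<mu> r) = vclass \<mu> (linear_extension (verma_action X) r)"
  unfolding verma_alt vclass_def[abs_def] verma_kernel_def
  using tensor_quotient_facts[OF verma_kernel_facts(1)[unfolded verma_kernel_def]]
    verma_action_kernel[unfolded verma_kernel_def] by simp_all

lemma vclass_eqI: "r - r' \<in> verma_kernel \<mu> \<Longrightarrow> vclass \<mu> r = vclass \<mu> r'"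
  by (simp add: vclass_def fcoset_eq_iff verma_kernel_facts(1))

lemma in_F_pure: "in_U p \<Longrightarrow> in_F (pure p z)"
  by (simp add: pure_def enveloping_algebra_facts(1)[OF closed_under_bracket_sl2])

lemma in_F_contains:
  assumes "fsubspace M" "\<And>p z. in_U p \<Longrightarrow> pure p z \<in> M" "in_F r"
  shows "r \<in> M"
proof (rule fsubspace_contains[OF assms(1) _ assms(3)])
  fix x assume "x \<in> carrier (enveloping_algebra sl2) \<times> (UNIV :: complex set)"
  then show "gen x \<in> M"
    using assms(2) by (auto simp: pure_def enveloping_algebra_facts(1)[OF closed_under_bracket_sl2])
qed

lemma verma_action_in_F:
  assumes "X \<in> sl2" "in_F r"
  shows "in_F (linear_extension (verma_action X) r)"
proof -
  have "r \<in> {r. linear_extension (verma_action X) r \<in> {r. in_F r}}"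
  proof (rule in_F_contains[OF fsubspace_vimage[OF flinear_linear_extension fsubspace_keys] _ assms(2)])
    fix p z assume "in_U p"
    then show "pure p z \<in> {r. linear_extension (verma_action X) r \<in> {r. in_F r}}"
      using assms(1) by (simp add: verma_action_pure in_F_pure in_U_simps)
  qed
  then show ?thesis by simp
qed

lemma lie_module_verma: "lie_module sl2 (verma \<mu>)"
proof -
  note vf = verma_facts[where \<mu> = \<mu>]
  let ?A = "\<lambda>X. linear_extension (verma_action X)"
  have vs: "vectorspace complex_ring (verma \<mu>)"
    by (rule vectorspace_image[OF vectorspace_free_space[of "carrier (enveloping_algebra sl2) \<times> UNIV"], of "vclass \<mu>"])
      (simp_all add: vf)
  have minus: "vclass \<mu> r \<ominus>\<^bsub>verma \<mu>\<^esub> vclass \<mu> r' = vclass \<mu> (r - r')" if "in_F r" "in_F r'" for r r'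
    using vectorspace_minus[OF vs, of "vclass \<mu> r" "vclass \<mu> r'"] that by (simp add: vf fscale_minus_one)
  have kernelI: "g r \<in> verma_kernel \<mu>"
    if g: "flinear g" "\<And>p z. in_U p \<Longrightarrow> g (pure p z) \<in> verma_kernel \<mu>" and r: "in_F r" for g r
    using in_F_contains[OF fsubspace_vimage[OF g(1) verma_kernel_facts(1)] _ r] g(2) by simp
  have lin: "flinear (?A X)" for X by (rule flinear_linear_extension)
  have ideal: "p \<in> enveloping_relations sl2 \<Longrightarrow> in_U q \<Longrightarrow> word_mult p q \<in> enveloping_ideal sl2" for p q
    using enveloping_ideal_facts(1,2)[OF closed_under_bracket_sl2] unfolding ideal_free_algebra_iff by blast
  have pure_cong: "pure p z = pure q z" if "p - q \<in> enveloping_ideal sl2" for p q z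
    using uclass_eqI[OF closed_under_bracket_sl2 that] by (simp add: pure_def)
  note u = in_U_simps
  show ?thesis
    unfolding lie_module_def
  proof (intro conjI ballI allI vs, goal_cases)
    case (1 X)
    then show ?case by (auto simp: module_hom_def vf verma_action_in_F linear_extension_simps)
  next
    case (2 X Y v)
    then obtain r where r: "in_F r" "v = vclass \<mu> r" by (auto simp: vf)
    have "?A (X + Y) r - (?A X r + ?A Y r) \<in> verma_kernel \<mu>"
    proof (rule kernelI[of "\<lambda>r. ?A (X + Y) r - (?A X r + ?A Y r)", OF _ _ r(1)])
      show "flinear (\<lambda>r. ?A (X + Y) r - (?A X r + ?A Y r))" by (intro flinear_ops lin)
      fix p z assume p: "in_U p"
      have "gen [X + Y] - gen [X] - gen [Y] \<in> enveloping_relations sl2"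
        using 2 unfolding enveloping_relations_def by blast
      from ideal[OF this p]
      have "pure (word_mult (gen [X + Y]) p) z = pure (word_mult (gen [X]) p + word_mult (gen [Y]) p) z"
        by (intro pure_cong) (simp add: word_mult_linear algebra_simps)
      then show "?A (X + Y) (pure p z) - (?A X (pure p z) + ?A Y (pure p z)) \<in> verma_kernel \<mu>"
        using verma_kernel_pure(1)[of "word_mult (gen [X]) p" "word_mult (gen [Y]) p" z \<mu>] p 2
        by (simp add: verma_action_pure sl2_closed u algebra_simps)
    qed
    then show ?case using 2 r by (simp add: vf sl2_closed vclass_eqI)
  next
    case (3 c X v)
    then obtain r where r: "in_F r" "v = vclass \<mu> r" by (auto simp: vf)
    have "?A (mscale c X) r - fscale c (?A X r) \<in> verma_kernel \<mu>"
    proof (rule kernelI[of "\<lambda>r. ?A (mscale c X) r - fscale c (?A X r)", OF _ _ r(1)])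
      show "flinear (\<lambda>r. ?A (mscale c X) r - fscale c (?A X r))" by (intro flinear_ops lin)
      fix p z assume p: "in_U p"
      have "gen [mscale c X] - fscale c (gen [X]) \<in> enveloping_relations sl2"
        using 3 unfolding enveloping_relations_def by blast
      from ideal[OF this p]
      have "pure (word_mult (gen [mscale c X]) p) z = pure (fscale c (word_mult (gen [X]) p)) z"
        by (intro pure_cong) (simp add: word_mult_linear)
      then show "?A (mscale c X) (pure p z) - fscale c (?A X (pure p z)) \<in> verma_kernel \<mu>"
        using verma_kernel_pure(3)[of "word_mult (gen [X]) p" c z \<mu>] p 3
        by (simp add: verma_action_pure sl2_closed u)
    qed
    then show ?case using 3 r by (simp add: vf sl2_closed vclass_eqI)
  next
    case (4 X Y v)
    then obtain r where r: "in_F r" "v = vclass \<mu> r" by (auto simp: vf)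
    have "?A (commutator X Y) r - (?A X (?A Y r) - ?A Y (?A X r)) \<in> verma_kernel \<mu>"
    proof (rule kernelI[of "\<lambda>r. ?A (commutator X Y) r - (?A X (?A Y r) - ?A Y (?A X r))", OF _ _ r(1)])
      show "flinear (\<lambda>r. ?A (commutator X Y) r - (?A X (?A Y r) - ?A Y (?A X r)))"
        by (intro flinear_ops(3) flinear_comp[OF lin lin] lin)
      fix p z assume p: "in_U p"
      have "gen [X, Y] - gen [Y, X] - gen [commutator X Y] \<in> enveloping_relations sl2"
        using 4 unfolding enveloping_relations_def by blast
      from fsubspaceD(4)[OF fsubspace_enveloping_ideal[OF closed_under_bracket_sl2] ideal[OF this p]]
      have eq: "pure (word_mult (gen [commutator X Y]) p) z = pure (word_mult (gen [X, Y]) p - word_mult (gen [Y, X]) p) z"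
        by (intro pure_cong) (simp add: word_mult_linear algebra_simps)
      have XY: "word_mult (gen [X]) (word_mult (gen [Y]) p) = word_mult (gen [X, Y]) p"
        "word_mult (gen [Y]) (word_mult (gen [X]) p) = word_mult (gen [Y, X]) p"
        by (simp_all flip: word_mult_assoc)
      have "in_U (gen [X, Y])" "in_U (gen [Y, X])" using 4 by auto
      then show "?A (commutator X Y) (pure p z) - (?A X (?A Y (pure p z)) - ?A Y (?A X (pure p z))) \<in> verma_kernel \<mu>"
        using fsubspaceD(4)[OF verma_kernel_facts(1) verma_kernel_pure(1)[of "word_mult (gen [X, Y]) p - word_mult (gen [Y, X]) p" "word_mult (gen [Y, X]) p" z \<mu>]] p 4
        by (simp add: verma_action_pure sl2_closed u XY eq algebra_simps)
    qed
    then show ?case using 4 r by (simp add: vf sl2_closed vclass_eqI minus verma_action_in_F)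
  qed
qed

subsection \<open>A basis of the Verma module\<close>

lemma singular_verma: "singular_vector (verma \<mu>) \<mu> (vclass \<mu> (pure (gen []) 1))"
proof -
  let ?v = "pure (gen []) 1"
  have one: "in_U (gen [])" by simp
  have act: "act (verma \<mu>) X (vclass \<mu> ?v) = (\<mu> * X$1$1) \<odot>\<^bsub>verma \<mu>\<^esub> vclass \<mu> ?v"
    if X: "X \<in> borel_subalgebra" for X
  proof -
    have X': "X \<in> sl2" using X borel_subset_sl2 by blast
    have wa: "word_action (weight_module \<mu>) (gen [X]) 1 = \<mu> * X$1$1"
      using word_action_gen[OF lie_module_weight_module, of "[X]" 1 \<mu>] X by simp
    have "pure (gen [X]) 1 - pure (gen []) (\<mu> * X$1$1) \<in> verma_kernel \<mu>"
      using verma_kernel_pure(5)[OF one, of "gen [X]" 1 \<mu>] X wa by simp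
    moreover have "pure (gen []) (\<mu> * X$1$1) - fscale (\<mu> * X$1$1) ?v \<in> verma_kernel \<mu>"
      using verma_kernel_pure(4)[OF one, of "\<mu> * X$1$1" 1 \<mu>] by simp
    ultimately have "pure (gen [X]) 1 - fscale (\<mu> * X$1$1) ?v \<in> verma_kernel \<mu>"
      using fsubspaceD(2)[OF verma_kernel_facts(1)] by fastforce
    then show ?thesis
      using X' one by (simp add: verma_facts verma_action_pure vclass_eqI)
  qed
  have "vclass \<mu> ?v \<in> carrier (verma \<mu>)" using in_F_pure[OF one] by (simp add: verma_facts)
  then show ?thesis
    using act[of mat_h] act[of mat_e] lie_module_space(4)[OF lie_module_verma]
    by (simp add: singular_vector_def)
qed

text \<open>
  The class of \<open>1 \<otimes> 1\<close> generates the Verma module: words over the Lie algebra are applied letter by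
  letter, and scalars pass through the tensor sign.
\<close>

lemma vclass_pure_surj:
  assumes W: "lie_submodule sl2 W (verma \<mu>)" and v: "vclass \<mu> (pure (gen []) 1) \<in> W"
  shows "W = carrier (verma \<mu>)"
proof -
  note w = W[unfolded lie_submodule_iff[OF lie_module_verma]]
  let ?M = "{r. vclass \<mu> r \<in> W}"
  have M: "fsubspace ?M" using w by (auto simp: fsubspace_def simp flip: verma_facts)
  have word: "pure (gen w) 1 \<in> ?M" if "w \<in> lists sl2" for w
    using that
  proof induction
    case Nil then show ?case using v by simp
  next
    case (Cons X l)
    have "act (verma \<mu>) X (vclass \<mu> (pure (gen l) 1)) \<in> W" using w Cons by blast
    moreover have "in_U (gen l)" using Cons by simp
    ultimately show ?case using Cons by (simp add: verma_facts verma_action_pure)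
  qed
  have p1: "pure p 1 \<in> ?M" if "in_U p" for p
    using that
  proof (induction p rule: free_induct)
    case zero
    have "vclass \<mu> (pure (fscale 0 0) 1) = vclass \<mu> (fscale 0 (pure 0 1))"
      by (rule vclass_eqI[OF verma_kernel_pure(3)]) simp
    then show ?case using fsubspaceD(1)[OF M] by simp
  next
    case (add p q)
    have "vclass \<mu> (pure (p + q) 1) = vclass \<mu> (pure p 1 + pure q 1)"
      using verma_kernel_pure(1)[OF add(1,2), of 1 \<mu>] by (intro vclass_eqI) (simp add: algebra_simps)
    then show ?case using fsubspaceD(2)[OF M] add by simp
  next
    case (scale c p)
    have "vclass \<mu> (pure (fscale c p) 1) = vclass \<mu> (fscale c (pure p 1))"
      by (rule vclass_eqI[OF verma_kernel_pure(3)[OF scale(1)]])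
    then show ?case using fsubspaceD(3)[OF M] scale by simp
  next
    case (gen w)
    then show ?case by (rule word)
  qed
  have pz: "pure p z \<in> ?M" if "in_U p" for p z
  proof -
    have "vclass \<mu> (pure p z) = vclass \<mu> (fscale z (pure p 1))"
      using verma_kernel_pure(4)[OF that, of z 1 \<mu>] by (intro vclass_eqI) simp
    then show ?thesis using fsubspaceD(3)[OF M p1[OF that]] by simp
  qed
  have "in_F r \<Longrightarrow> r \<in> ?M" for r by (rule in_F_contains[OF M pz])
  then show ?thesis using w by (auto simp: verma_facts)
qed

text \<open>The linear map of the universal property: \<open>u \<otimes> z\<close> is sent to \<open>z\<close> times the image of the
  highest weight vector of the model under \<open>u\<close>.\<close>

definition verma_evaluation ::
    "complex \<Rightarrow> (((complex^2^2) list \<Rightarrow>\<^sub>0 complex) set \<times> complex \<Rightarrow>\<^sub>0 complex) \<Rightarrow> (nat \<Rightarrow>\<^sub>0 complex)" where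
  "verma_evaluation \<mu> = linear_extension (\<lambda>(u, z). fscale z (enveloping_act (verma_model \<mu>) u (gen 0)))"

lemma verma_evaluation_pure:
  "in_U p \<Longrightarrow> verma_evaluation \<mu> (pure p z) = fscale z (word_action (verma_model \<mu>) p (gen 0))"
  by (simp add: verma_evaluation_def pure_def enveloping_act_uclass[OF closed_under_bracket_sl2 lie_module_verma_model])

text \<open>
  The line spanned by the highest weight vector of the model is a copy of the one-dimensional module
  of the Borel subalgebra.
\<close>

lemma word_action_borel:
  assumes q: "in_Ub q"
  shows "word_action (verma_model \<mu>) q (gen 0) = fscale (word_action (weight_module \<mu>) q 1) (gen 0)"
    and "word_action (weight_module \<mu>) q z = z * word_action (weight_module \<mu>) q 1"
proof -
  note wm = word_action_facts[OF lie_module_verma_model] and ww = word_action_facts[OF lie_module_weight_module]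
  show "word_action (weight_module \<mu>) q z = z * word_action (weight_module \<mu>) q 1"
    using word_action_linear(2)[OF lie_module_weight_module q, of 1 \<mu> z] by simp
  have word: "foldr (act (verma_model \<mu>)) w (gen 0) = fscale (foldr (act (weight_module \<mu>)) w 1) (gen 0)"
    if "w \<in> lists borel_subalgebra" for w
    using that
  proof induction
    case (Cons X w)
    then show ?case
      by (simp add: borel_iff verma_model_def lie_moduleD(4)[OF lie_module_verma_model] ac_simps)
  qed simp
  show "word_action (verma_model \<mu>) q (gen 0) = fscale (word_action (weight_module \<mu>) q 1) (gen 0)"
    using q
  proof (induction q rule: free_induct)
    case zero
    then show ?case using wm(4)[of 0] ww(4)[of 0] by simp
  next
    case (add p q)
    then show ?case using wm(2)[OF in_Ub_in_U _ in_Ub_in_U] ww(2) by (simp add: in_Ub_in_U fscale_distribs)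
  next
    case (scale c p)
    then show ?case using wm(3)[OF in_Ub_in_U] ww(3) by simp
  next
    case (gen w)
    then have "w \<in> lists sl2" using lists_mono[OF borel_subset_sl2] by blast
    then show ?case
      using word[OF gen] word_action_gen[OF lie_module_verma_model] word_action_gen[OF lie_module_weight_module gen] by simp
  qed
qed

lemma verma_evaluation_kernel:
  assumes "k \<in> verma_kernel \<mu>"
  shows "verma_evaluation \<mu> k = 0"
proof -
  let ?M = "{k. verma_evaluation \<mu> k \<in> {0}}"
  have lin: "flinear (verma_evaluation \<mu>)" unfolding verma_evaluation_def by (rule flinear_linear_extension)
  note l = flinearD[OF lin] and e = verma_evaluation_pure and u = in_U_simps
  note wm = word_action_facts[OF lie_module_verma_model]
  have "verma_kernel \<mu> \<subseteq> ?M"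
  proof (rule verma_kernel_least)
    show "fsubspace ?M" by (rule fsubspace_vimage[OF lin]) (simp add: fsubspace_def)
    show "pure (p + q) z - pure p z - pure q z \<in> ?M" if "in_U p" "in_U q" for p q z
      using wm(2)[of p "gen 0" _ q] that by (simp add: l e u fscale_distribs)
    show "pure p (z + z') - pure p z - pure p z' \<in> ?M" if "in_U p" for p z z'
      using that by (simp add: l e fscale_distribs)
    show "pure (fscale c p) z - fscale c (pure p z) \<in> ?M" if "in_U p" for c p z
      using wm(3)[of p "gen 0" _ c] that by (simp add: l e u mult.commute)
    show "pure p (c * z) - fscale c (pure p z) \<in> ?M" if "in_U p" for c p z
      using that by (simp add: l e)
    show "pure (word_mult p q) z - pure p (word_action (weight_module \<mu>) q z) \<in> ?M" if pq: "in_U p" "in_Ub q" for p q z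
    proof -
      have "word_action (verma_model \<mu>) (word_mult p q) (gen 0)
        = fscale (word_action (weight_module \<mu>) q 1) (word_action (verma_model \<mu>) p (gen 0))"
        using word_action_mult[OF lie_module_verma_model pq(1) in_Ub_in_U[OF pq(2)], of "gen 0"]
          word_action_linear(2)[OF lie_module_verma_model pq(1), of "gen 0"] word_action_borel(1)[OF pq(2)] by simp
      then show ?thesis
        using pq in_Ub_in_U[OF pq(2)] word_action_borel(2)[OF pq(2), of \<mu> z] by (simp add: l e u)
    qed
  qed
  then show ?thesis using assms by blast
qed

text \<open>
  This is the case of the theorem of Poincare, Birkhoff and Witt that is needed. The image of the
  homomorphism is a submodule that contains the generator, so it is everything. Injectivity holds
  because the evaluation, which respects the relations, returns the coordinates of an element.
\<close>

theorem verma_isomorphic_model: "lie_isomorphic sl2 (verma_model \<mu>) (verma \<mu>)"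
proof -
  let ?v = "vclass \<mu> (pure (gen []) 1)"
  let ?\<theta> = "highest_weight_hom (verma \<mu>) ?v"
  note \<theta> = highest_weight_hom[OF lie_module_verma singular_verma[of \<mu>]]
  define s where "s = linear_extension (\<lambda>i. pure (gen (replicate i mat_f)) 1)"
  have word: "replicate i mat_f \<in> lists sl2" for i by auto
  have pow: "(act (verma \<mu>) mat_f ^^ i) ?v = vclass \<mu> (pure (gen (replicate i mat_f)) 1)" for i
  proof (induction i)
    case (Suc i)
    have "in_U (gen (replicate i mat_f))" using word[of i] by simp
    then show ?case using Suc by (simp add: verma_facts verma_action_pure)
  qed simp
  have in_F: "in_F (s p)" for p
    unfolding s_def by (rule keys_linear_extension) (use in_F_pure word in simp)
  have lin_s: "flinear s" unfolding s_def by (rule flinear_linear_extension)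
  have \<theta>_eq: "?\<theta> p = vclass \<mu> (s p)" for p
  proof (rule vlinear_eqI[OF \<theta>(3)])
    show "vlinear (verma \<mu>) (\<lambda>p. vclass \<mu> (s p))"
      using in_F by (simp add: vlinear_def verma_facts flinearD[OF lin_s])
    show "?\<theta> (gen i) = vclass \<mu> (s (gen i))" for i
      using \<theta>(2)[of i] pow by (simp add: s_def)
  qed
  have eval: "verma_evaluation \<mu> (s p) = p" for p
  proof (rule flinear_eqI[of "\<lambda>p. verma_evaluation \<mu> (s p)" "\<lambda>p. p"])
    show "flinear (\<lambda>p. verma_evaluation \<mu> (s p))"
      by (rule flinear_comp[OF _ lin_s]) (simp add: verma_evaluation_def flinear_linear_extension)
    show "verma_evaluation \<mu> (s (gen i)) = gen i" for i
      using word[of i] word_action_gen[OF lie_module_verma_model word[of i], of "gen 0" \<mu>]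
      by (simp add: s_def verma_evaluation_pure verma_f_pow)
  qed (rule flinear_ops(1))
  have "inj ?\<theta>"
  proof (rule injI)
    fix p q assume "?\<theta> p = ?\<theta> q"
    then have "vclass \<mu> (s p) = vclass \<mu> (s q)" unfolding \<theta>_eq .
    then have "s p - s q \<in> verma_kernel \<mu>"
      unfolding vclass_def fcoset_eq_iff[OF verma_kernel_facts(1)] .
    then have "verma_evaluation \<mu> (s (p - q)) = 0" using verma_evaluation_kernel flinearD(5)[OF lin_s] by simp
    then show "p = q" by (simp add: eval)
  qed
  moreover have "range ?\<theta> = carrier (verma \<mu>)"
  proof (rule vclass_pure_surj)
    have "lie_submodule sl2 (carrier (verma_model \<mu>)) (verma_model \<mu>)"
      by (simp add: lie_submodule_iff[OF lie_module_verma_model])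
    then show "lie_submodule sl2 (range ?\<theta>) (verma \<mu>)"
      using lie_submodule_image[OF lie_module_verma_model lie_module_verma \<theta>(1)] by simp
    show "?v \<in> range ?\<theta>" using \<theta>(2)[of 0] by (metis funpow_0 rangeI)
  qed
  ultimately show ?thesis
    unfolding lie_isomorphic_def using \<theta>(1) by (intro bexI[of _ ?\<theta>]) (simp_all add: bij_betw_def)
qed

section \<open>The tensor product of modules isomorphic to Verma modules\<close>

definition tensor_action ::
    "'v lmodule \<Rightarrow> 'w lmodule \<Rightarrow> complex^2^2 \<Rightarrow> 'v \<times> 'w \<Rightarrow> ('v \<times> 'w \<Rightarrow>\<^sub>0 complex)" where
  "tensor_action V W X = (\<lambda>(v, w). gen (act V X v, w) + gen (v, act W X w))"

lemma tensor_product_alt: "tensor_product V W = tensor_quotient V W {} (tensor_action V W)"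
  by (simp add: tensor_product_def tensor_action_def[abs_def])

lemma tensor_action_kernel:
  assumes V: "lie_module L V" and W: "lie_module L W" and X: "X \<in> L" and k: "k \<in> tensor_kernel V W {}"
  shows "linear_extension (tensor_action V W X) k \<in> tensor_kernel V W {}"
proof -
  note tk = tensor_kernel_facts[OF lie_moduleD(1)[OF V] lie_moduleD(1)[OF W] empty_subsetI]
  note K = fsubspaceD[OF tk(1)]
  let ?A = "linear_extension (tensor_action V W X)"
  let ?M = "{k. ?A k \<in> tensor_kernel V W {}}"
  note mV = lie_moduleD(2)[OF V X] and mW = lie_moduleD(2)[OF W X]
  note rel = bilinear_relationsI[THEN subsetD[OF tk(2)]]
  have "tensor_kernel V W {} \<subseteq> ?M"
  proof (rule tk(4))
    show "fsubspace ?M" by (rule fsubspace_vimage[OF flinear_linear_extension tk(1)])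
    show "bilinear_relations V W \<subseteq> ?M"
    proof
      fix r assume "r \<in> bilinear_relations V W"
      then show "r \<in> ?M"
      proof (cases rule: bilinear_relations_cases)
        case (1 v v' w)
        have "(gen (act V X v \<oplus>\<^bsub>V\<^esub> act V X v', w) - gen (act V X v, w) - gen (act V X v', w)) +
            (gen (v \<oplus>\<^bsub>V\<^esub> v', act W X w) - gen (v, act W X w) - gen (v', act W X w)) \<in> tensor_kernel V W {}"
          using 1 by (intro K(2) rel mV mW)
        then show ?thesis
          unfolding 1(4) mem_Collect_eq using 1(1,2) 1(3) by (simp add: linear_extension_simps tensor_action_def lie_moduleD(3)[OF V X] algebra_simps)
      next
        case (2 v w w')
        have "(gen (act V X v, w \<oplus>\<^bsub>W\<^esub> w') - gen (act V X v, w) - gen (act V X v, w')) +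
            (gen (v, act W X w \<oplus>\<^bsub>W\<^esub> act W X w') - gen (v, act W X w) - gen (v, act W X w')) \<in> tensor_kernel V W {}"
          using 2 by (intro K(2) rel mV mW)
        then show ?thesis
          unfolding 2(4) mem_Collect_eq using 2(1,2) 2(3) by (simp add: linear_extension_simps tensor_action_def lie_moduleD(3)[OF W X] algebra_simps)
      next
        case (3 c v w)
        have "(gen (c \<odot>\<^bsub>V\<^esub> act V X v, w) - fscale c (gen (act V X v, w))) +
            (gen (c \<odot>\<^bsub>V\<^esub> v, act W X w) - fscale c (gen (v, act W X w))) \<in> tensor_kernel V W {}"
          using 3 by (intro K(2) rel mV mW)
        then show ?thesis
          unfolding 3(3) mem_Collect_eq using 3(1,2)  by (simp add: linear_extension_simps tensor_action_def lie_moduleD(4)[OF V X] fscale_distribs algebra_simps)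
      next
        case (4 c v w)
        have "(gen (act V X v, c \<odot>\<^bsub>W\<^esub> w) - fscale c (gen (act V X v, w))) +
            (gen (v, c \<odot>\<^bsub>W\<^esub> act W X w) - fscale c (gen (v, act W X w))) \<in> tensor_kernel V W {}"
          using 4 by (intro K(2) rel mV mW)
        then show ?thesis
          unfolding 4(3) mem_Collect_eq using 4(1,2)  by (simp add: linear_extension_simps tensor_action_def lie_moduleD(4)[OF W X] fscale_distribs algebra_simps)
      qed
    qed
  qed simp
  then show ?thesis using k by blast
qed

definition kron :: "(nat \<Rightarrow>\<^sub>0 complex) \<Rightarrow> (nat \<Rightarrow>\<^sub>0 complex) \<Rightarrow> (nat \<times> nat \<Rightarrow>\<^sub>0 complex)" where
  "kron = bilinear_extension (\<lambda>i j. gen (i, j))"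

lemma flinear_kron: "flinear (\<lambda>p. kron p q)" "flinear (kron p)"
  unfolding kron_def by (rule flinear_bilinear_extension)+

lemmas kron_linear = flinearD[OF flinear_kron(1)] flinearD[OF flinear_kron(2)]

lemma kron_gen [simp]: "kron (gen i) (gen j) = gen (i, j)"
  by (simp add: kron_def bilinear_extension_def)

lemma tensor_model_act_gen:
  "act (tensor_model m n) X (gen (i, j)) =
    kron (act (verma_model m) X (gen i)) (gen j) + kron (gen i) (act (verma_model n) X (gen j))"
  by (simp add: tensor_model_def verma_model_def kron_linear fscale_distribs)

text \<open>
  The pure tensors of basis vectors span the tensor product. They are independent because sending
  \<open>v \<otimes> w\<close> to the Kronecker product of the coordinates of \<open>v\<close> and \<open>w\<close> respects bilinearity.
\<close>

theorem tensor_product_isomorphic_model: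
  assumes V: "lie_module sl2 V" and W: "lie_module sl2 W"
    and isoV: "lie_isomorphic sl2 (verma_model m) V" and isoW: "lie_isomorphic sl2 (verma_model n) W"
  shows "lie_module sl2 (tensor_product V W)" "lie_isomorphic sl2 (tensor_model m n) (tensor_product V W)"
proof -
  let ?T = "tensor_product V W"
  let ?K = "tensor_kernel V W {}"
  note tk = tensor_kernel_facts[OF lie_moduleD(1)[OF V] lie_moduleD(1)[OF W] empty_subsetI]
  note K = fsubspaceD[OF tk(1)]
  note tf = tensor_quotient_facts[OF tk(1), of "tensor_action V W", folded tensor_product_alt]
  have actT: "act ?T X (fcoset ?K p) = fcoset ?K (linear_extension (tensor_action V W X) p)" if "X \<in> sl2" for X p
    by (rule tf(5)) (rule tensor_action_kernel[OF V W that])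
  have coset_eq: "fcoset ?K p = fcoset ?K q" if "p - q \<in> ?K" for p q
    using that by (simp add: fcoset_eq_iff[OF tk(1)])
  obtain \<alpha> where \<alpha>: "\<alpha> \<in> lie_hom sl2 (verma_model m) V" "bij_betw \<alpha> UNIV (carrier V)"
    using isoV by (auto simp: lie_isomorphic_def)
  obtain \<beta> where \<beta>: "\<beta> \<in> lie_hom sl2 (verma_model n) W" "bij_betw \<beta> UNIV (carrier W)"
    using isoW by (auto simp: lie_isomorphic_def)
  obtain \<alpha>' where \<alpha>': "\<alpha>' \<in> lie_hom sl2 V (verma_model m)" "\<And>p. \<alpha>' (\<alpha> p) = p" "\<And>v. v \<in> carrier V \<Longrightarrow> \<alpha> (\<alpha>' v) = v"
    using lie_hom_inverse[OF lie_module_verma_model \<alpha>(1)] \<alpha>(2) by auto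
  obtain \<beta>' where \<beta>': "\<beta>' \<in> lie_hom sl2 W (verma_model n)" "\<And>p. \<beta>' (\<beta> p) = p" "\<And>v. v \<in> carrier W \<Longrightarrow> \<beta> (\<beta>' v) = v"
    using lie_hom_inverse[OF lie_module_verma_model \<beta>(1)] \<beta>(2) by auto
  note \<alpha>h = lie_homD[OF \<alpha>(1), simplified] and \<beta>h = lie_homD[OF \<beta>(1), simplified]
  note \<alpha>h' = lie_homD[OF \<alpha>'(1), simplified] and \<beta>h' = lie_homD[OF \<beta>'(1), simplified]
  define s where "s = linear_extension (\<lambda>(i, j). gen (\<alpha> (gen i), \<beta> (gen j)))"
  have lin_s: "flinear s" and s_gen: "s (gen (i, j)) = gen (\<alpha> (gen i), \<beta> (gen j))" for i j
    by (simp_all add: s_def flinear_linear_extension)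
  have keys_s: "Poly_Mapping.keys (s p) \<subseteq> carrier V \<times> carrier W" for p
    unfolding s_def by (rule keys_linear_extension) (auto simp: \<alpha>h(1) \<beta>h(1))
  define \<theta> where "\<theta> p = fcoset ?K (s p)" for p
  have vl: "vlinear ?T (\<lambda>p. fcoset ?K (t p))"
    if "flinear t" "\<And>p. Poly_Mapping.keys (t p) \<subseteq> carrier V \<times> carrier W" for t :: "(nat \<times> nat \<Rightarrow>\<^sub>0 complex) \<Rightarrow> _"
    using that by (simp add: vlinear_def tf flinearD)
  have \<theta>lin: "vlinear ?T \<theta>" unfolding \<theta>_def by (rule vl[OF lin_s keys_s])
  note \<theta>D = \<theta>lin[unfolded vlinear_def]
  have pure: "fcoset ?K (gen (\<alpha> p, \<beta> q)) = \<theta> (kron p q)" for p q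
  proof -
    have vlq: "vlinear ?T (\<lambda>q. fcoset ?K (gen (\<alpha> p, \<beta> q)))" for p
      unfolding vlinear_def
    proof (intro conjI allI)
      show "fcoset ?K (gen (\<alpha> p, \<beta> q)) \<in> carrier ?T" for q using \<alpha>h(1) \<beta>h(1) by (simp add: tf)
      fix q q' c
      have "gen (\<alpha> p, \<beta> q \<oplus>\<^bsub>W\<^esub> \<beta> q') - gen (\<alpha> p, \<beta> q) - gen (\<alpha> p, \<beta> q') \<in> ?K"
        by (intro subsetD[OF tk(2)] bilinear_relationsI \<alpha>h \<beta>h)
      then show "fcoset ?K (gen (\<alpha> p, \<beta> (q + q'))) = fcoset ?K (gen (\<alpha> p, \<beta> q)) \<oplus>\<^bsub>?T\<^esub> fcoset ?K (gen (\<alpha> p, \<beta> q'))"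
        by (simp add: tf coset_eq \<beta>h(2) diff_diff_eq)
      have "gen (\<alpha> p, c \<odot>\<^bsub>W\<^esub> \<beta> q) - fscale c (gen (\<alpha> p, \<beta> q)) \<in> ?K"
        by (intro subsetD[OF tk(2)] bilinear_relationsI \<alpha>h \<beta>h)
      then show "fcoset ?K (gen (\<alpha> p, \<beta> (fscale c q))) = c \<odot>\<^bsub>?T\<^esub> fcoset ?K (gen (\<alpha> p, \<beta> q))"
        by (simp add: tf coset_eq \<beta>h(3))
    qed
    have vlp: "vlinear ?T (\<lambda>p. fcoset ?K (gen (\<alpha> p, \<beta> q)))" for q
      unfolding vlinear_def
    proof (intro conjI allI)
      show "fcoset ?K (gen (\<alpha> p, \<beta> q)) \<in> carrier ?T" for p using \<alpha>h(1) \<beta>h(1) by (simp add: tf)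
      fix p p' c
      have "gen (\<alpha> p \<oplus>\<^bsub>V\<^esub> \<alpha> p', \<beta> q) - gen (\<alpha> p, \<beta> q) - gen (\<alpha> p', \<beta> q) \<in> ?K"
        by (intro subsetD[OF tk(2)] bilinear_relationsI \<alpha>h \<beta>h)
      then show "fcoset ?K (gen (\<alpha> (p + p'), \<beta> q)) = fcoset ?K (gen (\<alpha> p, \<beta> q)) \<oplus>\<^bsub>?T\<^esub> fcoset ?K (gen (\<alpha> p', \<beta> q))"
        by (simp add: tf coset_eq \<alpha>h(2) diff_diff_eq)
      have "gen (c \<odot>\<^bsub>V\<^esub> \<alpha> p, \<beta> q) - fscale c (gen (\<alpha> p, \<beta> q)) \<in> ?K"
        by (intro subsetD[OF tk(2)] bilinear_relationsI \<alpha>h \<beta>h)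
      then show "fcoset ?K (gen (\<alpha> (fscale c p), \<beta> q)) = c \<odot>\<^bsub>?T\<^esub> fcoset ?K (gen (\<alpha> p, \<beta> q))"
        by (simp add: tf coset_eq \<alpha>h(3))
    qed
    have "fcoset ?K (gen (\<alpha> (gen i), \<beta> q)) = \<theta> (kron (gen i) q)" for i
      by (rule vlinear_eqI[OF vlq vlinear_flinear[OF \<theta>lin flinear_kron(2)]]) (simp add: \<theta>_def s_gen)
    then show ?thesis
      by (rule vlinear_eqI[OF vlp vlinear_flinear[OF \<theta>lin flinear_kron(1)]])
  qed
  have act: "act ?T X (\<theta> p) = \<theta> (act (tensor_model m n) X p)" if X: "X \<in> sl2" for X p
  proof (rule vlinear_eqI[of ?T "\<lambda>p. act ?T X (\<theta> p)" "\<lambda>p. \<theta> (act (tensor_model m n) X p)"])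
    have "Poly_Mapping.keys (linear_extension (tensor_action V W X) (s p)) \<subseteq> carrier V \<times> carrier W" for p
    proof (rule keys_linear_extension)
      fix x assume "x \<in> Poly_Mapping.keys (s p)"
      then have "x \<in> carrier V \<times> carrier W" using keys_s by blast
      then show "Poly_Mapping.keys (tensor_action V W X x) \<subseteq> carrier V \<times> carrier W"
        using lie_moduleD(2)[OF V X] lie_moduleD(2)[OF W X]
        by (cases x) (auto simp: tensor_action_def dest!: subsetD[OF keys_add])
    qed
    then show "vlinear ?T (\<lambda>p. act ?T X (\<theta> p))"
      unfolding \<theta>_def actT[OF X] by (intro vl flinear_comp[OF flinear_linear_extension lin_s])
    show "vlinear ?T (\<lambda>p. \<theta> (act (tensor_model m n) X p))"
      by (rule vlinear_flinear[OF \<theta>lin])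
        (simp add: tensor_model_def flinear_def fscale_distribs ac_simps)
    fix x :: "nat \<times> nat"
    obtain i j where x: "x = (i, j)" by (cases x)
    have "act ?T X (\<theta> (gen (i, j))) =
      fcoset ?K (gen (\<alpha> (act (verma_model m) X (gen i)), \<beta> (gen j)) + gen (\<alpha> (gen i), \<beta> (act (verma_model n) X (gen j))))"
      using X by (simp add: \<theta>_def actT s_gen tensor_action_def \<alpha>h(4) \<beta>h(4))
    also have "\<dots> = \<theta> (act (tensor_model m n) X (gen (i, j)))"
      unfolding tensor_model_act_gen by (simp add: \<theta>D pure flip: tf(3))
    finally show "act ?T X (\<theta> (gen x)) = \<theta> (act (tensor_model m n) X (gen x))" by (simp add: x)
  qed
  have surj: "range \<theta> = carrier ?T"
  proof
    show "range \<theta> \<subseteq> carrier ?T" using \<theta>D by blast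
    let ?M = "{r. fcoset ?K r \<in> range \<theta>}"
    have M: "fsubspace ?M"
      unfolding fsubspace_def
    proof (intro conjI ballI allI)
      have "fcoset ?K 0 = \<theta> 0" by (simp add: \<theta>_def flinearD[OF lin_s])
      then show "0 \<in> ?M" by simp
    next
      fix p q assume "p \<in> ?M" "q \<in> ?M"
      then obtain x y where "fcoset ?K p = \<theta> x" "fcoset ?K q = \<theta> y" by auto
      then have "fcoset ?K (p + q) = \<theta> (x + y)" using \<theta>D by (simp flip: tf(3))
      then show "p + q \<in> ?M" by simp
    next
      fix c p assume "p \<in> ?M"
      then obtain x where "fcoset ?K p = \<theta> x" by auto
      then have "fcoset ?K (fscale c p) = \<theta> (fscale c x)" using \<theta>D by (simp flip: tf(4))
      then show "fscale c p \<in> ?M" by simp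
    qed
    have "gen x \<in> ?M" if "x \<in> carrier V \<times> carrier W" for x
    proof -
      obtain v w where x: "x = (v, w)" "v \<in> carrier V" "w \<in> carrier W" using \<open>x \<in> _\<close> by blast
      then have "fcoset ?K (gen x) = \<theta> (kron (\<alpha>' v) (\<beta>' w))"
        using pure[of "\<alpha>' v" "\<beta>' w"] \<alpha>'(3) \<beta>'(3) by simp
      then show ?thesis by simp
    qed
    then have "r \<in> ?M" if "Poly_Mapping.keys r \<subseteq> carrier V \<times> carrier W" for r
      using fsubspace_contains[OF M _ that] by blast
    then show "carrier ?T \<subseteq> range \<theta>" by (auto simp: tf(1))
  qed
  have inj: "inj \<theta>"
  proof (rule injI)
    fix p q assume "\<theta> p = \<theta> q"
    then have pq: "s p - s q \<in> ?K" by (simp add: \<theta>_def fcoset_eq_iff[OF tk(1)])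
    define \<psi> where "\<psi> = linear_extension (\<lambda>(v, w). kron (\<alpha>' v) (\<beta>' w))"
    have lin: "flinear \<psi>" and g: "\<psi> (gen (v, w)) = kron (\<alpha>' v) (\<beta>' w)" for v w
      by (simp_all add: \<psi>_def flinear_linear_extension)
    note l = flinearD[OF lin]
    have "?K \<subseteq> {k. \<psi> k \<in> {0}}"
    proof (rule tk(4))
      show "fsubspace {k. \<psi> k \<in> {0}}" by (rule fsubspace_vimage[OF lin]) (simp add: fsubspace_def)
      show "bilinear_relations V W \<subseteq> {k. \<psi> k \<in> {0}}"
      proof
        fix r assume "r \<in> bilinear_relations V W"
        then show "r \<in> {k. \<psi> k \<in> {0}}"
          by (cases rule: bilinear_relations_cases) (simp_all add: l g \<alpha>h' \<beta>h' kron_linear)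
      qed
    qed simp
    then have "\<psi> (s (p - q)) = 0" using pq by (auto simp: flinearD[OF lin_s])
    moreover have "\<psi> (s p) = p" for p
      by (rule pair_flinear_eqI[of "\<lambda>p. \<psi> (s p)" "\<lambda>p. p"])
        (simp_all add: flinear_comp lin lin_s flinear_ops s_gen g \<alpha>'(2) \<beta>'(2))
    ultimately show "p = q" by simp
  qed
  show T: "lie_module sl2 ?T"
    by (rule sl2_module_image[OF lie_module_tensor_model[of m n], where q = \<theta>])
      (use \<theta>D surj act in \<open>simp_all add: tf(2) \<theta>_def flinearD[OF lin_s]\<close>)
  have "\<theta> \<in> lie_hom sl2 (tensor_model m n) ?T"
    using \<theta>D act by (intro lie_homI) simp_all
  then show "lie_isomorphic sl2 (tensor_model m n) ?T"
    unfolding lie_isomorphic_def using inj surj by (intro bexI[of _ \<theta>]) (simp_all add: bij_betw_def)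
qed

section \<open>The dual\<close>

text \<open>
  The root spaces are the lines through \<open>e\<close> and \<open>f\<close>, so \<open>\<tau> e = a f\<close> for some \<open>a\<close>; as \<open>\<tau>\<close> is an involution,
  \<open>a\<close> is nonzero and \<open>\<tau> f = e / a\<close>.
\<close>

lemma duality_anti_involution_matrices:
  assumes "duality_anti_involution \<tau>"
  obtains a where "a \<noteq> 0" "\<And>X. X \<in> sl2 \<Longrightarrow> \<tau> X = mscale (X$1$1) mat_h + mscale (X$2$1 / a) mat_e + mscale (a * X$1$2) mat_f"
proof -
  note \<tau> = assms[unfolded duality_anti_involution_def]
  have add: "\<tau> (X + Y) = \<tau> X + \<tau> Y" if "X \<in> sl2" "Y \<in> sl2" for X Y using \<tau> that by blast
  have scale: "\<tau> (mscale c X) = mscale c (\<tau> X)" if "X \<in> sl2" for c X using \<tau> that by blast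
  have invol: "\<tau> (\<tau> X) = X" if "X \<in> sl2" for X using \<tau> that by simp
  have h: "\<tau> mat_h = mat_h" using \<tau> mat_in_subalgebras(1) by blast
  have "mat_e \<in> root_space 2"
    unfolding root_space_def using mat_in_sl2
    by (simp add: cartan_def sl2_iff) (simp add: matrix_eq2_iff)
  then have "\<tau> mat_e \<in> root_space (-2)" using \<tau> by blast
  then have te: "\<tau> mat_e \<in> sl2" "commutator mat_h (\<tau> mat_e) = mscale (- 2) (\<tau> mat_e)"
    using mat_in_subalgebras(1) by (auto simp: root_space_def)
  define a where "a = \<tau> mat_e $ 2 $ 1"
  have e: "\<tau> mat_e = mscale a mat_f"
    using te unfolding matrix_eq2_iff by (auto simp: a_def sl2_iff)
  have "mscale a (\<tau> mat_f) = \<tau> (\<tau> mat_e)" unfolding e by (rule scale[symmetric]) simp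
  also have "\<dots> = mat_e" by (rule invol[OF mat_in_sl2(2)])
  finally have ef: "mscale a (\<tau> mat_f) = mat_e" .
  have a: "a \<noteq> 0"
  proof
    assume "a = 0"
    then have "mscale a (\<tau> mat_f) $ 1 $ 2 = 0" by simp
    then show False unfolding ef by simp
  qed
  have "\<tau> mat_f = mscale (1 / a) (mscale a (\<tau> mat_f))" using a by (simp add: matrix_eq2_iff)
  then have f: "\<tau> mat_f = mscale (1 / a) mat_e" unfolding ef .
  have "\<tau> X = mscale (X$1$1) mat_h + mscale (X$2$1 / a) mat_e + mscale (a * X$1$2) mat_f" if X: "X \<in> sl2" for X
  proof -
    have "\<tau> X = \<tau> (mscale (X$1$1) mat_h + mscale (X$1$2) mat_e + mscale (X$2$1) mat_f)"
      using sl2_decomp[OF X] by simp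
    also have "\<dots> = mscale (X$1$1) mat_h + mscale (X$1$2) (mscale a mat_f) + mscale (X$2$1) (mscale (1 / a) mat_e)"
      by (simp add: add scale sl2_closed h e f)
    also have "\<dots> = mscale (X$1$1) mat_h + mscale (X$2$1 / a) mat_e + mscale (a * X$1$2) mat_f"
      by (simp add: matrix_eq2_iff)
    finally show ?thesis .
  qed
  then show thesis using that a by blast
qed

lemma vectorspace_complex_space: "vectorspace complex_ring complex_space"
proof (rule complex_vectorspaceI)
  fix v show "\<exists>w\<in>carrier complex_space. v \<oplus>\<^bsub>complex_space\<^esub> w = \<zero>\<^bsub>complex_space\<^esub>"
    by (rule bexI[of _ "- v"]) simp_all
qed (simp_all add: algebra_simps)

text \<open>
  The bilinear form for which the basis elements are orthonormal.
\<close>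

definition fpair :: "('x \<Rightarrow>\<^sub>0 complex) \<Rightarrow> ('x \<Rightarrow>\<^sub>0 complex) \<Rightarrow> complex" where
  "fpair \<xi> p = free_lift complex_space (Poly_Mapping.lookup p) \<xi>"

lemma vlinear_fpair: "vlinear complex_space (\<lambda>\<xi>. fpair \<xi> p)"
  unfolding fpair_def by (rule vlinear_free_lift[OF vectorspace_complex_space]) simp

lemma fpair_simps [simp]:
  "fpair (\<xi> + \<eta>) p = fpair \<xi> p + fpair \<eta> p" "fpair (fscale c \<xi>) p = c * fpair \<xi> p"
  "fpair (gen x) p = Poly_Mapping.lookup p x" "fpair 0 p = 0"
proof -
  show "fpair (\<xi> + \<eta>) p = fpair \<xi> p + fpair \<eta> p" "fpair (fscale c \<xi>) p = c * fpair \<xi> p" for \<xi> c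
    using vlinear_fpair[of p] by (simp_all add: vlinear_def)
  from this(2)[of 0 0] show "fpair 0 p = 0" by simp
  show "fpair (gen x) p = Poly_Mapping.lookup p x"
    unfolding fpair_def by (rule free_lift_gen[OF vectorspace_complex_space]) simp
qed

lemma fpair_right [simp]:
  "fpair \<xi> (p + q) = fpair \<xi> p + fpair \<xi> q" "fpair \<xi> (fscale c p) = c * fpair \<xi> p"
  "fpair \<xi> (gen x) = Poly_Mapping.lookup \<xi> x"
proof -
  have k: "Poly_Mapping.keys \<xi> \<subseteq> UNIV" by simp
  from k show "fpair \<xi> (p + q) = fpair \<xi> p + fpair \<xi> q"
    by (induction \<xi> rule: free_induct) (simp_all add: lookup_add distrib_left)
  from k show "fpair \<xi> (fscale c p) = c * fpair \<xi> p"
    by (induction \<xi> rule: free_induct) (simp_all add: distrib_left mult.left_commute)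
  from k show "fpair \<xi> (gen x) = Poly_Mapping.lookup \<xi> x"
    by (induction \<xi> rule: free_induct) (simp_all add: lookup_add lookup_gen eq_commute)
qed

lemma fpair_nonzero:
  assumes "fpair \<xi> p \<noteq> 0"
  shows "\<exists>x\<in>Poly_Mapping.keys \<xi>. Poly_Mapping.lookup p x \<noteq> 0"
proof (rule ccontr)
  assume *: "\<not> ?thesis"
  have "Poly_Mapping.keys \<xi> \<subseteq> Poly_Mapping.keys \<xi>" by simp
  then have "fpair \<xi> p = 0"
    by (induction \<xi> rule: free_induct[where A = "Poly_Mapping.keys \<xi>"]) (use * in auto)
  then show False using assms by simp
qed

lemma fpair_adjoint:
  "fpair (tensor_h m n \<xi>) p = fpair \<xi> (tensor_h m n p)"
  "fpair (cotensor_e \<xi>) p = fpair \<xi> (tensor_f p)"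
  "fpair (cotensor_f m n \<xi>) p = fpair \<xi> (tensor_e m n p)"
proof -
  have *: "fpair (g \<xi>) p = fpair \<xi> (g' p)"
    if g: "flinear g" "\<And>i j. fpair (g (gen (i, j))) p = Poly_Mapping.lookup (g' p) (i, j)"
    for g g' :: "(nat \<times> nat \<Rightarrow>\<^sub>0 complex) \<Rightarrow> (nat \<times> nat \<Rightarrow>\<^sub>0 complex)"
  proof (rule vlinear_eqI[OF vlinear_flinear[OF vlinear_fpair g(1)] vlinear_fpair])
    fix x :: "nat \<times> nat"
    show "fpair (g (gen x)) p = fpair (gen x) (g' p)" using g(2) by (cases x) simp
  qed
  show "fpair (tensor_h m n \<xi>) p = fpair \<xi> (tensor_h m n p)"
    by (rule *) (simp_all add: lookup_tensor_h del: of_nat_add)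
  show "fpair (cotensor_e \<xi>) p = fpair \<xi> (tensor_f p)"
    by (rule *) (simp_all add: lookup_tensor_f)
  show "fpair (cotensor_f m n \<xi>) p = fpair \<xi> (tensor_e m n p)"
    by (rule *) (simp_all add: lookup_tensor_e del: of_nat_Suc)
qed

lemma dual_module_simps:
  "carrier (dual_module \<tau> V) = {f \<in> module_hom complex_ring V complex_space.
     f \<in> extensional (carrier V) \<and> finite {\<nu>. \<exists>v\<in>weight_space V \<nu>. f v \<noteq> 0}}"
  "zero (dual_module \<tau> V) = (\<lambda>v\<in>carrier V. 0)"
  "add (dual_module \<tau> V) f g = (\<lambda>v\<in>carrier V. f v + g v)"
  "smult (dual_module \<tau> V) c f = (\<lambda>v\<in>carrier V. c * f v)"
  "act (dual_module \<tau> V) X f = (\<lambda>v\<in>carrier V. f (act V (\<tau> X) v))"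
  by (simp_all add: dual_module_def)

text \<open>
  A weight space of the tensor product is spanned by the finitely many basis elements of one degree.
  Hence a linear form that vanishes on all but finitely many weight spaces vanishes on all but
  finitely many basis elements, and is the pairing with a unique finitely supported function.
\<close>

theorem dual_isomorphic_cotensor_model:
  assumes \<tau>: "duality_anti_involution \<tau>" and T: "lie_module sl2 T" and iso: "lie_isomorphic sl2 (tensor_model m n) T"
  obtains a where "a \<noteq> 0" "lie_module sl2 (dual_module \<tau> T)"
    "lie_isomorphic sl2 (cotensor_model a m n) (dual_module \<tau> T)"
proof -
  obtain a where a: "a \<noteq> 0" and \<tau>a: "\<And>X. X \<in> sl2 \<Longrightarrow>
      \<tau> X = mscale (X$1$1) mat_h + mscale (X$2$1 / a) mat_e + mscale (a * X$1$2) mat_f"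
    using duality_anti_involution_matrices[OF \<tau>] by blast
  let ?D = "dual_module \<tau> T"
  obtain \<theta> where \<theta>: "\<theta> \<in> lie_hom sl2 (tensor_model m n) T" "bij_betw \<theta> UNIV (carrier T)"
    using iso by (auto simp: lie_isomorphic_def)
  obtain \<kappa> where \<kappa>: "\<kappa> \<in> lie_hom sl2 T (tensor_model m n)" "\<And>p. \<kappa> (\<theta> p) = p" "\<And>v. v \<in> carrier T \<Longrightarrow> \<theta> (\<kappa> v) = v"
    using lie_hom_inverse[OF lie_module_tensor_model \<theta>(1)] \<theta>(2) by auto
  note \<theta>h = lie_homD[OF \<theta>(1), simplified] and \<kappa>h = lie_homD[OF \<kappa>(1), simplified]
  note s = lie_module_space[OF T] and d = lie_moduleD[OF T]
  note ds = dual_module_simps[of \<tau> T]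
  define \<Delta> where "\<Delta> \<xi> = (\<lambda>v\<in>carrier T. fpair \<xi> (\<kappa> v))" for \<xi>
  have mem: "\<Delta> \<xi> \<in> carrier ?D" for \<xi>
  proof -
    have "\<Delta> \<xi> \<in> module_hom complex_ring T complex_space"
      by (simp add: \<Delta>_def module_hom_def s \<kappa>h)
    moreover have "\<Delta> \<xi> \<in> extensional (carrier T)" by (simp add: \<Delta>_def)
    moreover have "{\<nu>. \<exists>v\<in>weight_space T \<nu>. \<Delta> \<xi> v \<noteq> 0} \<subseteq> (\<lambda>(i, j). m + n - 2 * of_nat (i + j)) ` Poly_Mapping.keys \<xi>"
    proof clarify
      fix \<nu> v assume v: "v \<in> weight_space T \<nu>" and nz: "\<Delta> \<xi> v \<noteq> 0"
      have vc: "v \<in> carrier T" and hv: "act T mat_h v = \<nu> \<odot>\<^bsub>T\<^esub> v" using v by (simp_all add: weight_space_def)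
      have "fpair \<xi> (\<kappa> v) \<noteq> 0" using nz vc by (simp add: \<Delta>_def)
      then obtain i j where ij: "(i, j) \<in> Poly_Mapping.keys \<xi>" "Poly_Mapping.lookup (\<kappa> v) (i, j) \<noteq> 0"
        using fpair_nonzero by force
      have "tensor_h m n (\<kappa> v) = fscale \<nu> (\<kappa> v)" using \<kappa>h(4)[of mat_h v] \<kappa>h(3)[of v \<nu>] hv vc by simp
      then have "Poly_Mapping.lookup (tensor_h m n (\<kappa> v)) (i, j) = \<nu> * Poly_Mapping.lookup (\<kappa> v) (i, j)" by simp
      then have "\<nu> = m + n - 2 * of_nat (i + j)" using ij(2) unfolding lookup_tensor_h by simp
      then show "\<nu> \<in> (\<lambda>(i, j). m + n - 2 * of_nat (i + j)) ` Poly_Mapping.keys \<xi>" using ij(1) by force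
    qed
    then have "finite {\<nu>. \<exists>v\<in>weight_space T \<nu>. \<Delta> \<xi> v \<noteq> 0}" by (rule finite_subset) simp
    ultimately show ?thesis by (simp add: ds)
  qed
  have act: "act ?D X (\<Delta> \<xi>) = \<Delta> (act (cotensor_model a m n) X \<xi>)" if X: "X \<in> sl2" for X \<xi>
  proof -
    have \<tau>X: "\<tau> X \<in> sl2" using \<tau> X by (auto simp: duality_anti_involution_def)
    have entries: "\<tau> X $ 1 $ 1 = X$1$1" "\<tau> X $ 1 $ 2 = X$2$1 / a" "\<tau> X $ 2 $ 1 = a * X$1$2"
      by (simp_all add: \<tau>a[OF X])
    have "fpair \<xi> (\<kappa> (act T (\<tau> X) v)) = fpair (act (cotensor_model a m n) X \<xi>) (\<kappa> v)" if v: "v \<in> carrier T" for v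
      unfolding \<kappa>h(4)[OF \<tau>X v]
      by (simp add: tensor_model_def cotensor_model_def entries fpair_adjoint)
    then show ?thesis
      unfolding \<Delta>_def ds(5) by (intro restrict_ext) (simp add: d(2)[OF \<tau>X])
  qed
  have add: "\<Delta> \<xi> \<oplus>\<^bsub>?D\<^esub> \<Delta> \<eta> = \<Delta> (\<xi> + \<eta>)" and scale: "c \<odot>\<^bsub>?D\<^esub> \<Delta> \<xi> = \<Delta> (fscale c \<xi>)" for \<xi> \<eta> c
    unfolding ds \<Delta>_def by (auto intro!: restrict_ext)
  have surj: "range \<Delta> = carrier ?D"
  proof
    show "range \<Delta> \<subseteq> carrier ?D" using mem by blast
    show "carrier ?D \<subseteq> range \<Delta>"
    proof
      fix g assume "g \<in> carrier ?D"
      then have g: "g \<in> module_hom complex_ring T complex_space" "g \<in> extensional (carrier T)"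
        and fin: "finite {\<nu>. \<exists>v\<in>weight_space T \<nu>. g v \<noteq> 0}" by (simp_all add: ds)
      let ?N = "{\<nu>. \<exists>v\<in>weight_space T \<nu>. g v \<noteq> 0}"
      let ?S = "{x. g (\<theta> (gen x)) \<noteq> 0}"
      have wt: "\<theta> (gen (i, j)) \<in> weight_space T (m + n - 2 * of_nat (i + j))" for i j
      proof -
        have "act T H (\<theta> (gen (i, j))) = ((m + n - 2 * of_nat (i + j)) * H$1$1) \<odot>\<^bsub>T\<^esub> \<theta> (gen (i, j))"
          if H: "H \<in> cartan" for H
        proof -
          have "H = mscale (H$1$1) mat_h" using H by (simp add: cartan_iff)
          then have "act T H (\<theta> (gen (i, j))) = H$1$1 \<odot>\<^bsub>T\<^esub> act T mat_h (\<theta> (gen (i, j)))"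
            using d(6)[OF mat_in_sl2(1) \<theta>h(1)] by metis
          also have "act T mat_h (\<theta> (gen (i, j))) = (m + n - 2 * of_nat (i + j)) \<odot>\<^bsub>T\<^esub> \<theta> (gen (i, j))"
            using \<theta>h(4)[of mat_h "gen (i, j)"] \<theta>h(3) by (simp del: of_nat_add)
          finally show ?thesis using s(9) \<theta>h(1) by (simp add: mult.commute del: of_nat_add)
        qed
        then show ?thesis using \<theta>h(1) by (simp add: weight_space_def)
      qed
      have "?S \<subseteq> (\<Union>k\<in>{k. m + n - 2 * of_nat k \<in> ?N}. {..k} \<times> {..k})"
      proof
        fix x assume x: "x \<in> ?S"
        obtain i j where ij: "x = (i, j)" by (cases x)
        have "m + n - 2 * of_nat (i + j) \<in> ?N" using wt[of i j] x ij by blast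
        then show "x \<in> (\<Union>k\<in>{k. m + n - 2 * of_nat k \<in> ?N}. {..k} \<times> {..k})"
          unfolding ij by (intro UN_I[of "i + j"]) auto
      qed
      moreover have "finite (\<Union>k\<in>{k. m + n - 2 * of_nat k \<in> ?N}. {..k} \<times> {..k})"
      proof (rule finite_UN_I)
        have "inj_on (\<lambda>k :: nat. m + n - 2 * of_nat k) UNIV" by (auto simp: inj_on_def)
        from finite_vimage_IntI[OF fin this] show "finite {k :: nat. m + n - 2 * of_nat k \<in> ?N}"
          by (simp add: vimage_def)
      qed simp
      ultimately have finS: "finite ?S" by (rule finite_subset)
      define \<xi> where "\<xi> = Abs_poly_mapping (\<lambda>x. g (\<theta> (gen x)))"
      have look: "Poly_Mapping.lookup \<xi> x = g (\<theta> (gen x))" for x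
        unfolding \<xi>_def using finS by simp
      have "g (\<theta> p) = fpair \<xi> p" for p
      proof (rule vlinear_eqI[of complex_space "\<lambda>p. g (\<theta> p)" "\<lambda>p. fpair \<xi> p"])
        show "vlinear complex_space (\<lambda>p. g (\<theta> p))"
          using g(1) \<theta>h by (simp add: vlinear_def module_hom_def)
        show "vlinear complex_space (fpair \<xi>)" by (simp add: vlinear_def)
      qed (simp add: look)
      then have "g = \<Delta> \<xi>"
        using g(2) \<kappa>(3) by (intro extensionalityI[of _ "carrier T"]) (simp_all add: \<Delta>_def, metis)
      then show "g \<in> range \<Delta>" by blast
    qed
  qed
  have inj: "inj \<Delta>"
  proof (rule injI)
    fix \<xi> \<eta> assume eq: "\<Delta> \<xi> = \<Delta> \<eta>"
    show "\<xi> = \<eta>"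
    proof (rule poly_mapping_eqI)
      fix x
      from fun_cong[OF eq, of "\<theta> (gen x)"] show "Poly_Mapping.lookup \<xi> x = Poly_Mapping.lookup \<eta> x"
        by (simp add: \<Delta>_def \<theta>h(1) \<kappa>(2))
    qed
  qed
  note C = lie_module_cotensor_model[OF a, of m n]
  have D: "lie_module sl2 ?D"
    by (rule sl2_module_image[OF C, where q = \<Delta>]) (simp_all add: surj act add scale, simp add: ds(2) \<Delta>_def)
  have "\<Delta> \<in> lie_hom sl2 (cotensor_model a m n) ?D"
    by (rule lie_homI) (simp_all add: mem add scale act)
  then have "lie_isomorphic sl2 (cotensor_model a m n) ?D"
    unfolding lie_isomorphic_def using inj surj by (intro bexI[of _ \<Delta>]) (simp_all add: bij_betw_def)
  then show thesis using that a D by blast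
qed

section \<open>The equivalence\<close>

theorem corollary1p4:
  fixes \<mu>' \<mu>'' :: complex
    and \<tau> :: "complex^2^2 \<Rightarrow> complex^2^2"
    and emb :: "(nat \<Rightarrow>\<^sub>0 complex) \<Rightarrow> 'n"
  assumes "duality_anti_involution \<tau>"
    and "inj emb" \<comment> \<open>HOL cannot quantify over types inside (i), so \<open>N\<close> has its carrier in
      an arbitrary type \<open>'n\<close> in which every module of countable dimension has an isomorphic copy\<close>
  shows
    "let T = tensor_product (verma \<mu>') (verma \<mu>'');
         i = (\<forall>N :: 'n lmodule. category_O N \<and> simple_module sl2 N \<longrightarrow> dim_hom_le_1 sl2 N T);
         ii = (\<forall>\<nu>. dim_hom_le_1 sl2 (verma \<nu>) T);
         iii = lie_isomorphic sl2 (dual_module \<tau> T) T;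
         iv = (\<not> (\<exists>\<nu>. reducible_module sl2 (verma \<nu>) \<and> has_direct_summand sl2 T (verma \<nu>)))
     in (i \<longleftrightarrow> ii) \<and> (ii \<longleftrightarrow> iii) \<and> (iii \<longleftrightarrow> iv)"
proof -
  define T where "T = tensor_product (verma \<mu>') (verma \<mu>'')"
  let ?M = "tensor_model \<mu>' \<mu>''" and ?P = "\<not> (\<mu>' \<in> \<nat> \<and> \<mu>'' \<in> \<nat>)"
  note M = lie_module_tensor_model[of \<mu>' \<mu>''] and V = lie_module_verma and VM = lie_module_verma_model
  have T: "lie_module sl2 T" and MT: "lie_isomorphic sl2 ?M T"
    unfolding T_def by (rule tensor_product_isomorphic_model[OF V V verma_isomorphic_model verma_isomorphic_model])+
  have TM: "lie_isomorphic sl2 T ?M" by (rule lie_isomorphic_sym[OF M MT])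
  note VMV = verma_isomorphic_model and VVM = lie_isomorphic_sym[OF VM verma_isomorphic_model]
  have hom: "dim_hom_le_1 sl2 N T \<longleftrightarrow> dim_hom_le_1 sl2 N' ?M"
    if "lie_module sl2 N" "lie_module sl2 N'" "lie_isomorphic sl2 N N'"
    for N :: "'v lmodule" and N' :: "'w lmodule"
    using dim_hom_le_1_iso[OF that(1) T that(2) M that(3) TM]
      dim_hom_le_1_iso[OF that(2) M that(1) T lie_isomorphic_sym[OF that(1,3)] MT] by blast
  have ii: "(\<forall>\<nu>. dim_hom_le_1 sl2 (verma \<nu>) T) \<longleftrightarrow> ?P"
    unfolding hom[OF V VM VVM] using dim_hom_tensor_model dim_hom_tensor_model_fails by blast
  have i: "(\<forall>N :: 'n lmodule. category_O N \<and> simple_module sl2 N \<longrightarrow> dim_hom_le_1 sl2 N T) \<longleftrightarrow> ?P"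
  proof
    assume ?P
    then have "dim_hom_le_1 sl2 (verma_model \<nu>) T" for \<nu>
      using hom[OF VM VM lie_isomorphic_refl[OF VM]] dim_hom_tensor_model by blast
    then show "\<forall>N :: 'n lmodule. category_O N \<and> simple_module sl2 N \<longrightarrow> dim_hom_le_1 sl2 N T"
      using dim_hom_simple[OF T] by blast
  next
    assume i: "\<forall>N :: 'n lmodule. category_O N \<and> simple_module sl2 N \<longrightarrow> dim_hom_le_1 sl2 N T"
    show ?P
    proof
      assume \<mu>: "\<mu>' \<in> \<nat> \<and> \<mu>'' \<in> \<nat>"
      let ?\<nu> = "- \<mu>' - \<mu>'' - 2"
      obtain N :: "'n lmodule" where N: "category_O N" "simple_module sl2 N" "lie_module sl2 N"
        "lie_isomorphic sl2 (verma_model ?\<nu>) N"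
        using simple_verma_copy[OF \<open>inj emb\<close> minus_Nats_not_Nats] \<mu> by blast
      have "dim_hom_le_1 sl2 (verma_model ?\<nu>) ?M"
        using i N hom[OF N(3) VM lie_isomorphic_sym[OF VM N(4)]] by blast
      then show False using dim_hom_tensor_model_fails \<mu> by blast
    qed
  qed
  have iii: "lie_isomorphic sl2 (dual_module \<tau> T) T \<longleftrightarrow> ?P"
  proof -
    obtain a where a: "a \<noteq> 0" and D: "lie_module sl2 (dual_module \<tau> T)"
      and CD: "lie_isomorphic sl2 (cotensor_model a \<mu>' \<mu>'') (dual_module \<tau> T)"
      using dual_isomorphic_cotensor_model[OF assms(1) T MT] by blast
    note C = lie_module_cotensor_model[OF a, of \<mu>' \<mu>'']
    have "lie_isomorphic sl2 (dual_module \<tau> T) T \<longleftrightarrow> lie_isomorphic sl2 (cotensor_model a \<mu>' \<mu>'') ?M"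
    proof
      assume "lie_isomorphic sl2 (dual_module \<tau> T) T"
      then show "lie_isomorphic sl2 (cotensor_model a \<mu>' \<mu>'') ?M"
        using lie_isomorphic_trans[OF C CD lie_isomorphic_trans[OF D _ TM]] by blast
    next
      assume "lie_isomorphic sl2 (cotensor_model a \<mu>' \<mu>'') ?M"
      then show "lie_isomorphic sl2 (dual_module \<tau> T) T"
        using lie_isomorphic_trans[OF D lie_isomorphic_sym[OF C CD] lie_isomorphic_trans[OF C _ MT]] by blast
    qed
    then show ?thesis using self_dual_tensor_model[OF a] not_self_dual_tensor_model[OF a] by blast
  qed
  have iv: "\<not> (\<exists>\<nu>. reducible_module sl2 (verma \<nu>) \<and> has_direct_summand sl2 T (verma \<nu>)) \<longleftrightarrow> ?P"
  proof -
    have red: "reducible_module sl2 (verma \<nu>) \<longleftrightarrow> \<nu> \<in> \<nat>" for \<nu>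
      using reducible_module_iso[OF V VM VVM] reducible_module_iso[OF VM V VMV] reducible_verma_model_iff by blast
    have sum: "has_direct_summand sl2 T (verma \<nu>) \<longleftrightarrow> has_direct_summand sl2 ?M (verma_model \<nu>)" for \<nu>
      using has_direct_summand_iso[OF T M V VM TM VVM] has_direct_summand_iso[OF M T VM V MT VMV] by blast
    have "\<exists>\<nu>\<in>\<nat>. has_direct_summand sl2 ?M (verma_model \<nu>)" if "\<mu>' \<in> \<nat>" "\<mu>'' \<in> \<nat>"
    proof -
      obtain k l where "\<mu>' = of_nat k" "\<mu>'' = of_nat l" using \<open>\<mu>' \<in> \<nat>\<close> \<open>\<mu>'' \<in> \<nat>\<close> by (auto elim!: Nats_cases)
      then show ?thesis using verma_summand[of k l] by (intro bexI[of _ "\<mu>' + \<mu>''"]) auto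
    qed
    then show ?thesis unfolding red sum using no_reducible_summand by blast
  qed
  show ?thesis
    unfolding Let_def T_def[symmetric] using i ii iii iv by blast
qed

end
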